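(* Suppose $A$ is a field and $\Gamma$ is a finite-type Mitchell coalgebra over $A$. Then: (1) The filtered ideal sets $\mathrm{dist}$ and $\mathrm{grad}$ in $\Gamma^*$ are equivalent. In particular, $\mathrm{dist}$ is closed. (2) The functor $h^0_{\mathrm{dist}}:\mathrm{gr\,Mod}(\Gamma^* )\to\mathrm{gr\,Ab}$ is equivalent to the composite of $H^0_{\mathrm{dist}}:\mathrm{gr\,Mod}(\Gamma^* )\to\mathrm{gr\,Mod}(\Gamma^* )$ with the forgetful functor $\mathrm{gr\,Mod}(\Gamma^* )\to\mathrm{gr\,Ab}$. (3) For every integer $n$, the distinguished local cohomology $H^n_{\mathrm{dist}}(M)$ of a graded $\Gamma^*$-module $M$ is naturally isomorphic, as an abelian group, to $\mathrm{colim}_{I\in\mathrm{dist}}\,\mathrm{Ext}^n_{\Gamma^*}(\Gamma^*/I,M)$. (4) For every integer $n$, the distinguished local cohomology $H^n_{\mathrm{dist}}(M)$ of a graded $\Gamma^*$-module $M$ is naturally isomorphic, as an abelian group, to $\mathrm{colim}_{j\to\infty}\,\mathrm{Ext}^n_{\Gamma^*}(\Gamma^*/I_j,M)$, where $I_j$ is the left ideal of $\Gamma^*$ generated by all homogeneous elements of degree $\geq j$.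
   Context: Gradings are $\mathbb{Z}$-gradings; modules are left modules and comodules are right comodules. $\Gamma^*$ is the graded dual algebra, with degree $n$ summand $\mathrm{Hom}_A(\Gamma^{-n},A)$ and the convolution product. Finite-type means finite-dimensional over $A$ in each degree. $\mathrm{Ext}^n_{\Gamma^*}(L,-)$ denotes the $n$th right derived functor of $\underline{\mathrm{hom}}_{\Gamma^*}(L,-)$, the graded abelian group with degree $d$ part the degree-preserving $\Gamma^*$-linear maps $\Sigma^dL\to -$. $\iota\Gamma$ is $\Gamma$ with the adjoint left $\Gamma^*$-action: $f\in\Gamma^*$ acts by $\Gamma\xrightarrow{\Delta}\Gamma\otimes_A\Gamma\xrightarrow{\Gamma\otimes f}\Gamma\otimes_A A\cong\Gamma$. Ideal sets. An ideal set in a graded ring $R$ is a set of homogeneous proper left ideals of $R$. It is filtered if any two members contain a common member. Write $S\leq S'$ if every $I\in S$ contains some $J\in S'$; $S,S'$ are equivalent if $S\leq S'$ and $S'\leq S$. For $S$ filtered, $h^0_S(M)=\mathrm{colim}_{I\in S}\underline{\mathrm{hom}}_R(R/I,M)$, i.e. the graded subgroup of $M$ generated by the homogeneous elements annihilated by some $I\in S$; $H^0_S(M)$ is the graded $R$-submodule of $M$ generated by $h^0_S(M)$. $S$ is closed if $h^0_S(M)\hookrightarrow H^0_S(M)$ is an isomorphism for all graded $R$-modules $M$. In $\Gamma^*$: a homogeneous left ideal is strongly distinguished if it is the left annihilator of a nonzero homogeneous element of $\iota\Gamma$; $\mathrm{dist}$ is the set of all finite intersections of strongly distinguished left ideals;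 $\mathrm{grad}=\{I_1,I_2,I_3,\dots\}$. $h^0_{\mathrm{dist}},H^0_{\mathrm{dist}}$ are the functors $h^0_S,H^0_S$ for $R=\Gamma^*$ and $S=\mathrm{dist}$; $H^n_{\mathrm{dist}}=R^nH^0_{\mathrm{dist}}$. Poincaré algebra over $A$: a finite-dimensional graded connected $A$-algebra $B$ (trivial in negative degrees, one-dimensional in degree $0$) with, for some $d$, a linear map $e:B^d\to A$ such that $B^q\otimes_A B^{d-q}\to B^d\xrightarrow{e}A$ is a nonsingular pairing for all $q$. Mitchell coalgebra: a graded $A$-coalgebra $\Gamma$ admitting a Mitchell decomposition, that is, the following data: - A sequence $\dots\to\Gamma(2)\to\Gamma(1)\to\Gamma(0)$ of surjective graded $A$-coalgebra morphisms, with each $\Gamma(n)$ a graded quotient $A$-coalgebra of $\Gamma$, such that each dual algebra $\Gamma^*(n)=\Gamma(n)^*$ is a Poincaré algebra, and such that the left $\Gamma^*(n)$-action on $\Gamma^*(n+1)$ arising from the dual map $\Gamma^*(n)\to\Gamma^*(n+1)$ makes $\Gamma^*(n+1)$ flat over $\Gamma^*(n)$. - For each $n\geq0$, a homogeneous element $\omega_n\in\Gamma(n)$; evaluation at $\omega_n$ is a linear functional $e$ on $\Gamma^*(n)$ supported in a single degree, denoted $|\omega_n|$; it is required that the pairing $\Gamma^*(n)^q\otimes_A\Gamma^*(n)^{|\omega_n|-q}\to\Gamma^*(n)^{|\omega_n|}\xrightarrow{e}A$ be nonsingular. - For each $n\geq0$, an extension of the natural graded left $\Gamma^*(n)$-module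 structure on $\Gamma^*(n)$ to a graded left action of $\Gamma^*$ on $\Gamma^*(n)$, together with graded left $\Gamma^*(n)$-module homomorphisms $\sigma_n:\Gamma^*\to\Gamma^*(n)$ and $\sigma_{n,n+1}:\Gamma^*(n+1)\to\Gamma^*(n)$ such that: (i) the composite of the injection $\Gamma^*(n)\hookrightarrow\Gamma^*$ (dual to $\Gamma\to\Gamma(n)$) with $\sigma_n$ is the identity; (ii) the duality isomorphism $\Gamma^*(n)\cong\Sigma^{|\omega_n|}\Gamma^*(n)^*$ of graded left $\Gamma^*(n)$-modules, adjoint to the pairing $\Gamma^*(n)^q\otimes_A\Gamma^*(n)^{|\omega_n|-q}\to\Gamma^*(n)^{|\omega_n|}\xrightarrow{e}A$, is an isomorphism of graded left $\Gamma^*$-modules; (iii) $\sigma_{n,n+1}\circ\sigma_{n+1}=\sigma_n$ for all $n$; (iv) the resulting graded left $\Gamma^*$-module homomorphism $\Gamma^*\to\lim_n\Gamma^*(n)$ is an isomorphism. *)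

theory Defs
  imports "HOL-Algebra.Module" "HOL-Algebra.Coset" "HOL-Algebra.Generated_Groups"
begin

text \<open>
  Conventions. All gradings are by the integers and are external: a graded object is the family
  of its homogeneous components. The component of degree \<open>n\<close> of a graded abelian group is a
  commutative group in the sense of \<^locale>\<open>comm_group\<close>, so the group law is \<open>\<otimes>\<close> and the neutral
  element is \<open>\<one>\<close> although the group is thought of additively. Morphisms are families of maps;
  their values outside the carriers carry no information. No Koszul signs are used, neither in
  suspensions nor in convolution products.
\<close>

section \<open>Graded abelian groups, graded rings and graded modules\<close>

type_synonym 'x ggrp = "int \<Rightarrow> 'x monoid"

definition ggroup :: "'x ggrp \<Rightarrow> bool" where
  "ggroup G \<longleftrightarrow> (\<forall>n. comm_group (G n))"

definition ghom :: "'x ggrp \<Rightarrow> 'y ggrp \<Rightarrow> (int \<Rightarrow> 'x \<Rightarrow> 'y) set" where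
  "ghom G H = {f. \<forall>n. f n \<in> hom (G n) (H n)}"

definition giso :: "'x ggrp \<Rightarrow> 'y ggrp \<Rightarrow> (int \<Rightarrow> 'x \<Rightarrow> 'y) set" where
  "giso G H = {f. \<forall>n. f n \<in> iso (G n) (H n)}"

record 'r gring =
  rgrp :: "int \<Rightarrow> 'r monoid"
  rmul :: "int \<Rightarrow> int \<Rightarrow> 'r \<Rightarrow> 'r \<Rightarrow> 'r"  \<comment> \<open>\<open>rmul R p q : R\<^sup>p \<times> R\<^sup>q \<rightarrow> R\<^sup>p\<^sup>+\<^sup>q\<close>\<close>
  rone :: 'r

record ('r, 'x) gmod =
  mgrp :: "int \<Rightarrow> 'x monoid"
  act :: "int \<Rightarrow> int \<Rightarrow> 'r \<Rightarrow> 'x \<Rightarrow> 'x"   \<comment> \<open>\<open>act M p q : R\<^sup>p \<times> M\<^sup>q \<rightarrow> M\<^sup>p\<^sup>+\<^sup>q\<close>\<close>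

definition gmodule :: "'r gring \<Rightarrow> ('r, 'x) gmod \<Rightarrow> bool" where
  "gmodule R M \<longleftrightarrow>
     ggroup (mgrp M) \<and>
     (\<forall>p q. \<forall>r\<in>carrier (rgrp R p). act M p q r \<in> hom (mgrp M q) (mgrp M (p + q))) \<and>
     (\<forall>p q. \<forall>r\<in>carrier (rgrp R p). \<forall>s\<in>carrier (rgrp R p). \<forall>x\<in>carrier (mgrp M q).
        act M p q (r \<otimes>\<^bsub>rgrp R p\<^esub> s) x = act M p q r x \<otimes>\<^bsub>mgrp M (p + q)\<^esub> act M p q s x) \<and>
     (\<forall>p q n. \<forall>r\<in>carrier (rgrp R p). \<forall>s\<in>carrier (rgrp R q). \<forall>x\<in>carrier (mgrp M n).
        act M (p + q) n (rmul R p q r s) x = act M p (q + n) r (act M q n s x)) \<and>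
     (\<forall>n. \<forall>x\<in>carrier (mgrp M n). act M 0 n (rone R) x = x)"

definition reg :: "'r gring \<Rightarrow> ('r, 'r) gmod" where
  "reg R = \<lparr>mgrp = rgrp R, act = rmul R\<rparr>"

text \<open>
  The module axioms for \<open>reg R\<close> comprise distributivity on both sides, associativity and the left
  unit law.
\<close>

definition graded_ring :: "'r gring \<Rightarrow> bool" where
  "graded_ring R \<longleftrightarrow>
     rone R \<in> carrier (rgrp R 0) \<and> gmodule R (reg R) \<and>
     (\<forall>p. \<forall>r\<in>carrier (rgrp R p). rmul R p 0 r (rone R) = r)"

text \<open>Graded right modules over \<open>R\<close> are treated as graded left modules over the opposite ring.\<close>

definition opposite :: "'r gring \<Rightarrow> 'r gring" where
  "opposite R = \<lparr>rgrp = rgrp R, rmul = (\<lambda>p q r s. rmul R q p s r), rone = rone R\<rparr>"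

definition mhom :: "'r gring \<Rightarrow> ('r, 'x) gmod \<Rightarrow> ('r, 'y) gmod \<Rightarrow> (int \<Rightarrow> 'x \<Rightarrow> 'y) set" where
  "mhom R M N = {f \<in> ghom (mgrp M) (mgrp N).
     \<forall>p q. \<forall>r\<in>carrier (rgrp R p). \<forall>x\<in>carrier (mgrp M q).
       f (p + q) (act M p q r x) = act N p q r (f q x)}"

definition miso :: "'r gring \<Rightarrow> ('r, 'x) gmod \<Rightarrow> ('r, 'y) gmod \<Rightarrow> (int \<Rightarrow> 'x \<Rightarrow> 'y) set" where
  "miso R M N = mhom R M N \<inter> giso (mgrp M) (mgrp N)"

definition res_scalars ::
  "(int \<Rightarrow> 's \<Rightarrow> 'r) \<Rightarrow> ('r, 'x) gmod \<Rightarrow> ('s, 'x) gmod" where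
  "res_scalars \<phi> M = \<lparr>mgrp = mgrp M, act = (\<lambda>p q s. act M p q (\<phi> p s))\<rparr>"

definition susp :: "int \<Rightarrow> ('r, 'x) gmod \<Rightarrow> ('r, 'x) gmod" where
  "susp d M = \<lparr>mgrp = (\<lambda>n. mgrp M (n - d)), act = (\<lambda>p n. act M p (n - d))\<rparr>"

definition gsubmodule :: "'r gring \<Rightarrow> ('r, 'x) gmod \<Rightarrow> (int \<Rightarrow> 'x set) \<Rightarrow> bool" where
  "gsubmodule R M N \<longleftrightarrow>
     (\<forall>n. subgroup (N n) (mgrp M n)) \<and>
     (\<forall>p q. \<forall>r\<in>carrier (rgrp R p). \<forall>x\<in>N q. act M p q r x \<in> N (p + q))"

definition gspan :: "'r gring \<Rightarrow> ('r, 'x) gmod \<Rightarrow> (int \<Rightarrow> 'x set) \<Rightarrow> int \<Rightarrow> 'x set" where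
  "gspan R M X n = (\<Inter>N\<in>{N. gsubmodule R M N \<and> (\<forall>k. X k \<subseteq> N k)}. N n)"

definition submod :: "('r, 'x) gmod \<Rightarrow> (int \<Rightarrow> 'x set) \<Rightarrow> ('r, 'x) gmod" where
  "submod M N = \<lparr>mgrp = (\<lambda>n. (mgrp M n)\<lparr>carrier := N n\<rparr>), act = act M\<rparr>"

text \<open>
  The map on cosets induced by \<open>h\<close>: the coset of \<open>z\<close> goes to the coset of \<open>h z\<close> modulo the
  subgroup \<open>B\<close> of \<open>G\<close>. If \<open>h\<close> is compatible with the subgroups, all members of the union agree.
\<close>

definition coset_map :: "'y monoid \<Rightarrow> 'y set \<Rightarrow> ('x \<Rightarrow> 'y) \<Rightarrow> 'x set \<Rightarrow> 'y set" where
  "coset_map G B h X = (\<Union>z\<in>X. B #>\<^bsub>G\<^esub> h z)"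

definition quot_mod :: "('r, 'x) gmod \<Rightarrow> (int \<Rightarrow> 'x set) \<Rightarrow> ('r, 'x set) gmod" where
  "quot_mod M N =
     \<lparr>mgrp = (\<lambda>n. mgrp M n Mod N n),
      act = (\<lambda>p q r. coset_map (mgrp M (p + q)) (N (p + q)) (act M p q r))\<rparr>"


section \<open>Formal sums and tensor products\<close>

text \<open>
  Tensors are represented by formal sums (lists) of symbols. \<open>fsum_eq Q\<close> is the congruence on the
  commutative monoid of formal sums generated by the relations in \<open>Q\<close>.
\<close>

inductive fsum_eq :: "('s list \<times> 's list) set \<Rightarrow> 's list \<Rightarrow> 's list \<Rightarrow> bool" for Q where
  gen: "(s, t) \<in> Q \<Longrightarrow> fsum_eq Q s t"
| refl: "fsum_eq Q s s"
| sym: "fsum_eq Q s t \<Longrightarrow> fsum_eq Q t s"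
| trans: "fsum_eq Q s t \<Longrightarrow> fsum_eq Q t u \<Longrightarrow> fsum_eq Q s u"
| app: "fsum_eq Q s s' \<Longrightarrow> fsum_eq Q t t' \<Longrightarrow> fsum_eq Q (s @ t) (s' @ t')"
| comm: "fsum_eq Q (s @ t) (t @ s)"

text \<open>
  For a right module \<open>N\<close> and a left module \<open>M\<close> over \<open>B\<close>, two formal sums of symbols \<open>x \<otimes> y\<close>
  (each factor tagged with its degree) are equal in \<open>N \<otimes>\<^sub>B M\<close> iff they are related by
  \<open>fsum_eq (bal_rels B N M)\<close>. In \<open>act N r p b x\<close> the element \<open>b\<close> acts on \<open>x\<close> from the right.
\<close>

definition homog :: "('r, 'x) gmod \<Rightarrow> (int \<times> 'x) set" where
  "homog M = {(n, x). x \<in> carrier (mgrp M n)}"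

inductive_set bal_rels ::
  "'r gring \<Rightarrow> ('r, 'x) gmod \<Rightarrow> ('r, 'y) gmod \<Rightarrow>
     (((int \<times> 'x) \<times> (int \<times> 'y)) list \<times> ((int \<times> 'x) \<times> (int \<times> 'y)) list) set"
  for B N M where
  add_left: "x \<in> carrier (mgrp N p) \<Longrightarrow> x' \<in> carrier (mgrp N p) \<Longrightarrow> b \<in> homog M \<Longrightarrow>
    ([((p, x \<otimes>\<^bsub>mgrp N p\<^esub> x'), b)], [((p, x), b), ((p, x'), b)]) \<in> bal_rels B N M"
| add_right: "y \<in> carrier (mgrp M q) \<Longrightarrow> y' \<in> carrier (mgrp M q) \<Longrightarrow> a \<in> homog N \<Longrightarrow>
    ([(a, (q, y \<otimes>\<^bsub>mgrp M q\<^esub> y'))], [(a, (q, y)), (a, (q, y'))]) \<in> bal_rels B N M"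
| zero_left: "b \<in> homog M \<Longrightarrow> ([((p, \<one>\<^bsub>mgrp N p\<^esub>), b)], []) \<in> bal_rels B N M"
| zero_right: "a \<in> homog N \<Longrightarrow> ([(a, (q, \<one>\<^bsub>mgrp M q\<^esub>))], []) \<in> bal_rels B N M"
| balanced: "x \<in> carrier (mgrp N p) \<Longrightarrow> b \<in> carrier (rgrp B r) \<Longrightarrow> y \<in> carrier (mgrp M q) \<Longrightarrow>
    ([((r + p, act N r p b x), (q, y))], [((p, x), (r + q, act M r q b y))]) \<in> bal_rels B N M"

text \<open>
  A graded left module \<open>M\<close> is flat if \<open>- \<otimes>\<^sub>B M\<close> preserves injectivity of homomorphisms of graded
  right modules. The right modules tested have their elements in the type \<open>'u\<close>.
\<close>

definition gflat :: "'u itself \<Rightarrow> 'r gring \<Rightarrow> ('r, 'y) gmod \<Rightarrow> bool" where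
  "gflat (_ :: 'u itself) B M \<longleftrightarrow>
     (\<forall>(N' :: ('r, 'u) gmod) (N :: ('r, 'u) gmod) i.
        gmodule (opposite B) N' \<and> gmodule (opposite B) N \<and> i \<in> mhom (opposite B) N' N \<and>
        (\<forall>n. inj_on (i n) (carrier (mgrp N' n))) \<longrightarrow>
        (\<forall>s\<in>lists (homog N' \<times> homog M). \<forall>t\<in>lists (homog N' \<times> homog M).
           fsum_eq (bal_rels B N M)
             (map (\<lambda>((n, x), b). ((n, i n x), b)) s) (map (\<lambda>((n, x), b). ((n, i n x), b)) t) \<longrightarrow>
           fsum_eq (bal_rels B N' M) s t))"


section \<open>Graded vector spaces, algebras and coalgebras over a field\<close>

text \<open>
  A graded vector space over the field \<open>A\<close> is a family of \<open>A\<close>-modules in the sense of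
  \<^locale>\<open>module\<close>; the multiplication and unit fields of the module records are not used.
\<close>

type_synonym ('a, 'v) gvs = "int \<Rightarrow> ('a, 'v) module"

text \<open>The additive group, as a plain \<^typ>\<open>'v monoid\<close> (\<open>add_monoid\<close> keeps extra record fields).\<close>

abbreviation add_grp :: "('v, 'k) ring_scheme \<Rightarrow> 'v monoid" where
  "add_grp V \<equiv> \<lparr>carrier = carrier V, monoid.mult = add V, one = zero V\<rparr>"

definition linear_maps ::
  "'a ring \<Rightarrow> ('a, 'v) module \<Rightarrow> ('a, 'w) module \<Rightarrow> ('v \<Rightarrow> 'w) set" where
  "linear_maps A V W = {f \<in> hom (add_grp V) (add_grp W).
     \<forall>c\<in>carrier A. \<forall>x\<in>carrier V. f (c \<odot>\<^bsub>V\<^esub> x) = c \<odot>\<^bsub>W\<^esub> f x}"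

definition functionals :: "'a ring \<Rightarrow> ('a, 'v) module \<Rightarrow> ('v \<Rightarrow> 'a) set" where
  "functionals A V = {f \<in> carrier V \<rightarrow>\<^sub>E carrier A.
     (\<forall>x\<in>carrier V. \<forall>y\<in>carrier V. f (x \<oplus>\<^bsub>V\<^esub> y) = f x \<oplus>\<^bsub>A\<^esub> f y) \<and>
     (\<forall>c\<in>carrier A. \<forall>x\<in>carrier V. f (c \<odot>\<^bsub>V\<^esub> x) = c \<otimes>\<^bsub>A\<^esub> f x)}"

definition fin_dim :: "'a ring \<Rightarrow> ('a, 'v) module \<Rightarrow> bool" where
  "fin_dim A V \<longleftrightarrow> (\<exists>X. finite X \<and> X \<subseteq> carrier V \<and>
     carrier V = generate (add_grp V) {c \<odot>\<^bsub>V\<^esub> x |c x. c \<in> carrier A \<and> x \<in> X})"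

definition one_dim :: "'a ring \<Rightarrow> ('a, 'v) module \<Rightarrow> bool" where
  "one_dim A V \<longleftrightarrow> (\<exists>x\<in>carrier V. x \<noteq> \<zero>\<^bsub>V\<^esub> \<and> carrier V = {c \<odot>\<^bsub>V\<^esub> x |c. c \<in> carrier A})"

definition gdual :: "'a ring \<Rightarrow> ('a, 'v) gvs \<Rightarrow> ('a, 'v \<Rightarrow> 'a) gvs" where
  "gdual A V n =
     \<lparr>carrier = functionals A (V (- n)),
      monoid.mult = (\<lambda>_ _. undefined), one = undefined,
      zero = (\<lambda>x\<in>carrier (V (- n)). \<zero>\<^bsub>A\<^esub>),
      add = (\<lambda>f g. \<lambda>x\<in>carrier (V (- n)). f x \<oplus>\<^bsub>A\<^esub> g x),
      smult = (\<lambda>c f. \<lambda>x\<in>carrier (V (- n)). c \<otimes>\<^bsub>A\<^esub> f x)\<rparr>"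

text \<open>A bilinear pairing \<open>V \<times> W \<rightarrow> A\<close> is nonsingular if both adjoint maps are bijective.\<close>

definition nonsingular ::
  "'a ring \<Rightarrow> ('a, 'v) module \<Rightarrow> ('a, 'w) module \<Rightarrow> ('v \<Rightarrow> 'w \<Rightarrow> 'a) \<Rightarrow> bool" where
  "nonsingular A V W \<beta> \<longleftrightarrow>
     bij_betw (\<lambda>x. \<lambda>y\<in>carrier W. \<beta> x y) (carrier V) (functionals A W) \<and>
     bij_betw (\<lambda>y. \<lambda>x\<in>carrier V. \<beta> x y) (carrier W) (functionals A V)"

record ('a, 'b) galg =
  avec :: "int \<Rightarrow> ('a, 'b) module"
  amul :: "int \<Rightarrow> int \<Rightarrow> 'b \<Rightarrow> 'b \<Rightarrow> 'b"
  aone :: 'b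

definition gring_of :: "('a, 'b) galg \<Rightarrow> 'b gring" where
  "gring_of B = \<lparr>rgrp = (\<lambda>n. add_grp (avec B n)), rmul = amul B, rone = aone B\<rparr>"

definition galgebra :: "'a ring \<Rightarrow> ('a, 'b) galg \<Rightarrow> bool" where
  "galgebra A B \<longleftrightarrow>
     (\<forall>n. module A (avec B n)) \<and> graded_ring (gring_of B) \<and>
     (\<forall>p q. \<forall>c\<in>carrier A. \<forall>x\<in>carrier (avec B p). \<forall>y\<in>carrier (avec B q).
        amul B p q (c \<odot>\<^bsub>avec B p\<^esub> x) y = c \<odot>\<^bsub>avec B (p + q)\<^esub> amul B p q x y \<and>
        amul B p q x (c \<odot>\<^bsub>avec B q\<^esub> y) = c \<odot>\<^bsub>avec B (p + q)\<^esub> amul B p q x y)"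

definition poincare_pairing :: "'a ring \<Rightarrow> ('a, 'b) galg \<Rightarrow> int \<Rightarrow> ('b \<Rightarrow> 'a) \<Rightarrow> bool" where
  "poincare_pairing A B d e \<longleftrightarrow>
     e \<in> functionals A (avec B d) \<and>
     (\<forall>q. nonsingular A (avec B q) (avec B (d - q)) (\<lambda>x y. e (amul B q (d - q) x y)))"

definition poincare_algebra :: "'a ring \<Rightarrow> ('a, 'b) galg \<Rightarrow> bool" where
  "poincare_algebra A B \<longleftrightarrow>
     galgebra A B \<and>
     (\<forall>n. fin_dim A (avec B n)) \<and> finite {n. carrier (avec B n) \<noteq> {\<zero>\<^bsub>avec B n\<^esub>}} \<and>
     (\<forall>n<0. carrier (avec B n) = {\<zero>\<^bsub>avec B n\<^esub>}) \<and> one_dim A (avec B 0) \<and>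
     (\<exists>d e. poincare_pairing A B d e)"

text \<open>
  \<open>comul C n x\<close> is a formal sum of tensors of homogeneous elements (tagged with their degrees)
  that represents \<open>\<Delta> x\<close>, for \<open>x\<close> of degree \<open>n\<close>. Only its class in the tensor product matters.
  \<open>counit C\<close> is the component of degree \<open>0\<close> of the counit; its other components vanish.
\<close>

record ('a, 'v) gcoalg =
  cvec :: "int \<Rightarrow> ('a, 'v) module"
  comul :: "int \<Rightarrow> 'v \<Rightarrow> ((int \<times> 'v) \<times> (int \<times> 'v)) list"
  counit :: "'v \<Rightarrow> 'a"

definition letters :: "('a, 'v) gvs \<Rightarrow> (int \<times> 'v) set" where
  "letters V = {(n, x). x \<in> carrier (V n)}"

text \<open>
  Words of length \<open>k\<close> over \<open>letters V\<close> stand for pure tensors in the \<open>k\<close>-fold tensor power of \<open>V\<close>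
  over \<open>A\<close>; formal sums of words are equal there iff they are related by
  \<open>fsum_eq (multilin_rels A V)\<close>.
\<close>

inductive_set multilin_rels ::
  "'a ring \<Rightarrow> ('a, 'v) gvs \<Rightarrow> ((int \<times> 'v) list list \<times> (int \<times> 'v) list list) set"
  for A V where
  add: "u \<in> lists (letters V) \<Longrightarrow> w \<in> lists (letters V) \<Longrightarrow>
    x \<in> carrier (V n) \<Longrightarrow> y \<in> carrier (V n) \<Longrightarrow>
    ([u @ [(n, x \<oplus>\<^bsub>V n\<^esub> y)] @ w], [u @ [(n, x)] @ w, u @ [(n, y)] @ w]) \<in> multilin_rels A V"
| zero: "u \<in> lists (letters V) \<Longrightarrow> w \<in> lists (letters V) \<Longrightarrow>
    ([u @ [(n, \<zero>\<^bsub>V n\<^esub>)] @ w], []) \<in> multilin_rels A V"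
| scal: "u \<in> lists (letters V) \<Longrightarrow> v \<in> lists (letters V) \<Longrightarrow> w \<in> lists (letters V) \<Longrightarrow>
    c \<in> carrier A \<Longrightarrow> x \<in> carrier (V m) \<Longrightarrow> y \<in> carrier (V n) \<Longrightarrow>
    ([u @ [(m, c \<odot>\<^bsub>V m\<^esub> x)] @ v @ [(n, y)] @ w], [u @ [(m, x)] @ v @ [(n, c \<odot>\<^bsub>V n\<^esub> y)] @ w])
      \<in> multilin_rels A V"

abbreviation tensor_eq ::
  "'a ring \<Rightarrow> ('a, 'v) gvs \<Rightarrow> (int \<times> 'v) list list \<Rightarrow> (int \<times> 'v) list list \<Rightarrow> bool" where
  "tensor_eq A V \<equiv> fsum_eq (multilin_rels A V)"

definition lsum :: "('v, 'k) ring_scheme \<Rightarrow> 'v list \<Rightarrow> 'v" where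
  "lsum V xs = foldr (add V) xs (zero V)"

definition gcoalgebra :: "'a ring \<Rightarrow> ('a, 'v) gcoalg \<Rightarrow> bool" where
  "gcoalgebra A C \<longleftrightarrow>
     (\<forall>n. module A (cvec C n)) \<and>
     counit C \<in> functionals A (cvec C 0) \<and>
     (\<forall>n. \<forall>x\<in>carrier (cvec C n).
        (\<forall>((i, a), (j, b))\<in>set (comul C n x).
           a \<in> carrier (cvec C i) \<and> b \<in> carrier (cvec C j) \<and> i + j = n) \<and>
        (\<forall>y\<in>carrier (cvec C n). tensor_eq A (cvec C)
           [[s, t]. (s, t) \<leftarrow> comul C n (x \<oplus>\<^bsub>cvec C n\<^esub> y)]
           [[s, t]. (s, t) \<leftarrow> comul C n x @ comul C n y]) \<and>
        (\<forall>c\<in>carrier A. tensor_eq A (cvec C)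
           [[s, t]. (s, t) \<leftarrow> comul C n (c \<odot>\<^bsub>cvec C n\<^esub> x)]
           [[(i, c \<odot>\<^bsub>cvec C i\<^esub> a), t]. ((i, a), t) \<leftarrow> comul C n x]) \<and>
        tensor_eq A (cvec C)
           [[s1, s2, t]. ((i, a), t) \<leftarrow> comul C n x, (s1, s2) \<leftarrow> comul C i a]
           [[s, t1, t2]. (s, (j, b)) \<leftarrow> comul C n x, (t1, t2) \<leftarrow> comul C j b] \<and>
        lsum (cvec C n) [counit C a \<odot>\<^bsub>cvec C n\<^esub> b. ((i, a), (j, b)) \<leftarrow> comul C n x, i = 0] = x \<and>
        lsum (cvec C n) [counit C b \<odot>\<^bsub>cvec C n\<^esub> a. ((i, a), (j, b)) \<leftarrow> comul C n x, j = 0] = x)"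

definition coalg_maps ::
  "'a ring \<Rightarrow> ('a, 'v) gcoalg \<Rightarrow> ('a, 'w) gcoalg \<Rightarrow> (int \<Rightarrow> 'v \<Rightarrow> 'w) set" where
  "coalg_maps A C D = {\<phi>.
     (\<forall>n. \<phi> n \<in> linear_maps A (cvec C n) (cvec D n)) \<and>
     (\<forall>x\<in>carrier (cvec C 0). counit D (\<phi> 0 x) = counit C x) \<and>
     (\<forall>n. \<forall>x\<in>carrier (cvec C n). tensor_eq A (cvec D)
        [[(i, \<phi> i a), (j, \<phi> j b)]. ((i, a), (j, b)) \<leftarrow> comul C n x]
        [[s, t]. (s, t) \<leftarrow> comul D n (\<phi> n x)])}"

definition coalg_epis ::
  "'a ring \<Rightarrow> ('a, 'v) gcoalg \<Rightarrow> ('a, 'w) gcoalg \<Rightarrow> (int \<Rightarrow> 'v \<Rightarrow> 'w) set" where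
  "coalg_epis A C D =
     {\<phi> \<in> coalg_maps A C D. \<forall>n. \<phi> n ` carrier (cvec C n) = carrier (cvec D n)}"

definition finite_type :: "'a ring \<Rightarrow> ('a, 'v) gcoalg \<Rightarrow> bool" where
  "finite_type A C \<longleftrightarrow> (\<forall>n. fin_dim A (cvec C n))"

text \<open>
  The graded dual algebra: \<open>(f * g) x = \<Sum> f x' g x''\<close>, where a functional of degree \<open>p\<close> lives on
  the component of degree \<open>- p\<close> and is zero on the other components.
\<close>

definition dual_alg :: "'a ring \<Rightarrow> ('a, 'v) gcoalg \<Rightarrow> ('a, 'v \<Rightarrow> 'a) galg" where
  "dual_alg A C =
     \<lparr>avec = gdual A (cvec C),
      amul = (\<lambda>p q f g. \<lambda>x\<in>carrier (cvec C (- (p + q))).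
        lsum A [f a \<otimes>\<^bsub>A\<^esub> g b. ((i, a), (j, b)) \<leftarrow> comul C (- (p + q)) x, i = - p \<and> j = - q]),
      aone = counit C\<rparr>"

abbreviation dual_ring :: "'a ring \<Rightarrow> ('a, 'v) gcoalg \<Rightarrow> ('v \<Rightarrow> 'a) gring" where
  "dual_ring A C \<equiv> gring_of (dual_alg A C)"

definition dual_map ::
  "('a, 'v) gcoalg \<Rightarrow> (int \<Rightarrow> 'v \<Rightarrow> 'w) \<Rightarrow> int \<Rightarrow> ('w \<Rightarrow> 'a) \<Rightarrow> 'v \<Rightarrow> 'a" where
  "dual_map C \<phi> n f = (\<lambda>x\<in>carrier (cvec C (- n)). f (\<phi> (- n) x))"

text \<open>\<open>\<iota> C\<close>, the coalgebra with the adjoint action \<open>f \<cdot> x = \<Sum> x' f x''\<close> of its graded dual.\<close>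

definition iota :: "('a, 'v) gcoalg \<Rightarrow> ('v \<Rightarrow> 'a, 'v) gmod" where
  "iota C =
     \<lparr>mgrp = (\<lambda>n. add_grp (cvec C n)),
      act = (\<lambda>p n f x. lsum (cvec C (p + n))
        [f b \<odot>\<^bsub>cvec C (p + n)\<^esub> a. ((i, a), (j, b)) \<leftarrow> comul C n x, j = - p])\<rparr>"


section \<open>Mitchell coalgebras\<close>

text \<open>
  The graded dual of a graded algebra \<open>B\<close>, as a left \<open>B\<close>-module: \<open>(b \<cdot> \<phi>) x = \<phi> (x b)\<close>.
\<close>

definition dual_module :: "'a ring \<Rightarrow> ('a, 'b) galg \<Rightarrow> ('b, 'b \<Rightarrow> 'a) gmod" where
  "dual_module A B =
     \<lparr>mgrp = (\<lambda>n. add_grp (gdual A (avec B) n)),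
      act = (\<lambda>p n b \<phi>. \<lambda>x\<in>carrier (avec B (- (p + n))). \<phi> (amul B (- (p + n)) p x b))\<rparr>"

text \<open>
  The map \<open>y \<mapsto> (x \<mapsto> e (x y))\<close> from \<open>B\<close> to the \<open>d\<close>-fold suspension of its dual: an element of
  degree \<open>q\<close> goes to a functional on \<open>B\<^sup>d\<^sup>-\<^sup>q\<close>.
\<close>

definition duality_map ::
  "('a, 'b) galg \<Rightarrow> int \<Rightarrow> ('b \<Rightarrow> 'a) \<Rightarrow> int \<Rightarrow> 'b \<Rightarrow> 'b \<Rightarrow> 'a" where
  "duality_map B d e q y = (\<lambda>x\<in>carrier (avec B (d - q)). e (amul B (d - q) q x y))"

definition seq_limit ::
  "(nat \<Rightarrow> ('r, 'x) gmod) \<Rightarrow> (nat \<Rightarrow> int \<Rightarrow> 'x \<Rightarrow> 'x) \<Rightarrow> ('r, nat \<Rightarrow> 'x) gmod" where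
  "seq_limit M \<tau> =
     \<lparr>mgrp = (\<lambda>k.
        \<lparr>carrier = {s. \<forall>n. s n \<in> carrier (mgrp (M n) k) \<and> \<tau> n k (s (Suc n)) = s n},
         monoid.mult = (\<lambda>s t n. s n \<otimes>\<^bsub>mgrp (M n) k\<^esub> t n),
         one = (\<lambda>n. \<one>\<^bsub>mgrp (M n) k\<^esub>)\<rparr>),
      act = (\<lambda>p k r s n. act (M n) p k r (s n))\<rparr>"

record ('a, 'g, 'q) mitchell_data =
  quo :: "nat \<Rightarrow> ('a, 'q) gcoalg"                       \<comment> \<open>\<open>\<Gamma>(n)\<close>\<close>
  proj :: "nat \<Rightarrow> int \<Rightarrow> 'g \<Rightarrow> 'q"                       \<comment> \<open>\<open>\<Gamma> \<rightarrow> \<Gamma>(n)\<close>\<close>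
  trn :: "nat \<Rightarrow> int \<Rightarrow> 'q \<Rightarrow> 'q"                        \<comment> \<open>\<open>\<Gamma>(n+1) \<rightarrow> \<Gamma>(n)\<close>\<close>
  omega :: "nat \<Rightarrow> 'q"                                   \<comment> \<open>\<open>\<omega>\<^sub>n\<close>\<close>
  omega_deg :: "nat \<Rightarrow> int"                              \<comment> \<open>\<open>|\<omega>\<^sub>n|\<close>\<close>
  ext_act :: "nat \<Rightarrow> int \<Rightarrow> int \<Rightarrow> ('g \<Rightarrow> 'a) \<Rightarrow> ('q \<Rightarrow> 'a) \<Rightarrow> 'q \<Rightarrow> 'a"
    \<comment> \<open>action of \<open>\<Gamma>\<^sup>*\<close> on \<open>\<Gamma>\<^sup>*(n)\<close>\<close>
  ext_dact :: "nat \<Rightarrow> int \<Rightarrow> int \<Rightarrow> ('g \<Rightarrow> 'a) \<Rightarrow> (('q \<Rightarrow> 'a) \<Rightarrow> 'a) \<Rightarrow> ('q \<Rightarrow> 'a) \<Rightarrow> 'a"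
    \<comment> \<open>action of \<open>\<Gamma>\<^sup>*\<close> on \<open>\<Gamma>\<^sup>*(n)\<^sup>*\<close>\<close>
  sigma :: "nat \<Rightarrow> int \<Rightarrow> ('g \<Rightarrow> 'a) \<Rightarrow> 'q \<Rightarrow> 'a"        \<comment> \<open>\<open>\<sigma>\<^sub>n : \<Gamma>\<^sup>* \<rightarrow> \<Gamma>\<^sup>*(n)\<close>\<close>
  sigma_trn :: "nat \<Rightarrow> int \<Rightarrow> ('q \<Rightarrow> 'a) \<Rightarrow> 'q \<Rightarrow> 'a"
    \<comment> \<open>\<open>\<sigma>\<^sub>n\<^sub>,\<^sub>n\<^sub>+\<^sub>1 : \<Gamma>\<^sup>*(n+1) \<rightarrow> \<Gamma>\<^sup>*(n)\<close>\<close>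

definition ext_mod :: "'a ring \<Rightarrow> ('a, 'g, 'q) mitchell_data \<Rightarrow> nat \<Rightarrow> ('g \<Rightarrow> 'a, 'q \<Rightarrow> 'a) gmod"
  where "ext_mod A D n = \<lparr>mgrp = rgrp (dual_ring A (quo D n)), act = ext_act D n\<rparr>"

definition ext_dmod ::
  "'a ring \<Rightarrow> ('a, 'g, 'q) mitchell_data \<Rightarrow> nat \<Rightarrow> ('g \<Rightarrow> 'a, ('q \<Rightarrow> 'a) \<Rightarrow> 'a) gmod" where
  "ext_dmod A D n =
     \<lparr>mgrp = mgrp (dual_module A (dual_alg A (quo D n))), act = ext_dact D n\<rparr>"

text \<open>
  The duality isomorphism is required to be linear over \<open>\<Gamma>\<^sup>*\<close> for \<open>ext_act\<close> on \<open>\<Gamma>\<^sup>*(n)\<close> and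
  \<open>ext_dact\<close> on \<open>\<Gamma>\<^sup>*(n)\<^sup>*\<close>. Dualizing the left action \<open>ext_act\<close> would only yield a right
  action, so the left action \<open>ext_dact\<close> is a datum of its own, required to extend the natural
  action of \<open>\<Gamma>\<^sup>*(n)\<close>. The element \<open>\<omega>\<^sub>n\<close>, on which functionals of degree \<open>|\<omega>\<^sub>n|\<close> are
  evaluated, sits in degree \<open>-|\<omega>\<^sub>n|\<close> of \<open>\<Gamma>(n)\<close>.
\<close>

definition mitchell_decomposition ::
  "'u itself \<Rightarrow> 'a ring \<Rightarrow> ('a, 'g) gcoalg \<Rightarrow> ('a, 'g, 'q) mitchell_data \<Rightarrow> bool" where
  "mitchell_decomposition U A \<Gamma> D \<longleftrightarrow>
     (\<forall>n. gcoalgebra A (quo D n) \<and>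
          proj D n \<in> coalg_epis A \<Gamma> (quo D n) \<and>
          trn D n \<in> coalg_epis A (quo D (Suc n)) (quo D n) \<and>
          (\<forall>k. \<forall>x\<in>carrier (cvec \<Gamma> k). trn D n k (proj D (Suc n) k x) = proj D n k x) \<and>
          poincare_algebra A (dual_alg A (quo D n)) \<and>
          gflat U (dual_ring A (quo D n))
            (res_scalars (dual_map (quo D (Suc n)) (trn D n)) (reg (dual_ring A (quo D (Suc n)))))) \<and>
     (\<forall>n. omega D n \<in> carrier (cvec (quo D n) (- omega_deg D n)) \<and>
          poincare_pairing A (dual_alg A (quo D n)) (omega_deg D n)
            (\<lambda>f\<in>carrier (avec (dual_alg A (quo D n)) (omega_deg D n)). f (omega D n))) \<and>
     (\<forall>n. gmodule (dual_ring A \<Gamma>) (ext_mod A D n) \<and>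
          (\<forall>p k. \<forall>b\<in>carrier (rgrp (dual_ring A (quo D n)) p).
             \<forall>y\<in>carrier (mgrp (ext_mod A D n) k).
               ext_act D n p k (dual_map \<Gamma> (proj D n) p b) y = amul (dual_alg A (quo D n)) p k b y) \<and>
          gmodule (dual_ring A \<Gamma>) (ext_dmod A D n) \<and>
          (\<forall>p k. \<forall>b\<in>carrier (rgrp (dual_ring A (quo D n)) p).
             \<forall>\<phi>\<in>carrier (mgrp (ext_dmod A D n) k).
               ext_dact D n p k (dual_map \<Gamma> (proj D n) p b) \<phi> =
                 act (dual_module A (dual_alg A (quo D n))) p k b \<phi>) \<and>
          sigma D n \<in> mhom (dual_ring A (quo D n))
            (res_scalars (dual_map \<Gamma> (proj D n)) (reg (dual_ring A \<Gamma>)))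
            (reg (dual_ring A (quo D n))) \<and>
          sigma_trn D n \<in> mhom (dual_ring A (quo D n))
            (res_scalars (dual_map (quo D (Suc n)) (trn D n)) (reg (dual_ring A (quo D (Suc n)))))
            (reg (dual_ring A (quo D n))) \<and>
          (\<forall>k. \<forall>f\<in>carrier (rgrp (dual_ring A (quo D n)) k).
             sigma D n k (dual_map \<Gamma> (proj D n) k f) = f) \<and>
          duality_map (dual_alg A (quo D n)) (omega_deg D n) (\<lambda>f. f (omega D n)) \<in>
            miso (dual_ring A \<Gamma>) (ext_mod A D n) (susp (omega_deg D n) (ext_dmod A D n)) \<and>
          (\<forall>k. \<forall>f\<in>carrier (rgrp (dual_ring A \<Gamma>) k).
             sigma_trn D n k (sigma D (Suc n) k f) = sigma D n k f)) \<and>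
     gmodule (dual_ring A \<Gamma>) (seq_limit (ext_mod A D) (sigma_trn D)) \<and>
     (\<lambda>k f n. sigma D n k f) \<in>
       miso (dual_ring A \<Gamma>) (reg (dual_ring A \<Gamma>)) (seq_limit (ext_mod A D) (sigma_trn D))"


section \<open>Ideal sets\<close>

type_synonym 'r gideal = "int \<Rightarrow> 'r set"

definition homog_left_ideal :: "'r gring \<Rightarrow> 'r gideal \<Rightarrow> bool" where
  "homog_left_ideal R I \<longleftrightarrow> gsubmodule R (reg R) I"

definition ideal_set :: "'r gring \<Rightarrow> 'r gideal set \<Rightarrow> bool" where
  "ideal_set R S \<longleftrightarrow>
     (\<forall>I\<in>S. homog_left_ideal R I \<and> (\<exists>n. I n \<noteq> carrier (rgrp R n)))"

text \<open>Containment of homogeneous ideals is the pointwise order on \<^typ>\<open>int \<Rightarrow> 'r set\<close>.\<close>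

definition filtered_ideal_set :: "'r gring \<Rightarrow> 'r gideal set \<Rightarrow> bool" where
  "filtered_ideal_set R S \<longleftrightarrow>
     ideal_set R S \<and> (\<forall>I\<in>S. \<forall>J\<in>S. \<exists>K\<in>S. K \<le> I \<and> K \<le> J)"

definition ideal_set_le :: "'r gideal set \<Rightarrow> 'r gideal set \<Rightarrow> bool" where
  "ideal_set_le S S' \<longleftrightarrow> (\<forall>I\<in>S. \<exists>J\<in>S'. J \<le> I)"

definition ideal_sets_equivalent :: "'r gideal set \<Rightarrow> 'r gideal set \<Rightarrow> bool" where
  "ideal_sets_equivalent S S' \<longleftrightarrow> ideal_set_le S S' \<and> ideal_set_le S' S"

definition h0 :: "('r, 'x) gmod \<Rightarrow> 'r gideal set \<Rightarrow> int \<Rightarrow> 'x set" where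
  "h0 M S n = generate (mgrp M n)
     {x \<in> carrier (mgrp M n). \<exists>I\<in>S. \<forall>p. \<forall>r\<in>I p. act M p n r x = \<one>\<^bsub>mgrp M (p + n)\<^esub>}"

definition H0 :: "'r gring \<Rightarrow> ('r, 'x) gmod \<Rightarrow> 'r gideal set \<Rightarrow> int \<Rightarrow> 'x set" where
  "H0 R M S = gspan R M (h0 M S)"

definition closed_ideal_set :: "'u itself \<Rightarrow> 'r gring \<Rightarrow> 'r gideal set \<Rightarrow> bool" where
  "closed_ideal_set (_ :: 'u itself) R S \<longleftrightarrow>
     (\<forall>M :: ('r, 'u) gmod. gmodule R M \<longrightarrow>
        (\<lambda>n x. x) \<in> giso (mgrp (submod M (h0 M S))) (mgrp (submod M (H0 R M S))))"

definition annihilator :: "'r gring \<Rightarrow> ('r, 'x) gmod \<Rightarrow> int \<Rightarrow> 'x \<Rightarrow> 'r gideal" where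
  "annihilator R M d x n = {r \<in> carrier (rgrp R n). act M n d r x = \<one>\<^bsub>mgrp M (n + d)\<^esub>}"

definition strongly_distinguished ::
  "'a ring \<Rightarrow> ('a, 'g) gcoalg \<Rightarrow> ('g \<Rightarrow> 'a) gideal \<Rightarrow> bool" where
  "strongly_distinguished A \<Gamma> I \<longleftrightarrow>
     (\<exists>d. \<exists>x\<in>carrier (mgrp (iota \<Gamma>) d).
        x \<noteq> \<one>\<^bsub>mgrp (iota \<Gamma>) d\<^esub> \<and> I = annihilator (dual_ring A \<Gamma>) (iota \<Gamma>) d x)"

text \<open>
  The intersections are nonempty: members of an ideal set are proper ideals, and the empty
  intersection would be the whole ring.
\<close>

definition dist :: "'a ring \<Rightarrow> ('a, 'g) gcoalg \<Rightarrow> ('g \<Rightarrow> 'a) gideal set" where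
  "dist A \<Gamma> = {(\<lambda>n. \<Inter>I\<in>F. I n) |F.
     finite F \<and> F \<noteq> {} \<and> (\<forall>I\<in>F. strongly_distinguished A \<Gamma> I)}"

definition deg_ideal :: "'r gring \<Rightarrow> nat \<Rightarrow> 'r gideal" where
  "deg_ideal R j = gspan R (reg R) (\<lambda>n. if n \<ge> int j then carrier (rgrp R n) else {})"

definition grad :: "'r gring \<Rightarrow> 'r gideal set" where
  "grad R = {deg_ideal R j |j. j \<ge> 1}"


section \<open>Functors on graded modules and their right derived functors\<close>

text \<open>
  The category of graded \<open>R\<close>-modules is rendered by the graded modules with elements in a fixed
  type \<open>'u\<close>. \<open>gfun\<close> is the type of functors from it to graded abelian groups, \<open>gmfun\<close> that of
  functors to graded \<open>R\<close>-modules; \<open>fmor F M N f\<close> is the value on \<open>f : M \<rightarrow> N\<close>.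
\<close>

record ('r, 'u, 'x) gfun =
  fobj :: "('r, 'u) gmod \<Rightarrow> 'x ggrp"
  fmor :: "('r, 'u) gmod \<Rightarrow> ('r, 'u) gmod \<Rightarrow> (int \<Rightarrow> 'u \<Rightarrow> 'u) \<Rightarrow> int \<Rightarrow> 'x \<Rightarrow> 'x"

record ('r, 'u, 'x) gmfun =
  mobj :: "('r, 'u) gmod \<Rightarrow> ('r, 'x) gmod"
  mmor :: "('r, 'u) gmod \<Rightarrow> ('r, 'u) gmod \<Rightarrow> (int \<Rightarrow> 'u \<Rightarrow> 'u) \<Rightarrow> int \<Rightarrow> 'x \<Rightarrow> 'x"

definition forget :: "('r, 'u, 'x) gmfun \<Rightarrow> ('r, 'u, 'x) gfun" where
  "forget F = \<lparr>fobj = (\<lambda>M. mgrp (mobj F M)), fmor = mmor F\<rparr>"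

definition nat_isomorphic ::
  "'r gring \<Rightarrow> ('r, 'u, 'x) gfun \<Rightarrow> ('r, 'u, 'y) gfun \<Rightarrow> bool" where
  "nat_isomorphic R F G \<longleftrightarrow> (\<exists>\<theta>.
     (\<forall>M. gmodule R M \<longrightarrow> \<theta> M \<in> giso (fobj F M) (fobj G M)) \<and>
     (\<forall>M N f. gmodule R M \<and> gmodule R N \<and> f \<in> mhom R M N \<longrightarrow>
        (\<forall>d. \<forall>x\<in>carrier (fobj F M d). \<theta> N d (fmor F M N f d x) = fmor G M N f d (\<theta> M d x))))"

definition h0_fun :: "'r gideal set \<Rightarrow> ('r, 'u, 'u) gfun" where
  "h0_fun S = \<lparr>fobj = (\<lambda>M. mgrp (submod M (h0 M S))), fmor = (\<lambda>M N f. f)\<rparr>"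

definition H0_fun :: "'r gring \<Rightarrow> 'r gideal set \<Rightarrow> ('r, 'u, 'u) gmfun" where
  "H0_fun R S = \<lparr>mobj = (\<lambda>M. submod M (H0 R M S)), mmor = (\<lambda>M N f. f)\<rparr>"

text \<open>
  The functor \<open>M \<mapsto> hom\<^sub>R(L, M)\<close> with degree \<open>d\<close> part the degree-preserving \<open>R\<close>-linear maps
  \<open>\<Sigma>\<^sup>d L \<rightarrow> M\<close>. Maps are taken to be extensional so that equality of maps is equality in HOL.
\<close>

definition hom_fun :: "'r gring \<Rightarrow> ('r, 'l) gmod \<Rightarrow> ('r, 'u, int \<Rightarrow> 'l \<Rightarrow> 'u) gfun" where
  "hom_fun R L =
     \<lparr>fobj = (\<lambda>M d.
        \<lparr>carrier = {h \<in> mhom R (susp d L) M. \<forall>k. h k \<in> extensional (carrier (mgrp (susp d L) k))},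
         monoid.mult = (\<lambda>h g k. \<lambda>x\<in>carrier (mgrp (susp d L) k). h k x \<otimes>\<^bsub>mgrp M k\<^esub> g k x),
         one = (\<lambda>k. \<lambda>x\<in>carrier (mgrp (susp d L) k). \<one>\<^bsub>mgrp M k\<^esub>)\<rparr>),
      fmor = (\<lambda>M N f d h k. \<lambda>x\<in>carrier (mgrp (susp d L) k). f k (h k x))\<rparr>"

definition hom_precomp ::
  "('r, 'k) gmod \<Rightarrow> (int \<Rightarrow> 'k \<Rightarrow> 'l) \<Rightarrow> int \<Rightarrow> (int \<Rightarrow> 'l \<Rightarrow> 'u) \<Rightarrow> int \<Rightarrow> 'k \<Rightarrow> 'u" where
  "hom_precomp L' u d h k = (\<lambda>x\<in>carrier (mgrp (susp d L') k). h k (u (k - d) x))"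

definition ginjective :: "'r gring \<Rightarrow> ('r, 'u) gmod \<Rightarrow> bool" where
  "ginjective R E \<longleftrightarrow> gmodule R E \<and>
     (\<forall>(N' :: ('r, 'u) gmod) (N :: ('r, 'u) gmod) i f.
        gmodule R N' \<and> gmodule R N \<and> i \<in> mhom R N' N \<and>
        (\<forall>n. inj_on (i n) (carrier (mgrp N' n))) \<and> f \<in> mhom R N' E \<longrightarrow>
        (\<exists>g\<in>mhom R N E. \<forall>n. \<forall>x\<in>carrier (mgrp N' n). g n (i n x) = f n x))"

record ('r, 'u) resolution =
  res_term :: "nat \<Rightarrow> ('r, 'u) gmod"
  aug :: "int \<Rightarrow> 'u \<Rightarrow> 'u"
  diff :: "nat \<Rightarrow> int \<Rightarrow> 'u \<Rightarrow> 'u"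

definition injective_resolution :: "'r gring \<Rightarrow> ('r, 'u) gmod \<Rightarrow> ('r, 'u) resolution \<Rightarrow> bool" where
  "injective_resolution R M E \<longleftrightarrow>
     (\<forall>k. ginjective R (res_term E k)) \<and>
     aug E \<in> mhom R M (res_term E 0) \<and>
     (\<forall>k. diff E k \<in> mhom R (res_term E k) (res_term E (Suc k))) \<and>
     (\<forall>n. inj_on (aug E n) (carrier (mgrp M n))) \<and>
     (\<forall>n. aug E n ` carrier (mgrp M n) =
        kernel (mgrp (res_term E 0) n) (mgrp (res_term E 1) n) (diff E 0 n)) \<and>
     (\<forall>k n. diff E k n ` carrier (mgrp (res_term E k) n) =
        kernel (mgrp (res_term E (Suc k)) n) (mgrp (res_term E (Suc (Suc k))) n) (diff E (Suc k) n))"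

definition inj_res :: "'r gring \<Rightarrow> ('r, 'u) gmod \<Rightarrow> ('r, 'u) resolution" where
  "inj_res R M = (SOME E. injective_resolution R M E)"

definition inj_res_map ::
  "'r gring \<Rightarrow> ('r, 'u) gmod \<Rightarrow> ('r, 'u) gmod \<Rightarrow> (int \<Rightarrow> 'u \<Rightarrow> 'u) \<Rightarrow> nat \<Rightarrow> int \<Rightarrow> 'u \<Rightarrow> 'u" where
  "inj_res_map R M N f = (SOME \<phi>.
     (\<forall>k. \<phi> k \<in> mhom R (res_term (inj_res R M) k) (res_term (inj_res R N) k)) \<and>
     (\<forall>n. \<forall>x\<in>carrier (mgrp M n).
        \<phi> 0 n (aug (inj_res R M) n x) = aug (inj_res R N) n (f n x)) \<and>
     (\<forall>k n. \<forall>x\<in>carrier (mgrp (res_term (inj_res R M) k) n).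
        \<phi> (Suc k) n (diff (inj_res R M) k n x) = diff (inj_res R N) k n (\<phi> k n x)))"

text \<open>
  The degree \<open>d\<close> parts of the cocycles and coboundaries of \<open>F\<close> applied to the chosen injective
  resolution of \<open>M\<close>, in cohomological degree \<open>n\<close>. For \<open>n < 0\<close> both are the trivial subgroup of
  the term of index \<open>0\<close>, so that the cohomology vanishes.
\<close>

definition cochains ::
  "'r gring \<Rightarrow> ('r, 'u, 'x) gfun \<Rightarrow> int \<Rightarrow> ('r, 'u) gmod \<Rightarrow> int \<Rightarrow> 'x monoid" where
  "cochains R F n M d = fobj F (res_term (inj_res R M) (nat n)) d"

definition coboundary_map ::
  "'r gring \<Rightarrow> ('r, 'u, 'x) gfun \<Rightarrow> nat \<Rightarrow> ('r, 'u) gmod \<Rightarrow> int \<Rightarrow> 'x \<Rightarrow> 'x" where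
  "coboundary_map R F k M d =
     fmor F (res_term (inj_res R M) k) (res_term (inj_res R M) (Suc k)) (diff (inj_res R M) k) d"

definition cocycles ::
  "'r gring \<Rightarrow> ('r, 'u, 'x) gfun \<Rightarrow> int \<Rightarrow> ('r, 'u) gmod \<Rightarrow> int \<Rightarrow> 'x set" where
  "cocycles R F n M d =
     (if n < 0 then {\<one>\<^bsub>cochains R F n M d\<^esub>}
      else kernel (cochains R F n M d) (cochains R F (n + 1) M d)
             (coboundary_map R F (nat n) M d))"

definition coboundaries ::
  "'r gring \<Rightarrow> ('r, 'u, 'x) gfun \<Rightarrow> int \<Rightarrow> ('r, 'u) gmod \<Rightarrow> int \<Rightarrow> 'x set" where
  "coboundaries R F n M d =
     (if n \<le> 0 then {\<one>\<^bsub>cochains R F n M d\<^esub>}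
      else coboundary_map R F (nat (n - 1)) M d ` carrier (cochains R F (n - 1) M d))"

definition rderived ::
  "'r gring \<Rightarrow> int \<Rightarrow> ('r, 'u, 'x) gfun \<Rightarrow> ('r, 'u, 'x set) gfun" where
  "rderived R n F =
     \<lparr>fobj = (\<lambda>M d. (cochains R F n M d)\<lparr>carrier := cocycles R F n M d\<rparr> Mod coboundaries R F n M d),
      fmor = (\<lambda>M N f d. coset_map (cochains R F n N d) (coboundaries R F n N d)
        (fmor F (res_term (inj_res R M) (nat n)) (res_term (inj_res R N) (nat n))
           (inj_res_map R M N f (nat n)) d))\<rparr>"

definition mrderived ::
  "'r gring \<Rightarrow> int \<Rightarrow> ('r, 'u, 'x) gmfun \<Rightarrow> ('r, 'u, 'x set) gmfun" where
  "mrderived R n F =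
     \<lparr>mobj = (\<lambda>M.
        \<lparr>mgrp = fobj (rderived R n (forget F)) M,
         act = (\<lambda>p d r. coset_map (cochains R (forget F) n M (p + d))
           (coboundaries R (forget F) n M (p + d))
           (act (mobj F (res_term (inj_res R M) (nat n))) p d r))\<rparr>),
      mmor = fmor (rderived R n (forget F))\<rparr>"

definition local_cohomology ::
  "'r gring \<Rightarrow> 'r gideal set \<Rightarrow> int \<Rightarrow> ('r, 'u, 'u set) gmfun" where
  "local_cohomology R S n = mrderived R n (H0_fun R S)"

definition Ext_fun ::
  "'r gring \<Rightarrow> int \<Rightarrow> ('r, 'l) gmod \<Rightarrow> ('r, 'u, (int \<Rightarrow> 'l \<Rightarrow> 'u) set) gfun" where
  "Ext_fun R n L = rderived R n (hom_fun R L)"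

text \<open>The map \<open>Ext\<^sup>n(L, M) \<rightarrow> Ext\<^sup>n(L', M)\<close> in degree \<open>d\<close> induced by \<open>u : L' \<rightarrow> L\<close>.\<close>

definition Ext_restrict ::
  "'r gring \<Rightarrow> int \<Rightarrow> ('r, 'k) gmod \<Rightarrow> (int \<Rightarrow> 'k \<Rightarrow> 'l) \<Rightarrow> ('r, 'u) gmod \<Rightarrow> int \<Rightarrow>
     (int \<Rightarrow> 'l \<Rightarrow> 'u) set \<Rightarrow> (int \<Rightarrow> 'k \<Rightarrow> 'u) set" where
  "Ext_restrict R n L' u M d =
     coset_map (cochains R (hom_fun R L') n M d) (coboundaries R (hom_fun R L') n M d)
       (hom_precomp L' u d)"


section \<open>Directed colimits\<close>

text \<open>
  The colimit of a system of abelian groups \<open>G i\<close> with transition maps \<open>t i j : G i \<rightarrow> G j\<close> for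
  \<open>r i j\<close>, where \<open>i, j\<close> range over the set \<open>S\<close>, directed by \<open>r\<close>. Its elements are the classes of
  pairs \<open>(i, x)\<close> with \<open>x\<close> in \<open>G i\<close>. In the definitions of the operations all members of the
  unions agree.
\<close>

definition colim_class ::
  "'i set \<Rightarrow> ('i \<Rightarrow> 'i \<Rightarrow> bool) \<Rightarrow> ('i \<Rightarrow> 'x monoid) \<Rightarrow> ('i \<Rightarrow> 'i \<Rightarrow> 'x \<Rightarrow> 'x) \<Rightarrow>
     'i \<Rightarrow> 'x \<Rightarrow> ('i \<times> 'x) set" where
  "colim_class S r G t i x = {(j, y). j \<in> S \<and> y \<in> carrier (G j) \<and>
     (\<exists>k\<in>S. r i k \<and> r j k \<and> t i k x = t j k y)}"

definition colim_grp ::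
  "'i set \<Rightarrow> ('i \<Rightarrow> 'i \<Rightarrow> bool) \<Rightarrow> ('i \<Rightarrow> 'x monoid) \<Rightarrow> ('i \<Rightarrow> 'i \<Rightarrow> 'x \<Rightarrow> 'x) \<Rightarrow>
     ('i \<times> 'x) set monoid" where
  "colim_grp S r G t =
     \<lparr>carrier = {colim_class S r G t i x |i x. i \<in> S \<and> x \<in> carrier (G i)},
      monoid.mult = (\<lambda>X Y. \<Union>{colim_class S r G t k (t i k x \<otimes>\<^bsub>G k\<^esub> t j k y) |i x j y k.
        (i, x) \<in> X \<and> (j, y) \<in> Y \<and> k \<in> S \<and> r i k \<and> r j k}),
      one = (\<Union>i\<in>S. colim_class S r G t i \<one>\<^bsub>G i\<^esub>)\<rparr>"

definition colim_fun ::
  "'i set \<Rightarrow> ('i \<Rightarrow> 'i \<Rightarrow> bool) \<Rightarrow> ('i \<Rightarrow> ('r, 'u, 'x) gfun) \<Rightarrow>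
     ('i \<Rightarrow> 'i \<Rightarrow> ('r, 'u) gmod \<Rightarrow> int \<Rightarrow> 'x \<Rightarrow> 'x) \<Rightarrow> ('r, 'u, ('i \<times> 'x) set) gfun" where
  "colim_fun S r F t =
     \<lparr>fobj = (\<lambda>M d. colim_grp S r (\<lambda>i. fobj (F i) M d) (\<lambda>i j. t i j M d)),
      fmor = (\<lambda>M N f d X. \<Union>(i, x)\<in>X.
        colim_class S r (\<lambda>i. fobj (F i) N d) (\<lambda>i j. t i j N d) i (fmor (F i) M N f d x))\<rparr>"

definition ring_quot :: "'r gring \<Rightarrow> 'r gideal \<Rightarrow> ('r, 'r set) gmod" where
  "ring_quot R I = quot_mod (reg R) I"

text \<open>The projection \<open>R/J \<rightarrow> R/I\<close> for \<open>J \<subseteq> I\<close>.\<close>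

definition quot_proj :: "'r gring \<Rightarrow> 'r gideal \<Rightarrow> int \<Rightarrow> 'r set \<Rightarrow> 'r set" where
  "quot_proj R I n = coset_map (rgrp R n) (I n) (\<lambda>x. x)"

text \<open>\<open>colim\<^bsub>i\<in>S\<^esub> Ext\<^sup>n(R/I\<^sub>i, -)\<close> for a family of ideals \<open>I\<close> that decreases along \<open>r\<close>.\<close>

definition colim_Ext ::
  "'r gring \<Rightarrow> int \<Rightarrow> 'i set \<Rightarrow> ('i \<Rightarrow> 'i \<Rightarrow> bool) \<Rightarrow> ('i \<Rightarrow> 'r gideal) \<Rightarrow>
     ('r, 'u, ('i \<times> (int \<Rightarrow> 'r set \<Rightarrow> 'u) set) set) gfun" where
  "colim_Ext R n S r I = colim_fun S r (\<lambda>i. Ext_fun R n (ring_quot R (I i)))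
     (\<lambda>i j. Ext_restrict R n (ring_quot R (I j)) (quot_proj R (I i)))"


section \<open>Size of the type of elements\<close>

text \<open>
  HOL has no universe of sets, so graded modules have their elements in some type \<open>'u\<close>. That type
  must be large enough for the resulting category of graded \<open>R\<close>-modules to have injective
  resolutions. This holds if \<open>'u\<close> is closed, up to injections, under families indexed by
  homogeneous elements of \<open>R\<close>, i.e. if its cardinality is at least its own power with exponent
  \<open>|int \<times> 'r|\<close>. By the lemma below, every type embeds into such a type.
\<close>

definition large_type :: "'r itself \<Rightarrow> 'u itself \<Rightarrow> bool" where
  "large_type (_ :: 'r itself) (_ :: 'u itself) \<longleftrightarrow> (\<exists>\<phi> :: (int \<Rightarrow> 'r \<Rightarrow> 'u) \<Rightarrow> 'u. inj \<phi>)"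

lemma large_type_exists: "large_type TYPE('r) TYPE(int \<Rightarrow> 'r \<Rightarrow> 'v)"
proof -
  have "infinite (UNIV :: (int \<times> 'r) set)"
    by (simp add: finite_prod)
  then obtain f :: "(int \<times> 'r) \<times> (int \<times> 'r) \<Rightarrow> int \<times> 'r"
    where "bij_betw f (UNIV \<times> UNIV) UNIV"
    using card_of_Times_same_infinite card_of_ordIso by blast
  then obtain b :: "int \<times> 'r \<Rightarrow> (int \<times> 'r) \<times> (int \<times> 'r)" where "bij_betw b UNIV (UNIV \<times> UNIV)"
    using bij_betw_inv by blast
  then have surj: "surj b" by (simp add: bij_betw_def)
  define \<phi> :: "(int \<Rightarrow> 'r \<Rightarrow> int \<Rightarrow> 'r \<Rightarrow> 'v) \<Rightarrow> int \<Rightarrow> 'r \<Rightarrow> 'v"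
    where "\<phi> = (\<lambda>F i r. case b (i, r) of ((j, s), (k, t)) \<Rightarrow> F j s k t)"
  have "inj \<phi>"
  proof (rule injI, intro ext)
    fix F G j s k t
    assume eq: "\<phi> F = \<phi> G"
    obtain i r where "b (i, r) = ((j, s), (k, t))"
      using surj by (metis surjD surj_pair)
    then show "F j s k t = G j s k t"
      using fun_cong[OF fun_cong[OF eq, of i], of r] by (simp add: \<phi>_def)
  qed
  then show ?thesis unfolding large_type_def by blast
qed

end

theory Submission
  imports Defs
begin

text \<open>
  The ring \<open>R = \<Gamma>\<^sup>*\<close> is concentrated in nonnegative degrees: it is the limit of the Poincare duality
  algebras \<open>\<Gamma>\<^sup>*(n)\<close>, and the limit map is injective. As functionals separate points, \<open>\<Gamma>\<close> lives in
  nonpositive degrees (\<open>mitchell_nonpositive\<close>).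

  \<^bold>\<open>The two ideal sets.\<close> For \<open>x\<close> of degree \<open>d\<close> and \<open>f\<close> of degree \<open>n > - d\<close> the element \<open>f \<cdot> x\<close> has positive
  degree, so it vanishes and \<open>I\<^sub>j\<close> annihilates \<open>x\<close> as soon as \<open>j > - d\<close>. Conversely, the counit
  satisfies \<open>\<epsilon> (f \<cdot> x) = f x\<close>; hence a functional of degree \<open>n\<close> that annihilates a finite spanning set of
  \<open>\<Gamma>\<close> in degree \<open>- n\<close> is zero, and the annihilators of such spanning sets for \<open>0 \<le> n < j\<close> intersect in a
  subideal of \<open>I\<^sub>j\<close> (\<open>dist_equivalent_grad\<close>). For the ideals \<open>I\<^sub>j\<close> the elements killed by some member
  of the set already form a submodule, because \<open>I\<^sub>j r \<subseteq> I\<^sub>j\<close> in a nonnegatively graded ring; this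
  gives closedness and the comparison of \<open>h\<^sup>0\<close> with \<open>H\<^sup>0\<close>.

  \<^bold>\<open>Local cohomology as a colimit.\<close> A homomorphism \<open>R/I \<rightarrow> E\<close> is the same as an element of \<open>E\<close> killed
  by \<open>I\<close>. So \<open>H\<^sup>0(E)\<close> is the directed union, that is the colimit, of the groups \<open>hom(R/I, E)\<close>. Apply
  this to the terms of an injective resolution: directed colimits are exact, so they commute with
  the formation of cohomology (\<open>colim_subquotient\<close>, \<open>derived_torsion_colim_Ext\<close>). As both sides are
  computed from the same resolution and the same lifts of homomorphisms, naturality is a
  direct check.

  \<^bold>\<open>Existence of injective resolutions.\<close> The derived functors are defined by choosing injective
  resolutions inside a fixed type of elements, so these have to be constructed. Over an
  algebra \<open>R\<close> over a field \<open>K\<close> a module \<open>M\<close> embeds into the coinduced module \<open>hom\<^sub>K(R, M)\<close>, which is injective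
  because linear maps of vector spaces extend from subspaces (\<open>enough_injectives\<close>). Its elements are
  functions on \<open>int \<times> R\<close>, which is what a large type can encode.
\<close>

section \<open>Extension of linear maps of vector spaces\<close>

text \<open>
  A vector space over \<open>K\<close> is given by an abelian group and an action of \<open>K\<close>. The homogeneous components of
  graded modules are plain groups, on which the scalars act through a degree zero part of the ring.
\<close>

locale scalar_action = field K + V: comm_group V
  for K :: "'k ring" (structure) and V :: "'v monoid" and sc :: "'k \<Rightarrow> 'v \<Rightarrow> 'v" +
  assumes sc_hom: "c \<in> carrier K \<Longrightarrow> sc c \<in> hom V V"
    and sc_add: "c \<in> carrier K \<Longrightarrow> d \<in> carrier K \<Longrightarrow> x \<in> carrier V \<Longrightarrow> sc (c \<oplus> d) x = sc c x \<otimes>\<^bsub>V\<^esub> sc d x"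
    and sc_mult: "c \<in> carrier K \<Longrightarrow> d \<in> carrier K \<Longrightarrow> x \<in> carrier V \<Longrightarrow> sc (c \<otimes> d) x = sc c (sc d x)"
    and sc_one: "x \<in> carrier V \<Longrightarrow> sc \<one> x = x"
begin

lemma sc_closed [simp]: "c \<in> carrier K \<Longrightarrow> x \<in> carrier V \<Longrightarrow> sc c x \<in> carrier V"
  using sc_hom by (auto simp: hom_def)

lemma sc_distrib: "c \<in> carrier K \<Longrightarrow> x \<in> carrier V \<Longrightarrow> y \<in> carrier V \<Longrightarrow>
    sc c (x \<otimes>\<^bsub>V\<^esub> y) = sc c x \<otimes>\<^bsub>V\<^esub> sc c y"
  using sc_hom by (auto simp: hom_def)

lemma sc_zero: assumes "x \<in> carrier V" shows "sc \<zero> x = \<one>\<^bsub>V\<^esub>"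
proof -
  have "sc \<zero> x \<otimes>\<^bsub>V\<^esub> sc \<zero> x = sc \<zero> x"
    using sc_add[of \<zero> \<zero> x] assms by simp
  then show ?thesis using assms by (simp add: V.l_cancel_one')
qed

definition subspace :: "'v set \<Rightarrow> bool" where
  "subspace Q \<longleftrightarrow> subgroup Q V \<and> (\<forall>c\<in>carrier K. \<forall>x\<in>Q. sc c x \<in> Q)"

lemma subspaceD:
  assumes "subspace Q"
  shows "subgroup Q V" "x \<in> Q \<Longrightarrow> x \<in> carrier V" "\<one>\<^bsub>V\<^esub> \<in> Q" "x \<in> Q \<Longrightarrow> inv\<^bsub>V\<^esub> x \<in> Q"
    "x \<in> Q \<Longrightarrow> y \<in> Q \<Longrightarrow> x \<otimes>\<^bsub>V\<^esub> y \<in> Q" "c \<in> carrier K \<Longrightarrow> x \<in> Q \<Longrightarrow> sc c x \<in> Q"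
  using assms subgroup.subset[of Q V] subgroup.one_closed[of Q V] subgroup.m_inv_closed[of Q V]
    subgroup.m_closed[of Q V] by (auto simp: subspace_def)

lemma subspace_chain_Union:
  assumes ne: "\<C> \<noteq> {}" and chain: "\<And>X Y. X \<in> \<C> \<Longrightarrow> Y \<in> \<C> \<Longrightarrow> X \<subseteq> Y \<or> Y \<subseteq> X"
    and sub: "\<And>X. X \<in> \<C> \<Longrightarrow> subspace X"
  shows "subspace (\<Union>\<C>)"
proof -
  have "subgroup (\<Union>\<C>) V"
  proof (rule V.subgroupI)
    show "\<Union>\<C> \<subseteq> carrier V" using subspaceD(2)[OF sub] by blast
    show "\<Union>\<C> \<noteq> {}" using ne subspaceD(3)[OF sub] by blast
    fix a assume "a \<in> \<Union>\<C>"
    then show "inv\<^bsub>V\<^esub> a \<in> \<Union>\<C>" using subspaceD(4)[OF sub] by blast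
    fix b assume "b \<in> \<Union>\<C>"
    with \<open>a \<in> \<Union>\<C>\<close> obtain X where "X \<in> \<C>" "a \<in> X" "b \<in> X" using chain by blast
    then show "a \<otimes>\<^bsub>V\<^esub> b \<in> \<Union>\<C>" using subspaceD(5)[OF sub] by blast
  qed
  moreover have "sc c x \<in> \<Union>\<C>" if "c \<in> carrier K" "x \<in> \<Union>\<C>" for c x
    using that subspaceD(6)[OF sub] by blast
  ultimately show ?thesis by (simp add: subspace_def)
qed

lemma subspace_adjoin:
  assumes Q: "subspace Q" and x: "x \<in> carrier V"
  shows "subspace {q \<otimes>\<^bsub>V\<^esub> sc c x |q c. q \<in> Q \<and> c \<in> carrier K}" (is "subspace ?T")
proof -
  have sub: "subgroup Q V" using Q by (simp add: subspace_def)
  have Qc: "q \<in> carrier V" if "q \<in> Q" for q using sub that subgroup.subset by blast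
  have "subgroup ?T V"
  proof (rule V.subgroupI)
    show "?T \<subseteq> carrier V" using Qc x by auto
    show "?T \<noteq> {}" using subgroup.one_closed[OF sub] by blast
    fix a assume "a \<in> ?T"
    then obtain q c where a: "a = q \<otimes>\<^bsub>V\<^esub> sc c x" "q \<in> Q" "c \<in> carrier K" by blast
    have "sc (\<ominus> c) x \<otimes>\<^bsub>V\<^esub> sc c x = \<one>\<^bsub>V\<^esub>"
      using a x sc_add[of "\<ominus> c" c x] by (simp add: l_neg sc_zero)
    then have "sc (\<ominus> c) x = inv\<^bsub>V\<^esub> (sc c x)" using a x by (simp add: V.inv_equality)
    then have "inv\<^bsub>V\<^esub> a = inv\<^bsub>V\<^esub> q \<otimes>\<^bsub>V\<^esub> sc (\<ominus> c) x" using a x Qc by (simp add: V.inv_mult)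
    then show "inv\<^bsub>V\<^esub> a \<in> ?T" using a subgroup.m_inv_closed[OF sub] by blast
    fix b assume "b \<in> ?T"
    then obtain q' c' where b: "b = q' \<otimes>\<^bsub>V\<^esub> sc c' x" "q' \<in> Q" "c' \<in> carrier K" by blast
    have "a \<otimes>\<^bsub>V\<^esub> b = (q \<otimes>\<^bsub>V\<^esub> q') \<otimes>\<^bsub>V\<^esub> sc (c \<oplus> c') x"
      using a b x Qc by (simp add: sc_add V.m_ac)
    then show "a \<otimes>\<^bsub>V\<^esub> b \<in> ?T" using a b subgroup.m_closed[OF sub] by blast
  qed
  moreover have "sc d a \<in> ?T" if d: "d \<in> carrier K" and "a \<in> ?T" for d a
  proof -
    obtain q c where a: "a = q \<otimes>\<^bsub>V\<^esub> sc c x" "q \<in> Q" "c \<in> carrier K" using \<open>a \<in> ?T\<close> by blast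
    have "sc d a = sc d q \<otimes>\<^bsub>V\<^esub> sc (d \<otimes> c) x" using a x Qc d by (simp add: sc_distrib sc_mult)
    then show ?thesis using a d Q by (auto simp: subspace_def)
  qed
  ultimately show ?thesis by (simp add: subspace_def)
qed

text \<open>
  Zorn's lemma gives a maximal subspace \<open>Q\<close> that meets \<open>P\<close> trivially. A vector \<open>x\<close> outside \<open>Q + P\<close> could be
  adjoined to \<open>Q\<close>: if \<open>q + c x\<close> lies in \<open>P\<close> with \<open>c \<noteq> 0\<close>, dividing by \<open>c\<close> puts \<open>x\<close> into \<open>Q + P\<close>.
\<close>

lemma complement_exists:
  assumes P: "subspace P"
  shows "\<exists>Q. subspace Q \<and> Q \<inter> P = {\<one>\<^bsub>V\<^esub>} \<and>
    (\<forall>x\<in>carrier V. \<exists>q\<in>Q. \<exists>p\<in>P. x = q \<otimes>\<^bsub>V\<^esub> p)"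
proof -
  define \<A> where "\<A> = {Q. subspace Q \<and> Q \<inter> P = {\<one>\<^bsub>V\<^esub>}}"
  have subP: "subgroup P V" using P by (simp add: subspace_def)
  have sc1: "sc c \<one>\<^bsub>V\<^esub> = \<one>\<^bsub>V\<^esub>" if "c \<in> carrier K" for c
    using sc_hom[OF that] V.is_group by (simp add: hom_one)
  have "\<exists>M\<in>\<A>. \<forall>X\<in>\<A>. M \<subseteq> X \<longrightarrow> X = M"
  proof (rule subset_Zorn_nonempty)
    have "{\<one>\<^bsub>V\<^esub>} \<in> \<A>"
      using subgroup.one_closed[OF subP] V.triv_subgroup sc1 by (auto simp: \<A>_def subspace_def)
    then show "\<A> \<noteq> {}" by blast
    fix \<C> assume ne: "\<C> \<noteq> {}" and "subset.chain \<A> \<C>"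
    then have "\<And>X Y. X \<in> \<C> \<Longrightarrow> Y \<in> \<C> \<Longrightarrow> X \<subseteq> Y \<or> Y \<subseteq> X" and \<C>: "\<C> \<subseteq> \<A>"
      by (auto simp: subset_chain_def)
    then have "subspace (\<Union>\<C>)" using ne by (intro subspace_chain_Union) (auto simp: \<A>_def)
    moreover have "\<Union>\<C> \<inter> P = {\<one>\<^bsub>V\<^esub>}" using \<C> ne by (fastforce simp: \<A>_def)
    ultimately show "\<Union>\<C> \<in> \<A>" by (simp add: \<A>_def)
  qed
  then obtain Q where Q: "subspace Q" "Q \<inter> P = {\<one>\<^bsub>V\<^esub>}" and max: "\<And>X. X \<in> \<A> \<Longrightarrow> Q \<subseteq> X \<Longrightarrow> X = Q"
    by (auto simp: \<A>_def)
  have subQ: "subgroup Q V" using Q by (simp add: subspace_def)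
  have Qc: "q \<in> carrier V" if "q \<in> Q" for q using subQ that subgroup.subset by blast
  have Pc: "q \<in> carrier V" if "q \<in> P" for q using subP that subgroup.subset by blast
  have "\<exists>q\<in>Q. \<exists>p\<in>P. x = q \<otimes>\<^bsub>V\<^esub> p" if x: "x \<in> carrier V" for x
  proof (rule ccontr)
    assume no: "\<not> ?thesis"
    define T where "T = {q \<otimes>\<^bsub>V\<^esub> sc c x |q c. q \<in> Q \<and> c \<in> carrier K}"
    have "y = \<one>\<^bsub>V\<^esub>" if y: "y \<in> T" "y \<in> P" for y
    proof -
      obtain q c where q: "y = q \<otimes>\<^bsub>V\<^esub> sc c x" "q \<in> Q" "c \<in> carrier K" using y by (auto simp: T_def)
      show ?thesis
      proof (cases "c = \<zero>")
        case True
        then have "y = q" using q x Qc by (simp add: sc_zero)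
        then show ?thesis using q y Q by blast
      next
        case False
        then have c: "c \<in> Units K" using q field_Units by simp
        then have ic: "inv c \<in> carrier K" "inv c \<otimes> c = \<one>" by auto
        have "sc c x = inv\<^bsub>V\<^esub> q \<otimes>\<^bsub>V\<^esub> y" using q x Qc by (simp add: V.m_assoc[symmetric])
        then have "sc (inv c) (sc c x) = sc (inv c) (inv\<^bsub>V\<^esub> q) \<otimes>\<^bsub>V\<^esub> sc (inv c) y"
          using q(2,3) x Qc ic Pc[OF y(2)] by (simp add: sc_distrib)
        then have "x = sc (inv c) (inv\<^bsub>V\<^esub> q) \<otimes>\<^bsub>V\<^esub> sc (inv c) y"
          using q x ic by (simp add: sc_mult[symmetric] sc_one)
        moreover have "sc (inv c) (inv\<^bsub>V\<^esub> q) \<in> Q" "sc (inv c) y \<in> P"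
          using Q P y ic q subgroup.m_inv_closed[OF subQ] by (auto simp: subspace_def)
        ultimately show ?thesis using no by blast
      qed
    qed
    moreover have "subspace T" unfolding T_def by (rule subspace_adjoin[OF Q(1) x])
    moreover have "\<one>\<^bsub>V\<^esub> \<in> P" "\<one>\<^bsub>V\<^esub> \<in> T"
      using subgroup.one_closed[OF subP] subgroup.one_closed \<open>subspace T\<close> by (auto simp: subspace_def)
    ultimately have "T \<in> \<A>" unfolding \<A>_def by blast
    moreover have "Q \<subseteq> T"
    proof
      fix q assume "q \<in> Q"
      then have "q = q \<otimes>\<^bsub>V\<^esub> sc \<zero> x" using Qc x by (simp add: sc_zero)
      then show "q \<in> T" using \<open>q \<in> Q\<close> unfolding T_def by blast
    qed
    ultimately have "T = Q" by (rule max)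
    moreover have "\<one>\<^bsub>V\<^esub> \<otimes>\<^bsub>V\<^esub> sc \<one> x \<in> T"
      unfolding T_def using subgroup.one_closed[OF subQ] by blast
    ultimately have "x \<in> Q" using x by (simp add: sc_one)
    then show False using no subgroup.one_closed[OF subP] x by (metis V.r_one)
  qed
  then show ?thesis using Q by blast
qed

end

text \<open>
  On the image of \<open>u\<close> the map \<open>g\<close> is forced, and well defined since \<open>ker u \<subseteq> ker v\<close>; on a complement of
  the image it is set to zero. The kernel formulation covers at once the extension along an injection
  and the construction of functionals with a prescribed value at a nonzero vector.
\<close>

lemma extend_linear_map:
  assumes U: "scalar_action K U a" and V: "scalar_action K V b" and W: "scalar_action K W c"
    and u: "u \<in> hom U V" "\<And>k x. k \<in> carrier K \<Longrightarrow> x \<in> carrier U \<Longrightarrow> u (a k x) = b k (u x)"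
    and v: "v \<in> hom U W" "\<And>k x. k \<in> carrier K \<Longrightarrow> x \<in> carrier U \<Longrightarrow> v (a k x) = c k (v x)"
    and ker: "\<And>x. x \<in> carrier U \<Longrightarrow> u x = \<one>\<^bsub>V\<^esub> \<Longrightarrow> v x = \<one>\<^bsub>W\<^esub>"
  shows "\<exists>g. g \<in> hom V W \<and> (\<forall>k\<in>carrier K. \<forall>x\<in>carrier V. g (b k x) = c k (g x)) \<and>
    (\<forall>x\<in>carrier U. g (u x) = v x)"
proof -
  interpret U: scalar_action K U a by fact
  interpret V: scalar_action K V b by fact
  interpret W: scalar_action K W c by fact
  have uc [simp]: "u x \<in> carrier V" and vc [simp]: "v x \<in> carrier W" if "x \<in> carrier U" for x
    using u v that by (auto simp: hom_def)
  have uh: "group_hom U V u" using u by unfold_locales auto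
  have vh: "group_hom U W v" using v by unfold_locales auto
  have um: "u (x \<otimes>\<^bsub>U\<^esub> y) = u x \<otimes>\<^bsub>V\<^esub> u y" and vm: "v (x \<otimes>\<^bsub>U\<^esub> y) = v x \<otimes>\<^bsub>W\<^esub> v y"
    if "x \<in> carrier U" "y \<in> carrier U" for x y using that u v by (auto simp: hom_def)
  have img: "V.subspace (u ` carrier U)"
    unfolding V.subspace_def
  proof (intro conjI ballI)
    show "subgroup (u ` carrier U) V" using group_hom.img_is_subgroup[OF uh] .
    fix k x assume "k \<in> carrier K" "x \<in> u ` carrier U"
    then show "b k x \<in> u ` carrier U" using u(2)[symmetric] by auto
  qed
  obtain Q where Q: "V.subspace Q" "Q \<inter> u ` carrier U = {\<one>\<^bsub>V\<^esub>}"
    and tot: "\<And>x. x \<in> carrier V \<Longrightarrow> \<exists>q\<in>Q. \<exists>p\<in>u ` carrier U. x = q \<otimes>\<^bsub>V\<^esub> p"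
    using V.complement_exists[OF img] by metis
  have subQ: "subgroup Q V" using Q by (simp add: V.subspace_def)
  have Qc [simp]: "q \<in> carrier V" if "q \<in> Q" for q using subQ that subgroup.subset by blast
  have uniq: "v x = v y"
    if e: "q \<otimes>\<^bsub>V\<^esub> u x = q' \<otimes>\<^bsub>V\<^esub> u y" and m: "q \<in> Q" "q' \<in> Q" "x \<in> carrier U" "y \<in> carrier U" for q q' x y
  proof -
    have "inv\<^bsub>V\<^esub> q' \<otimes>\<^bsub>V\<^esub> q = inv\<^bsub>V\<^esub> q' \<otimes>\<^bsub>V\<^esub> (q \<otimes>\<^bsub>V\<^esub> u x) \<otimes>\<^bsub>V\<^esub> inv\<^bsub>V\<^esub> (u x)"
      using m by (simp add: V.V.m_assoc)
    also have "\<dots> = inv\<^bsub>V\<^esub> q' \<otimes>\<^bsub>V\<^esub> (q' \<otimes>\<^bsub>V\<^esub> u y) \<otimes>\<^bsub>V\<^esub> inv\<^bsub>V\<^esub> (u x)" by (simp add: e)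
    also have "\<dots> = u y \<otimes>\<^bsub>V\<^esub> inv\<^bsub>V\<^esub> (u x)" using m by (simp add: V.V.m_assoc[symmetric])
    also have "\<dots> = u (y \<otimes>\<^bsub>U\<^esub> inv\<^bsub>U\<^esub> x)" using m group_hom.hom_inv[OF uh] by (simp add: um)
    finally have eq: "inv\<^bsub>V\<^esub> q' \<otimes>\<^bsub>V\<^esub> q = u (y \<otimes>\<^bsub>U\<^esub> inv\<^bsub>U\<^esub> x)" .
    moreover have "inv\<^bsub>V\<^esub> q' \<otimes>\<^bsub>V\<^esub> q \<in> Q" using m subQ by (simp add: subgroup.m_closed subgroup.m_inv_closed)
    ultimately have "u (y \<otimes>\<^bsub>U\<^esub> inv\<^bsub>U\<^esub> x) = \<one>\<^bsub>V\<^esub>" using Q(2) m by (metis IntI U.V.inv_closed U.V.m_closed imageI singletonD)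
    then have "v (y \<otimes>\<^bsub>U\<^esub> inv\<^bsub>U\<^esub> x) = \<one>\<^bsub>W\<^esub>" using ker m by simp
    then have "v y \<otimes>\<^bsub>W\<^esub> inv\<^bsub>W\<^esub> (v x) = \<one>\<^bsub>W\<^esub>" using m group_hom.hom_inv[OF vh] by (simp add: vm)
    then have "v y \<otimes>\<^bsub>W\<^esub> inv\<^bsub>W\<^esub> (v x) \<otimes>\<^bsub>W\<^esub> v x = v x" using m by simp
    then show ?thesis using m by (simp add: W.V.m_assoc)
  qed
  define g where "g y = (THE w. \<exists>q\<in>Q. \<exists>x\<in>carrier U. y = q \<otimes>\<^bsub>V\<^esub> u x \<and> w = v x)" for y
  have g: "g (q \<otimes>\<^bsub>V\<^esub> u x) = v x" if "q \<in> Q" "x \<in> carrier U" for q x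
    unfolding g_def
  proof (rule the_equality)
    show "\<exists>q'\<in>Q. \<exists>x'\<in>carrier U. q \<otimes>\<^bsub>V\<^esub> u x = q' \<otimes>\<^bsub>V\<^esub> u x' \<and> v x = v x'" using that by blast
    fix w assume "\<exists>q'\<in>Q. \<exists>x'\<in>carrier U. q \<otimes>\<^bsub>V\<^esub> u x = q' \<otimes>\<^bsub>V\<^esub> u x' \<and> w = v x'"
    then obtain q' x' where "q' \<in> Q" "x' \<in> carrier U" "q \<otimes>\<^bsub>V\<^esub> u x = q' \<otimes>\<^bsub>V\<^esub> u x'" "w = v x'" by blast
    then show "w = v x" using uniq that by metis
  qed
  have dec: "\<exists>q\<in>Q. \<exists>x\<in>carrier U. y = q \<otimes>\<^bsub>V\<^esub> u x" if "y \<in> carrier V" for y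
    using tot[OF that] by blast
  show ?thesis
  proof (intro exI[of _ g] conjI ballI)
    show "g \<in> hom V W"
    proof (rule homI)
      fix y assume "y \<in> carrier V"
      then obtain q x where 1: "q \<in> Q" "x \<in> carrier U" "y = q \<otimes>\<^bsub>V\<^esub> u x" using dec by blast
      then show "g y \<in> carrier W" by (simp add: g)
      fix y' assume "y' \<in> carrier V"
      then obtain q' x' where 2: "q' \<in> Q" "x' \<in> carrier U" "y' = q' \<otimes>\<^bsub>V\<^esub> u x'" using dec by blast
      have "y \<otimes>\<^bsub>V\<^esub> y' = (q \<otimes>\<^bsub>V\<^esub> q') \<otimes>\<^bsub>V\<^esub> u (x \<otimes>\<^bsub>U\<^esub> x')"
        using 1 2 by (simp add: um V.V.m_ac)
      moreover have "q \<otimes>\<^bsub>V\<^esub> q' \<in> Q" using 1 2 subQ by (simp add: subgroup.m_closed)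
      ultimately show "g (y \<otimes>\<^bsub>V\<^esub> y') = g y \<otimes>\<^bsub>W\<^esub> g y'"
        using 1 2 by (simp add: g vm)
    qed
    fix k y assume k: "k \<in> carrier K" and "y \<in> carrier V"
    then obtain q x where 1: "q \<in> Q" "x \<in> carrier U" "y = q \<otimes>\<^bsub>V\<^esub> u x" using dec by blast
    have "b k y = b k q \<otimes>\<^bsub>V\<^esub> u (a k x)" using 1 k by (simp add: V.sc_distrib u(2))
    moreover have "b k q \<in> Q" using Q(1) 1 k by (simp add: V.subspace_def)
    ultimately show "g (b k y) = c k (g y)" using 1 k by (simp add: g v(2))
  next
    fix x assume "x \<in> carrier U"
    then show "g (u x) = v x"
      using g[of "\<one>\<^bsub>V\<^esub>" x] subgroup.one_closed[OF subQ] by simp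
  qed
qed

section \<open>Graded rings and modules\<close>

locale graded_ring_over =
  fixes R :: "'r gring"
  assumes graded_ring: "graded_ring R"
begin

lemma regular_module: "gmodule R (reg R)"
  using graded_ring by (simp add: graded_ring_def)

sublocale rg: comm_group "rgrp R n" for n
  using regular_module by (simp add: gmodule_def ggroup_def reg_def)

lemma rone_closed [simp]: "rone R \<in> carrier (rgrp R 0)"
  using graded_ring by (simp add: graded_ring_def)

lemma rmul_closed [simp]:
  "r \<in> carrier (rgrp R p) \<Longrightarrow> s \<in> carrier (rgrp R q) \<Longrightarrow> rmul R p q r s \<in> carrier (rgrp R (p + q))"
  using regular_module by (auto simp: gmodule_def reg_def hom_def)

lemma rmul_distrib:
  "r \<in> carrier (rgrp R p) \<Longrightarrow> s \<in> carrier (rgrp R q) \<Longrightarrow> t \<in> carrier (rgrp R q) \<Longrightarrow>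
    rmul R p q r (s \<otimes>\<^bsub>rgrp R q\<^esub> t) = rmul R p q r s \<otimes>\<^bsub>rgrp R (p + q)\<^esub> rmul R p q r t"
  using regular_module by (auto simp: gmodule_def reg_def hom_def)

lemma rmul_add:
  "r \<in> carrier (rgrp R p) \<Longrightarrow> s \<in> carrier (rgrp R p) \<Longrightarrow> t \<in> carrier (rgrp R q) \<Longrightarrow>
    rmul R p q (r \<otimes>\<^bsub>rgrp R p\<^esub> s) t = rmul R p q r t \<otimes>\<^bsub>rgrp R (p + q)\<^esub> rmul R p q s t"
  using regular_module by (auto simp: gmodule_def reg_def)

lemma rmul_assoc:
  "r \<in> carrier (rgrp R p) \<Longrightarrow> s \<in> carrier (rgrp R q) \<Longrightarrow> t \<in> carrier (rgrp R n) \<Longrightarrow>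
    rmul R (p + q) n (rmul R p q r s) t = rmul R p (q + n) r (rmul R q n s t)"
  using regular_module by (auto simp: gmodule_def reg_def)

lemma rmul_one_left [simp]: "r \<in> carrier (rgrp R n) \<Longrightarrow> rmul R 0 n (rone R) r = r"
  using regular_module by (auto simp: gmodule_def reg_def)

lemma rmul_one_right [simp]: "r \<in> carrier (rgrp R n) \<Longrightarrow> rmul R n 0 r (rone R) = r"
  using graded_ring by (auto simp: graded_ring_def)

end

locale graded_left_module = graded_ring_over R for R :: "'r gring" +
  fixes M :: "('r, 'x) gmod"
  assumes gmodule: "gmodule R M"
begin

sublocale mg: comm_group "mgrp M n" for n
  using gmodule by (simp add: gmodule_def ggroup_def)

lemma act_hom: "r \<in> carrier (rgrp R p) \<Longrightarrow> act M p q r \<in> hom (mgrp M q) (mgrp M (p + q))"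
  using gmodule by (simp add: gmodule_def)

lemma act_closed [simp]:
  "r \<in> carrier (rgrp R p) \<Longrightarrow> x \<in> carrier (mgrp M q) \<Longrightarrow> act M p q r x \<in> carrier (mgrp M (p + q))"
  using act_hom by (auto simp: hom_def)

lemma act_distrib:
  "r \<in> carrier (rgrp R p) \<Longrightarrow> x \<in> carrier (mgrp M q) \<Longrightarrow> y \<in> carrier (mgrp M q) \<Longrightarrow>
    act M p q r (x \<otimes>\<^bsub>mgrp M q\<^esub> y) = act M p q r x \<otimes>\<^bsub>mgrp M (p + q)\<^esub> act M p q r y"
  using act_hom by (auto simp: hom_def)

lemma act_one [simp]:
  "r \<in> carrier (rgrp R p) \<Longrightarrow> act M p q r \<one>\<^bsub>mgrp M q\<^esub> = \<one>\<^bsub>mgrp M (p + q)\<^esub>"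
  using hom_one[OF act_hom mg.is_group mg.is_group] .

lemma act_inv:
  assumes "r \<in> carrier (rgrp R p)" "x \<in> carrier (mgrp M q)"
  shows "act M p q r (inv\<^bsub>mgrp M q\<^esub> x) = inv\<^bsub>mgrp M (p + q)\<^esub> act M p q r x"
proof -
  have "group_hom (mgrp M q) (mgrp M (p + q)) (act M p q r)"
    using act_hom[OF assms(1)] mg.is_group by (simp add: group_hom_def group_hom_axioms_def)
  then show ?thesis using assms(2) by (rule group_hom.hom_inv)
qed

lemma act_add:
  "r \<in> carrier (rgrp R p) \<Longrightarrow> s \<in> carrier (rgrp R p) \<Longrightarrow> x \<in> carrier (mgrp M q) \<Longrightarrow>
    act M p q (r \<otimes>\<^bsub>rgrp R p\<^esub> s) x = act M p q r x \<otimes>\<^bsub>mgrp M (p + q)\<^esub> act M p q s x"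
  using gmodule by (simp add: gmodule_def)

lemma act_assoc:
  "r \<in> carrier (rgrp R p) \<Longrightarrow> s \<in> carrier (rgrp R q) \<Longrightarrow> x \<in> carrier (mgrp M n) \<Longrightarrow>
    act M (p + q) n (rmul R p q r s) x = act M p (q + n) r (act M q n s x)"
  using gmodule by (simp add: gmodule_def)

lemma act_unit [simp]: "x \<in> carrier (mgrp M n) \<Longrightarrow> act M 0 n (rone R) x = x"
  using gmodule by (simp add: gmodule_def)

lemma act_zero:
  assumes "x \<in> carrier (mgrp M q)"
  shows "act M p q \<one>\<^bsub>rgrp R p\<^esub> x = \<one>\<^bsub>mgrp M (p + q)\<^esub>"
  using act_add[of "\<one>\<^bsub>rgrp R p\<^esub>" p "\<one>\<^bsub>rgrp R p\<^esub>" x q] assms by (simp add: mg.l_cancel_one')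

end

lemma gmoduleI:
  assumes "\<And>n. comm_group (mgrp M n)"
    and "\<And>p q r x. r \<in> carrier (rgrp R p) \<Longrightarrow> x \<in> carrier (mgrp M q) \<Longrightarrow> act M p q r x \<in> carrier (mgrp M (p + q))"
    and "\<And>p q r x y. r \<in> carrier (rgrp R p) \<Longrightarrow> x \<in> carrier (mgrp M q) \<Longrightarrow> y \<in> carrier (mgrp M q) \<Longrightarrow>
      act M p q r (x \<otimes>\<^bsub>mgrp M q\<^esub> y) = act M p q r x \<otimes>\<^bsub>mgrp M (p + q)\<^esub> act M p q r y"
    and "\<And>p q r s x. r \<in> carrier (rgrp R p) \<Longrightarrow> s \<in> carrier (rgrp R p) \<Longrightarrow> x \<in> carrier (mgrp M q) \<Longrightarrow>
      act M p q (r \<otimes>\<^bsub>rgrp R p\<^esub> s) x = act M p q r x \<otimes>\<^bsub>mgrp M (p + q)\<^esub> act M p q s x"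
    and "\<And>p q n r s x. r \<in> carrier (rgrp R p) \<Longrightarrow> s \<in> carrier (rgrp R q) \<Longrightarrow> x \<in> carrier (mgrp M n) \<Longrightarrow>
      act M (p + q) n (rmul R p q r s) x = act M p (q + n) r (act M q n s x)"
    and "\<And>n x. x \<in> carrier (mgrp M n) \<Longrightarrow> act M 0 n (rone R) x = x"
  shows "gmodule R M"
  unfolding gmodule_def ggroup_def using assms by (auto intro!: homI)

lemma comm_group_surj_image:
  assumes G: "comm_group G" and surj: "\<pi> ` carrier G = carrier H"
    and mult: "\<And>x y. x \<in> carrier G \<Longrightarrow> y \<in> carrier G \<Longrightarrow> \<pi> (x \<otimes>\<^bsub>G\<^esub> y) = \<pi> x \<otimes>\<^bsub>H\<^esub> \<pi> y"
    and one: "\<pi> \<one>\<^bsub>G\<^esub> = \<one>\<^bsub>H\<^esub>"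
  shows "comm_group H"
proof -
  interpret G: comm_group G by fact
  have lift: "\<exists>x\<in>carrier G. h = \<pi> x" if "h \<in> carrier H" for h using that surj by blast
  have cl: "\<pi> x \<in> carrier H" if "x \<in> carrier G" for x using that surj by blast
  show ?thesis
  proof (rule comm_groupI)
    fix x y assume "x \<in> carrier H" "y \<in> carrier H"
    then obtain a b where ab: "a \<in> carrier G" "b \<in> carrier G" "x = \<pi> a" "y = \<pi> b" using lift by metis
    then show "x \<otimes>\<^bsub>H\<^esub> y \<in> carrier H" by (simp add: mult[symmetric] cl)
    show "x \<otimes>\<^bsub>H\<^esub> y = y \<otimes>\<^bsub>H\<^esub> x" using ab by (simp add: mult[symmetric] G.m_comm)
    fix z assume "z \<in> carrier H"
    then obtain c where "c \<in> carrier G" "z = \<pi> c" using lift by metis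
    then show "x \<otimes>\<^bsub>H\<^esub> y \<otimes>\<^bsub>H\<^esub> z = x \<otimes>\<^bsub>H\<^esub> (y \<otimes>\<^bsub>H\<^esub> z)" using ab by (simp add: mult[symmetric] G.m_assoc)
  next
    show "\<one>\<^bsub>H\<^esub> \<in> carrier H" using cl[of "\<one>\<^bsub>G\<^esub>"] one by simp
    fix x assume "x \<in> carrier H"
    then obtain a where a: "a \<in> carrier G" "x = \<pi> a" using lift by metis
    then show "\<one>\<^bsub>H\<^esub> \<otimes>\<^bsub>H\<^esub> x = x" by (simp add: mult[symmetric] one[symmetric])
    have "\<pi> (inv\<^bsub>G\<^esub> a) \<otimes>\<^bsub>H\<^esub> x = \<one>\<^bsub>H\<^esub>" using a by (simp add: mult[symmetric] one)
    then show "\<exists>y\<in>carrier H. y \<otimes>\<^bsub>H\<^esub> x = \<one>\<^bsub>H\<^esub>" using a cl by blast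
  qed
qed

text \<open>
  A structure onto which a module maps surjectively and compatibly inherits the axioms. It spares
  checking them for the encoded copies and the cokernels below.
\<close>

lemma gmodule_surj_image:
  assumes R: "graded_ring R" and E: "gmodule R E"
    and surj: "\<And>n. \<pi> n ` carrier (mgrp E n) = carrier (mgrp C n)"
    and mult: "\<And>n x y. x \<in> carrier (mgrp E n) \<Longrightarrow> y \<in> carrier (mgrp E n) \<Longrightarrow>
      \<pi> n (x \<otimes>\<^bsub>mgrp E n\<^esub> y) = \<pi> n x \<otimes>\<^bsub>mgrp C n\<^esub> \<pi> n y"
    and one: "\<And>n. \<pi> n \<one>\<^bsub>mgrp E n\<^esub> = \<one>\<^bsub>mgrp C n\<^esub>"
    and act: "\<And>p n r x. r \<in> carrier (rgrp R p) \<Longrightarrow> x \<in> carrier (mgrp E n) \<Longrightarrow>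
      \<pi> (p + n) (act E p n r x) = act C p n r (\<pi> n x)"
  shows "gmodule R C" and "\<pi> \<in> mhom R E C"
proof -
  interpret E: graded_left_module R E using R E by unfold_locales
  have lift: "\<exists>x\<in>carrier (mgrp E n). h = \<pi> n x" if "h \<in> carrier (mgrp C n)" for h n
    using that surj[of n] by blast
  have cl: "\<pi> n x \<in> carrier (mgrp C n)" if "x \<in> carrier (mgrp E n)" for x n using that surj by blast
  show "\<pi> \<in> mhom R E C" using cl mult act by (auto simp: mhom_def ghom_def intro: homI)
  show "gmodule R C"
  proof (rule gmoduleI)
    show "comm_group (mgrp C n)" for n
      by (rule comm_group_surj_image[OF E.mg.comm_group_axioms surj mult one])
    fix p q r x assume r: "r \<in> carrier (rgrp R p)" and "x \<in> carrier (mgrp C q)"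
    then obtain a where a: "a \<in> carrier (mgrp E q)" "x = \<pi> q a" using lift by metis
    then show "act C p q r x \<in> carrier (mgrp C (p + q))" using r by (simp add: act[symmetric] cl)
    {
      fix y assume "y \<in> carrier (mgrp C q)"
      then obtain b where b: "b \<in> carrier (mgrp E q)" "y = \<pi> q b" using lift by metis
      show "act C p q r (x \<otimes>\<^bsub>mgrp C q\<^esub> y) = act C p q r x \<otimes>\<^bsub>mgrp C (p + q)\<^esub> act C p q r y"
        using a b r by (simp add: act[symmetric] mult[symmetric] E.act_distrib)
    }
    {
      fix s assume "s \<in> carrier (rgrp R p)"
      then show "act C p q (r \<otimes>\<^bsub>rgrp R p\<^esub> s) x = act C p q r x \<otimes>\<^bsub>mgrp C (p + q)\<^esub> act C p q s x"
        using a r by (simp add: act[symmetric] mult[symmetric] E.act_add)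
    }
  next
    fix p q n r s x assume r: "r \<in> carrier (rgrp R p)" "s \<in> carrier (rgrp R q)" and "x \<in> carrier (mgrp C n)"
    then obtain a where a: "a \<in> carrier (mgrp E n)" "x = \<pi> n a" using lift by metis
    then show "act C (p + q) n (rmul R p q r s) x = act C p (q + n) r (act C q n s x)"
      using r act[of "rmul R p q r s" "p + q" a n] by (simp add: act[symmetric] E.act_assoc add.assoc)
  next
    fix n x assume "x \<in> carrier (mgrp C n)"
    then obtain a where a: "a \<in> carrier (mgrp E n)" "x = \<pi> n a" using lift by metis
    then show "act C 0 n (rone R) x = x" using act[of "rone R" 0 a n] by simp
  qed
qed

lemma mhomD:
  assumes "f \<in> mhom R M N"
  shows "f n \<in> hom (mgrp M n) (mgrp N n)"
    "x \<in> carrier (mgrp M n) \<Longrightarrow> f n x \<in> carrier (mgrp N n)"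
    "x \<in> carrier (mgrp M n) \<Longrightarrow> y \<in> carrier (mgrp M n) \<Longrightarrow>
      f n (x \<otimes>\<^bsub>mgrp M n\<^esub> y) = f n x \<otimes>\<^bsub>mgrp N n\<^esub> f n y"
    "r \<in> carrier (rgrp R p) \<Longrightarrow> x \<in> carrier (mgrp M n) \<Longrightarrow> f (p + n) (act M p n r x) = act N p n r (f n x)"
  using assms by (auto simp: mhom_def ghom_def hom_def)

lemma mhomI:
  assumes "\<And>n x. x \<in> carrier (mgrp M n) \<Longrightarrow> f n x \<in> carrier (mgrp N n)"
    "\<And>n x y. x \<in> carrier (mgrp M n) \<Longrightarrow> y \<in> carrier (mgrp M n) \<Longrightarrow>
      f n (x \<otimes>\<^bsub>mgrp M n\<^esub> y) = f n x \<otimes>\<^bsub>mgrp N n\<^esub> f n y"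
    "\<And>p n r x. r \<in> carrier (rgrp R p) \<Longrightarrow> x \<in> carrier (mgrp M n) \<Longrightarrow> f (p + n) (act M p n r x) = act N p n r (f n x)"
  shows "f \<in> mhom R M N"
  using assms by (auto simp: mhom_def ghom_def intro: homI)

lemma mhom_comp:
  assumes f: "f \<in> mhom R M N" and g: "g \<in> mhom R N P"
  shows "(\<lambda>n x. g n (f n x)) \<in> mhom R M P"
  using mhomD[OF f] mhomD[OF g] by (intro mhomI) auto

lemma mhom_group_hom:
  assumes "gmodule R M" "gmodule R N" "f \<in> mhom R M N"
  shows "group_hom (mgrp M n) (mgrp N n) (f n)"
  using assms mhomD(1)[OF assms(3)]
  by (simp add: group_hom_def group_hom_axioms_def gmodule_def ggroup_def comm_group_def)

lemma mhom_one:
  assumes "gmodule R M" "gmodule R N" "f \<in> mhom R M N"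
  shows "f n \<one>\<^bsub>mgrp M n\<^esub> = \<one>\<^bsub>mgrp N n\<^esub>"
  using group_hom.hom_one[OF mhom_group_hom[OF assms]] .

text \<open>
  Modules constructed in another type are brought into the type of elements of the category by copying
  them along an injection.
\<close>

definition encode :: "('x \<Rightarrow> 'y) \<Rightarrow> ('r, 'x) gmod \<Rightarrow> ('r, 'y) gmod" where
  "encode \<phi> M = \<lparr>mgrp = (\<lambda>n. \<lparr>carrier = \<phi> ` carrier (mgrp M n),
      monoid.mult = (\<lambda>x y. \<phi> (inv_into UNIV \<phi> x \<otimes>\<^bsub>mgrp M n\<^esub> inv_into UNIV \<phi> y)),
      one = \<phi> \<one>\<^bsub>mgrp M n\<^esub>\<rparr>),
    act = (\<lambda>p n r x. \<phi> (act M p n r (inv_into UNIV \<phi> x)))\<rparr>"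

lemma encode:
  assumes R: "graded_ring R" and M: "gmodule R M" and \<phi>: "inj \<phi>"
  shows "gmodule R (encode \<phi> M)"
    and "(\<lambda>n. \<phi>) \<in> mhom R M (encode \<phi> M)"
    and "(\<lambda>n. inv_into UNIV \<phi>) \<in> mhom R (encode \<phi> M) M"
proof -
  interpret M: graded_left_module R M using R M by unfold_locales
  show "gmodule R (encode \<phi> M)" and "(\<lambda>n. \<phi>) \<in> mhom R M (encode \<phi> M)"
    by (rule gmodule_surj_image[where \<pi> = "\<lambda>n. \<phi>", OF R M]; simp add: encode_def inv_f_f[OF \<phi>])+
  show "(\<lambda>n. inv_into UNIV \<phi>) \<in> mhom R (encode \<phi> M) M"
    by (rule mhomI) (auto simp: encode_def inv_f_f[OF \<phi>])
qed

lemma (in comm_group) coset_eq_iff: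
  assumes "subgroup P G" "x \<in> carrier G" "y \<in> carrier G"
  shows "P #> x = P #> y \<longleftrightarrow> x \<otimes> inv y \<in> P"
  using assms by (metis is_group rcos_self repr_independence subgroup.rcos_module)

text \<open>
  Cokernels have to stay in the type of elements of the given module, so that a resolution can be
  built in one type. Each coset is therefore replaced by a chosen representative.
\<close>

definition coset_rep :: "('r, 'x) gmod \<Rightarrow> (int \<Rightarrow> 'x set) \<Rightarrow> int \<Rightarrow> 'x \<Rightarrow> 'x" where
  "coset_rep E P n x = (SOME y. y \<in> P n #>\<^bsub>mgrp E n\<^esub> x)"

definition cokernel_mod :: "('r, 'x) gmod \<Rightarrow> (int \<Rightarrow> 'x set) \<Rightarrow> ('r, 'x) gmod" where
  "cokernel_mod E P = \<lparr>mgrp = (\<lambda>n. \<lparr>carrier = coset_rep E P n ` carrier (mgrp E n),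
      monoid.mult = (\<lambda>x y. coset_rep E P n (x \<otimes>\<^bsub>mgrp E n\<^esub> y)),
      one = coset_rep E P n \<one>\<^bsub>mgrp E n\<^esub>\<rparr>),
    act = (\<lambda>p n r x. coset_rep E P (p + n) (act E p n r x))\<rparr>"

lemma gsubmoduleD:
  assumes "gsubmodule R M N"
  shows "subgroup (N n) (mgrp M n)" "x \<in> N n \<Longrightarrow> x \<in> carrier (mgrp M n)" "\<one>\<^bsub>mgrp M n\<^esub> \<in> N n"
    "x \<in> N n \<Longrightarrow> inv\<^bsub>mgrp M n\<^esub> x \<in> N n" "x \<in> N n \<Longrightarrow> y \<in> N n \<Longrightarrow> x \<otimes>\<^bsub>mgrp M n\<^esub> y \<in> N n"
    "r \<in> carrier (rgrp R p) \<Longrightarrow> x \<in> N n \<Longrightarrow> act M p n r x \<in> N (p + n)"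
proof -
  show s: "subgroup (N n) (mgrp M n)" using assms by (simp add: gsubmodule_def)
  show "x \<in> N n \<Longrightarrow> x \<in> carrier (mgrp M n)" using subgroup.subset[OF s] by blast
  show "r \<in> carrier (rgrp R p) \<Longrightarrow> x \<in> N n \<Longrightarrow> act M p n r x \<in> N (p + n)"
    using assms by (simp add: gsubmodule_def)
qed (use subgroup.one_closed[of "N n" "mgrp M n"] subgroup.m_inv_closed[of "N n" "mgrp M n"]
      subgroup.m_closed[of "N n" "mgrp M n"] assms in \<open>auto simp: gsubmodule_def\<close>)

context graded_left_module
begin

context
  fixes P assumes P: "gsubmodule R M P"
begin

lemma coset_cong_mult:
  assumes "x \<in> carrier (mgrp M n)" "y \<in> carrier (mgrp M n)" "x' \<in> carrier (mgrp M n)" "y' \<in> carrier (mgrp M n)"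
    and "P n #>\<^bsub>mgrp M n\<^esub> x = P n #>\<^bsub>mgrp M n\<^esub> x'" "P n #>\<^bsub>mgrp M n\<^esub> y = P n #>\<^bsub>mgrp M n\<^esub> y'"
  shows "P n #>\<^bsub>mgrp M n\<^esub> (x \<otimes>\<^bsub>mgrp M n\<^esub> y) = P n #>\<^bsub>mgrp M n\<^esub> (x' \<otimes>\<^bsub>mgrp M n\<^esub> y')"
proof -
  have "(x \<otimes>\<^bsub>mgrp M n\<^esub> inv\<^bsub>mgrp M n\<^esub> x') \<otimes>\<^bsub>mgrp M n\<^esub> (y \<otimes>\<^bsub>mgrp M n\<^esub> inv\<^bsub>mgrp M n\<^esub> y') \<in> P n"
    using assms gsubmoduleD[OF P] by (simp add: mg.coset_eq_iff)
  then show ?thesis using assms gsubmoduleD(1)[OF P]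
    by (simp add: mg.coset_eq_iff mg.inv_mult mg.m_ac)
qed

lemma coset_cong_act:
  assumes "x \<in> carrier (mgrp M n)" "x' \<in> carrier (mgrp M n)" "r \<in> carrier (rgrp R p)"
    and "P n #>\<^bsub>mgrp M n\<^esub> x = P n #>\<^bsub>mgrp M n\<^esub> x'"
  shows "P (p + n) #>\<^bsub>mgrp M (p + n)\<^esub> act M p n r x = P (p + n) #>\<^bsub>mgrp M (p + n)\<^esub> act M p n r x'"
proof -
  have "act M p n r (x \<otimes>\<^bsub>mgrp M n\<^esub> inv\<^bsub>mgrp M n\<^esub> x') \<in> P (p + n)"
    using assms gsubmoduleD[OF P] by (simp add: mg.coset_eq_iff)
  then show ?thesis using assms gsubmoduleD(1)[OF P]
    by (simp add: mg.coset_eq_iff act_distrib act_inv)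
qed

lemma coset_rep:
  assumes x: "x \<in> carrier (mgrp M n)"
  shows "coset_rep M P n x \<in> carrier (mgrp M n)"
    "P n #>\<^bsub>mgrp M n\<^esub> coset_rep M P n x = P n #>\<^bsub>mgrp M n\<^esub> x"
proof -
  have s: "subgroup (P n) (mgrp M n)" using gsubmoduleD(1)[OF P] .
  have "coset_rep M P n x \<in> P n #>\<^bsub>mgrp M n\<^esub> x"
    unfolding coset_rep_def using mg.rcos_self[OF x s] by (rule someI)
  then show "coset_rep M P n x \<in> carrier (mgrp M n)"
    "P n #>\<^bsub>mgrp M n\<^esub> coset_rep M P n x = P n #>\<^bsub>mgrp M n\<^esub> x"
    using mg.r_coset_subset_G[OF subgroup.subset[OF s] x] mg.repr_independence[OF _ x s] by auto
qed

lemma coset_rep_eq_iff: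
  assumes "x \<in> carrier (mgrp M n)" "y \<in> carrier (mgrp M n)"
  shows "coset_rep M P n x = coset_rep M P n y \<longleftrightarrow> P n #>\<^bsub>mgrp M n\<^esub> x = P n #>\<^bsub>mgrp M n\<^esub> y"
  using coset_rep(2)[OF assms(1)] coset_rep(2)[OF assms(2)] by (metis coset_rep_def)

lemma cokernel_mod:
  shows gmodule_cokernel: "gmodule R (cokernel_mod M P)"
    and coset_rep_mhom: "coset_rep M P \<in> mhom R M (cokernel_mod M P)"
    and coset_rep_kernel: "x \<in> carrier (mgrp M n) \<Longrightarrow>
      coset_rep M P n x = \<one>\<^bsub>mgrp (cokernel_mod M P) n\<^esub> \<longleftrightarrow> x \<in> P n"
proof -
  have 1: "coset_rep M P n (x \<otimes>\<^bsub>mgrp M n\<^esub> y) =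
      coset_rep M P n (coset_rep M P n x \<otimes>\<^bsub>mgrp M n\<^esub> coset_rep M P n y)"
    if "x \<in> carrier (mgrp M n)" "y \<in> carrier (mgrp M n)" for x y n
    using that coset_rep coset_cong_mult[of x n y "coset_rep M P n x" "coset_rep M P n y"]
    by (subst coset_rep_eq_iff) simp_all
  have 2: "coset_rep M P (p + n) (act M p n r x) = coset_rep M P (p + n) (act M p n r (coset_rep M P n x))"
    if "x \<in> carrier (mgrp M n)" "r \<in> carrier (rgrp R p)" for x r p n
    using that coset_rep coset_cong_act[of x n "coset_rep M P n x" r p]
    by (subst coset_rep_eq_iff) simp_all
  show "gmodule R (cokernel_mod M P)" and "coset_rep M P \<in> mhom R M (cokernel_mod M P)"
    by (rule gmodule_surj_image[where \<pi> = "coset_rep M P", OF graded_ring gmodule]; simp add: cokernel_mod_def 1[symmetric] 2[symmetric])+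
  show "coset_rep M P n x = \<one>\<^bsub>mgrp (cokernel_mod M P) n\<^esub> \<longleftrightarrow> x \<in> P n" if "x \<in> carrier (mgrp M n)"
    using that gsubmoduleD(1)[OF P] by (simp add: cokernel_mod_def coset_rep_eq_iff mg.coset_eq_iff)
qed

end
end

section \<open>Coinduced modules are injective\<close>

text \<open>
  The map \<open>\<eta>\<close> turns each component of an \<open>R\<close>-module into a vector space over \<open>K\<close>.
\<close>

locale graded_ring_over_field = field K + graded_ring_over R
  for K :: "'k ring" and R :: "'r gring" +
  fixes \<eta> :: "'k \<Rightarrow> 'r"
  assumes \<eta>_closed [simp]: "c \<in> carrier K \<Longrightarrow> \<eta> c \<in> carrier (rgrp R 0)"
    and \<eta>_add: "c \<in> carrier K \<Longrightarrow> d \<in> carrier K \<Longrightarrow> \<eta> (c \<oplus>\<^bsub>K\<^esub> d) = \<eta> c \<otimes>\<^bsub>rgrp R 0\<^esub> \<eta> d"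
    and \<eta>_mult: "c \<in> carrier K \<Longrightarrow> d \<in> carrier K \<Longrightarrow> \<eta> (c \<otimes>\<^bsub>K\<^esub> d) = rmul R 0 0 (\<eta> c) (\<eta> d)"
    and \<eta>_one: "\<eta> \<one>\<^bsub>K\<^esub> = rone R"
begin

lemma scalar_action_module:
  assumes "gmodule R M"
  shows "scalar_action K (mgrp M n) (\<lambda>c x. act M 0 n (\<eta> c) x)"
proof -
  interpret M: graded_left_module R M using assms by unfold_locales
  show ?thesis
  proof
    show "act M 0 n (\<eta> c) \<in> hom (mgrp M n) (mgrp M n)" if "c \<in> carrier K" for c
      using M.act_hom[of "\<eta> c" 0 n] that by simp
    show "act M 0 n (\<eta> (c \<oplus>\<^bsub>K\<^esub> d)) x = act M 0 n (\<eta> c) x \<otimes>\<^bsub>mgrp M n\<^esub> act M 0 n (\<eta> d) x"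
      if "c \<in> carrier K" "d \<in> carrier K" "x \<in> carrier (mgrp M n)" for c d x
      using M.act_add[of "\<eta> c" 0 "\<eta> d" x n] that by (simp add: \<eta>_add)
    show "act M 0 n (\<eta> (c \<otimes>\<^bsub>K\<^esub> d)) x = act M 0 n (\<eta> c) (act M 0 n (\<eta> d) x)"
      if "c \<in> carrier K" "d \<in> carrier K" "x \<in> carrier (mgrp M n)" for c d x
      using M.act_assoc[of "\<eta> c" 0 "\<eta> d" 0 x n] that by (simp add: \<eta>_mult)
    show "act M 0 n (\<eta> \<one>\<^bsub>K\<^esub>) x = x" if "x \<in> carrier (mgrp M n)" for x
      using that by (simp add: \<eta>_one)
  qed
qed

text \<open>
  The graded module of \<open>K\<close>-linear maps from \<open>R\<close> to \<open>M\<close>: an element of degree \<open>n\<close> is a family of maps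
  \<open>R\<^sup>p \<rightarrow> M\<^sup>p\<^sup>+\<^sup>n\<close>, taken extensional so that equal maps are equal in HOL, and \<open>s \<in> R\<close> acts by right
  multiplication on the argument.
\<close>

definition coinduced :: "('r, 'x) gmod \<Rightarrow> ('r, int \<Rightarrow> 'r \<Rightarrow> 'x) gmod" where
  "coinduced M = \<lparr>mgrp = (\<lambda>n. \<lparr>
      carrier = {h. \<forall>p. h p \<in> extensional (carrier (rgrp R p)) \<and>
        h p \<in> hom (rgrp R p) (mgrp M (p + n)) \<and>
        (\<forall>c\<in>carrier K. \<forall>r\<in>carrier (rgrp R p).
          h p (rmul R 0 p (\<eta> c) r) = act M 0 (p + n) (\<eta> c) (h p r))},
      monoid.mult = (\<lambda>h g p. \<lambda>r\<in>carrier (rgrp R p). h p r \<otimes>\<^bsub>mgrp M (p + n)\<^esub> g p r),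
      one = (\<lambda>p. \<lambda>r\<in>carrier (rgrp R p). \<one>\<^bsub>mgrp M (p + n)\<^esub>)\<rparr>),
    act = (\<lambda>q n s h p. \<lambda>r\<in>carrier (rgrp R p). h (p + q) (rmul R p q r s))\<rparr>"

context
  fixes M :: "('r, 'x) gmod"
  assumes M: "gmodule R M"
begin

interpretation M: graded_left_module R M using M by unfold_locales

lemma coinduced_eqI:
  assumes "h \<in> carrier (mgrp (coinduced M) n)" "g \<in> carrier (mgrp (coinduced M) n)"
    and "\<And>p r. r \<in> carrier (rgrp R p) \<Longrightarrow> h p r = g p r"
  shows "h = g"
proof
  fix p show "h p = g p"
    by (rule extensionalityI[of _ "carrier (rgrp R p)"]) (use assms in \<open>auto simp: coinduced_def\<close>)
qed

lemma coinducedD: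
  assumes "h \<in> carrier (mgrp (coinduced M) n)"
  shows "r \<in> carrier (rgrp R p) \<Longrightarrow> h p r \<in> carrier (mgrp M (p + n))"
    "r \<in> carrier (rgrp R p) \<Longrightarrow> s \<in> carrier (rgrp R p) \<Longrightarrow>
      h p (r \<otimes>\<^bsub>rgrp R p\<^esub> s) = h p r \<otimes>\<^bsub>mgrp M (p + n)\<^esub> h p s"
    "c \<in> carrier K \<Longrightarrow> r \<in> carrier (rgrp R p) \<Longrightarrow>
      h p (rmul R 0 p (\<eta> c) r) = act M 0 (p + n) (\<eta> c) (h p r)"
  using assms by (auto simp: coinduced_def hom_def)

lemma coinducedI:
  assumes "\<And>p. h p \<in> extensional (carrier (rgrp R p))"
    and "\<And>p r. r \<in> carrier (rgrp R p) \<Longrightarrow> h p r \<in> carrier (mgrp M (p + n))"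
    "\<And>p r s. r \<in> carrier (rgrp R p) \<Longrightarrow> s \<in> carrier (rgrp R p) \<Longrightarrow>
      h p (r \<otimes>\<^bsub>rgrp R p\<^esub> s) = h p r \<otimes>\<^bsub>mgrp M (p + n)\<^esub> h p s"
    "\<And>c p r. c \<in> carrier K \<Longrightarrow> r \<in> carrier (rgrp R p) \<Longrightarrow>
      h p (rmul R 0 p (\<eta> c) r) = act M 0 (p + n) (\<eta> c) (h p r)"
  shows "h \<in> carrier (mgrp (coinduced M) n)"
  using assms by (auto simp: coinduced_def intro: homI)

lemma coinduced_simps:
  "r \<in> carrier (rgrp R p) \<Longrightarrow> (h \<otimes>\<^bsub>mgrp (coinduced M) n\<^esub> g) p r = h p r \<otimes>\<^bsub>mgrp M (p + n)\<^esub> g p r"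
  "r \<in> carrier (rgrp R p) \<Longrightarrow> \<one>\<^bsub>mgrp (coinduced M) n\<^esub> p r = \<one>\<^bsub>mgrp M (p + n)\<^esub>"
  "r \<in> carrier (rgrp R p) \<Longrightarrow> act (coinduced M) q n s h p r = h (p + q) (rmul R p q r s)"
  by (auto simp: coinduced_def)

lemma coinduced_mult_closed:
  assumes "h \<in> carrier (mgrp (coinduced M) n)" "g \<in> carrier (mgrp (coinduced M) n)"
  shows "h \<otimes>\<^bsub>mgrp (coinduced M) n\<^esub> g \<in> carrier (mgrp (coinduced M) n)"
proof (rule coinducedI)
  fix p show "(h \<otimes>\<^bsub>mgrp (coinduced M) n\<^esub> g) p \<in> extensional (carrier (rgrp R p))"
    by (simp add: coinduced_def)
next
  fix c p r assume "c \<in> carrier K" "r \<in> carrier (rgrp R p)"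
  then show "(h \<otimes>\<^bsub>mgrp (coinduced M) n\<^esub> g) p (rmul R 0 p (\<eta> c) r) =
      act M 0 (p + n) (\<eta> c) ((h \<otimes>\<^bsub>mgrp (coinduced M) n\<^esub> g) p r)"
    using rmul_closed[of "\<eta> c" 0 r p] M.act_distrib[of "\<eta> c" 0 "h p r" "p + n" "g p r"] assms
    by (simp add: coinduced_simps coinducedD)
qed (auto simp: coinduced_simps coinducedD[OF assms(1)] coinducedD[OF assms(2)] M.mg.m_ac)

lemma coinduced_one_closed: "\<one>\<^bsub>mgrp (coinduced M) n\<^esub> \<in> carrier (mgrp (coinduced M) n)"
proof (rule coinducedI)
  fix p show "\<one>\<^bsub>mgrp (coinduced M) n\<^esub> p \<in> extensional (carrier (rgrp R p))"
    by (simp add: coinduced_def)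
next
  fix c p r assume "c \<in> carrier K" "r \<in> carrier (rgrp R p)"
  then show "\<one>\<^bsub>mgrp (coinduced M) n\<^esub> p (rmul R 0 p (\<eta> c) r) =
      act M 0 (p + n) (\<eta> c) (\<one>\<^bsub>mgrp (coinduced M) n\<^esub> p r)"
    using rmul_closed[of "\<eta> c" 0 r p] M.act_one[of "\<eta> c" 0 "p + n"] by (simp add: coinduced_simps)
qed (auto simp: coinduced_simps)

lemma coinduced_act_closed:
  assumes h: "h \<in> carrier (mgrp (coinduced M) n)" and s: "s \<in> carrier (rgrp R q)"
  shows "act (coinduced M) q n s h \<in> carrier (mgrp (coinduced M) (q + n))"
proof (rule coinducedI)
  fix p show "act (coinduced M) q n s h p \<in> extensional (carrier (rgrp R p))"
    by (simp add: coinduced_def)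
  fix r assume r: "r \<in> carrier (rgrp R p)"
  show "act (coinduced M) q n s h p r \<in> carrier (mgrp M (p + (q + n)))"
    using r s coinducedD(1)[OF h, of "rmul R p q r s" "p + q"] by (simp add: coinduced_simps add.assoc)
  show "act (coinduced M) q n s h p (r \<otimes>\<^bsub>rgrp R p\<^esub> t) =
      act (coinduced M) q n s h p r \<otimes>\<^bsub>mgrp M (p + (q + n))\<^esub> act (coinduced M) q n s h p t"
    if "t \<in> carrier (rgrp R p)" for t
    using r s that coinducedD(2)[OF h, of "rmul R p q r s" "p + q" "rmul R p q t s"]
    by (simp add: coinduced_simps add.assoc rmul_add)
next
  fix c p r assume c: "c \<in> carrier K" and r: "r \<in> carrier (rgrp R p)"
  show "act (coinduced M) q n s h p (rmul R 0 p (\<eta> c) r) =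
      act M 0 (p + (q + n)) (\<eta> c) (act (coinduced M) q n s h p r)"
    using r s c coinducedD(3)[OF h c, of "rmul R p q r s" "p + q"] rmul_closed[of "\<eta> c" 0 r p]
      rmul_assoc[of "\<eta> c" 0 r p s q]
    by (simp add: coinduced_simps add.assoc)
qed

lemma gmodule_coinduced: "gmodule R (coinduced M)"
proof (rule gmoduleI)
  fix n show "comm_group (mgrp (coinduced M) n)"
  proof (rule comm_groupI)
    fix h g k assume h: "h \<in> carrier (mgrp (coinduced M) n)"
    {
      assume g: "g \<in> carrier (mgrp (coinduced M) n)"
      show "h \<otimes>\<^bsub>mgrp (coinduced M) n\<^esub> g \<in> carrier (mgrp (coinduced M) n)"
        by (rule coinduced_mult_closed[OF h g])
      show "h \<otimes>\<^bsub>mgrp (coinduced M) n\<^esub> g = g \<otimes>\<^bsub>mgrp (coinduced M) n\<^esub> h"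
        by (rule coinduced_eqI[of _ n])
          (simp_all add: h g coinduced_mult_closed coinduced_simps coinducedD(1)[OF h] coinducedD(1)[OF g] M.mg.m_comm)
      assume k: "k \<in> carrier (mgrp (coinduced M) n)"
      show "h \<otimes>\<^bsub>mgrp (coinduced M) n\<^esub> g \<otimes>\<^bsub>mgrp (coinduced M) n\<^esub> k =
          h \<otimes>\<^bsub>mgrp (coinduced M) n\<^esub> (g \<otimes>\<^bsub>mgrp (coinduced M) n\<^esub> k)"
        by (rule coinduced_eqI[of _ n])
          (simp_all add: h g k coinduced_mult_closed coinduced_simps coinducedD(1)[OF h]
            coinducedD(1)[OF g] coinducedD(1)[OF k] M.mg.m_assoc)
    }
    show "\<one>\<^bsub>mgrp (coinduced M) n\<^esub> \<otimes>\<^bsub>mgrp (coinduced M) n\<^esub> h = h"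
      by (rule coinduced_eqI[of _ n])
        (simp_all add: h coinduced_mult_closed coinduced_one_closed coinduced_simps coinducedD(1)[OF h])
    define g where "g = (\<lambda>p. \<lambda>r\<in>carrier (rgrp R p). h p (inv\<^bsub>rgrp R p\<^esub> r))"
    have "g \<in> carrier (mgrp (coinduced M) n)"
    proof (rule coinducedI)
      fix c p r assume c: "c \<in> carrier K" and r: "r \<in> carrier (rgrp R p)"
      interpret reg: graded_left_module R "reg R" using regular_module by unfold_locales
      have "inv\<^bsub>rgrp R p\<^esub> rmul R 0 p (\<eta> c) r = rmul R 0 p (\<eta> c) (inv\<^bsub>rgrp R p\<^esub> r)"
        using reg.act_inv[of "\<eta> c" 0 r p] c r by (simp add: reg_def)
      then show "g p (rmul R 0 p (\<eta> c) r) = act M 0 (p + n) (\<eta> c) (g p r)"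
        using rmul_closed[of "\<eta> c" 0 r p] c r by (simp add: g_def coinducedD[OF h])
    qed (auto simp: g_def coinducedD[OF h] rg.inv_mult)
    moreover have "g \<otimes>\<^bsub>mgrp (coinduced M) n\<^esub> h = \<one>\<^bsub>mgrp (coinduced M) n\<^esub>"
    proof (rule coinduced_eqI[of _ n])
      fix p r assume r: "r \<in> carrier (rgrp R p)"
      have "h p (inv\<^bsub>rgrp R p\<^esub> r) \<otimes>\<^bsub>mgrp M (p + n)\<^esub> h p r = h p \<one>\<^bsub>rgrp R p\<^esub>"
        using coinducedD(2)[OF h, of "inv\<^bsub>rgrp R p\<^esub> r" p r] r by simp
      also have "\<dots> = \<one>\<^bsub>mgrp M (p + n)\<^esub>"
        using coinducedD(2)[OF h, of "\<one>\<^bsub>rgrp R p\<^esub>" p "\<one>\<^bsub>rgrp R p\<^esub>"] coinducedD(1)[OF h, of "\<one>\<^bsub>rgrp R p\<^esub>" p]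
        by (simp add: M.mg.l_cancel_one')
      finally show "(g \<otimes>\<^bsub>mgrp (coinduced M) n\<^esub> h) p r = \<one>\<^bsub>mgrp (coinduced M) n\<^esub> p r"
        using r by (simp add: coinduced_simps g_def)
    qed (simp_all add: \<open>g \<in> _\<close> h coinduced_mult_closed coinduced_one_closed)
    ultimately show "\<exists>g\<in>carrier (mgrp (coinduced M) n). g \<otimes>\<^bsub>mgrp (coinduced M) n\<^esub> h = \<one>\<^bsub>mgrp (coinduced M) n\<^esub>"
      by blast
  qed (rule coinduced_one_closed)
next
  fix p q r x assume r: "r \<in> carrier (rgrp R p)" and x: "x \<in> carrier (mgrp (coinduced M) q)"
  show "act (coinduced M) p q r x \<in> carrier (mgrp (coinduced M) (p + q))"
    by (rule coinduced_act_closed[OF x r])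
  {
    fix y assume y: "y \<in> carrier (mgrp (coinduced M) q)"
    show "act (coinduced M) p q r (x \<otimes>\<^bsub>mgrp (coinduced M) q\<^esub> y) =
        act (coinduced M) p q r x \<otimes>\<^bsub>mgrp (coinduced M) (p + q)\<^esub> act (coinduced M) p q r y"
    proof (rule coinduced_eqI[of _ "p + q"])
      fix k s assume "s \<in> carrier (rgrp R k)"
      then show "act (coinduced M) p q r (x \<otimes>\<^bsub>mgrp (coinduced M) q\<^esub> y) k s =
          (act (coinduced M) p q r x \<otimes>\<^bsub>mgrp (coinduced M) (p + q)\<^esub> act (coinduced M) p q r y) k s"
        using r rmul_closed[of s k r p] by (simp add: coinduced_simps add.assoc)
    qed (simp_all add: r x y coinduced_act_closed coinduced_mult_closed)
  }
  fix s assume s: "s \<in> carrier (rgrp R p)"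
  show "act (coinduced M) p q (r \<otimes>\<^bsub>rgrp R p\<^esub> s) x =
      act (coinduced M) p q r x \<otimes>\<^bsub>mgrp (coinduced M) (p + q)\<^esub> act (coinduced M) p q s x"
  proof (rule coinduced_eqI[of _ "p + q"])
    fix k t assume "t \<in> carrier (rgrp R k)"
    then show "act (coinduced M) p q (r \<otimes>\<^bsub>rgrp R p\<^esub> s) x k t =
        (act (coinduced M) p q r x \<otimes>\<^bsub>mgrp (coinduced M) (p + q)\<^esub> act (coinduced M) p q s x) k t"
      using r s coinducedD(2)[OF x, of "rmul R k p t r" "k + p" "rmul R k p t s"]
      by (simp add: coinduced_simps add.assoc rmul_distrib)
  qed (simp_all add: r s x coinduced_act_closed coinduced_mult_closed)
next
  fix p q n r s x
  assume r: "r \<in> carrier (rgrp R p)" and s: "s \<in> carrier (rgrp R q)" and x: "x \<in> carrier (mgrp (coinduced M) n)"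
  show "act (coinduced M) (p + q) n (rmul R p q r s) x = act (coinduced M) p (q + n) r (act (coinduced M) q n s x)"
  proof (rule coinduced_eqI[of _ "p + q + n"])
    show "act (coinduced M) p (q + n) r (act (coinduced M) q n s x) \<in> carrier (mgrp (coinduced M) (p + q + n))"
      using coinduced_act_closed[OF coinduced_act_closed[OF x s] r] by (simp add: add.assoc)
    fix k t assume "t \<in> carrier (rgrp R k)"
    then show "act (coinduced M) (p + q) n (rmul R p q r s) x k t =
        act (coinduced M) p (q + n) r (act (coinduced M) q n s x) k t"
      using r s rmul_closed[of t k r p] by (simp add: coinduced_simps rmul_assoc add.assoc)
  qed (simp_all add: r s x coinduced_act_closed)
next
  fix n x assume x: "x \<in> carrier (mgrp (coinduced M) n)"
  show "act (coinduced M) 0 n (rone R) x = x"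
    by (rule coinduced_eqI[of _ n])
      (use coinduced_act_closed[OF x rone_closed] x in \<open>simp_all add: coinduced_simps\<close>)
qed

definition coinduced_unit :: "int \<Rightarrow> 'x \<Rightarrow> int \<Rightarrow> 'r \<Rightarrow> 'x" where
  "coinduced_unit n x = (\<lambda>p. \<lambda>r\<in>carrier (rgrp R p). act M p n r x)"

text \<open>
  Injectivity holds because the value of \<open>r \<mapsto> r x\<close> at \<open>1\<close> recovers \<open>x\<close>.
\<close>

lemma coinduced_unit:
  shows coinduced_unit_mhom: "coinduced_unit \<in> mhom R M (coinduced M)"
    and coinduced_unit_inj: "inj_on (coinduced_unit n) (carrier (mgrp M n))"
proof -
  have cl: "coinduced_unit n x \<in> carrier (mgrp (coinduced M) n)" if x: "x \<in> carrier (mgrp M n)" for n x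
  proof (rule coinducedI)
    fix c p r assume c: "c \<in> carrier K" and r: "r \<in> carrier (rgrp R p)"
    show "coinduced_unit n x p (rmul R 0 p (\<eta> c) r) = act M 0 (p + n) (\<eta> c) (coinduced_unit n x p r)"
      using M.act_assoc[of "\<eta> c" 0 r p x n] rmul_closed[of "\<eta> c" 0 r p] c r x by (simp add: coinduced_unit_def)
  qed (auto simp: coinduced_unit_def x M.act_add)
  show "coinduced_unit \<in> mhom R M (coinduced M)"
  proof (rule mhomI)
    fix n x assume x: "x \<in> carrier (mgrp M n)"
    show "coinduced_unit n x \<in> carrier (mgrp (coinduced M) n)" using cl[OF x] .
    show "coinduced_unit n (x \<otimes>\<^bsub>mgrp M n\<^esub> y) = coinduced_unit n x \<otimes>\<^bsub>mgrp (coinduced M) n\<^esub> coinduced_unit n y"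
      if y: "y \<in> carrier (mgrp M n)" for y
    proof (rule coinduced_eqI[of _ n])
      fix p r assume "r \<in> carrier (rgrp R p)"
      then show "coinduced_unit n (x \<otimes>\<^bsub>mgrp M n\<^esub> y) p r =
          (coinduced_unit n x \<otimes>\<^bsub>mgrp (coinduced M) n\<^esub> coinduced_unit n y) p r"
        using x y by (simp add: coinduced_simps coinduced_unit_def M.act_distrib)
    qed (simp_all add: cl x y coinduced_mult_closed)
    show "coinduced_unit (p + n) (act M p n r x) = act (coinduced M) p n r (coinduced_unit n x)"
      if r: "r \<in> carrier (rgrp R p)" for p r
    proof (rule coinduced_eqI[of _ "p + n"])
      fix q s assume s: "s \<in> carrier (rgrp R q)"
      then show "coinduced_unit (p + n) (act M p n r x) q s = act (coinduced M) p n r (coinduced_unit n x) q s"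
        using x r rmul_closed[OF s r] by (simp add: coinduced_simps coinduced_unit_def M.act_assoc)
    qed (simp_all add: cl x r coinduced_act_closed)
  qed
  show "inj_on (coinduced_unit n) (carrier (mgrp M n))"
  proof (rule inj_onI)
    fix x y assume xy: "x \<in> carrier (mgrp M n)" "y \<in> carrier (mgrp M n)" and e: "coinduced_unit n x = coinduced_unit n y"
    have "coinduced_unit n x 0 (rone R) = coinduced_unit n y 0 (rone R)" using e by simp
    then show "x = y" using xy by (simp add: coinduced_unit_def)
  qed
qed

text \<open>
  By adjunction, homomorphisms of \<open>R\<close>-modules into the coinduced module correspond to \<open>K\<close>-linear
  maps into \<open>M\<close>: evaluation at \<open>1\<close> in one direction, \<open>y \<mapsto> (r \<mapsto> G (r y))\<close> in the other. So it is enough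
  to extend a linear map of vector spaces in each degree.
\<close>

lemma coinduced_extension:
  assumes A: "gmodule R A" and B: "gmodule R B" and i: "i \<in> mhom R A B"
    and inj: "\<And>n. inj_on (i n) (carrier (mgrp A n))" and f: "f \<in> mhom R A (coinduced M)"
  shows "\<exists>g\<in>mhom R B (coinduced M). \<forall>n. \<forall>x\<in>carrier (mgrp A n). g n (i n x) = f n x"
proof -
  interpret A: graded_left_module R A using A by unfold_locales
  interpret B: graded_left_module R B using B by unfold_locales
  define e where "e n x = f n x 0 (rone R)" for n x
  have fc: "f n x \<in> carrier (mgrp (coinduced M) n)" if "x \<in> carrier (mgrp A n)" for n x
    using mhomD(2)[OF f that] .
  have ext: "\<exists>g. g \<in> hom (mgrp B n) (mgrp M n) \<and>
      (\<forall>k\<in>carrier K. \<forall>x\<in>carrier (mgrp B n). g (act B 0 n (\<eta> k) x) = act M 0 n (\<eta> k) (g x)) \<and>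
      (\<forall>x\<in>carrier (mgrp A n). g (i n x) = e n x)" for n
  proof -
    have 1: "e n \<in> hom (mgrp A n) (mgrp M n)"
    proof (rule homI)
      fix x assume x: "x \<in> carrier (mgrp A n)"
      then show "e n x \<in> carrier (mgrp M n)" using coinducedD(1)[OF fc[OF x] rone_closed] by (simp add: e_def)
      fix y assume y: "y \<in> carrier (mgrp A n)"
      then show "e n (x \<otimes>\<^bsub>mgrp A n\<^esub> y) = e n x \<otimes>\<^bsub>mgrp M n\<^esub> e n y"
        using x mhomD(3)[OF f x y] by (simp add: e_def coinduced_simps)
    qed
    have 2: "e n (act A 0 n (\<eta> k) x) = act M 0 n (\<eta> k) (e n x)" if "k \<in> carrier K" "x \<in> carrier (mgrp A n)" for k x
      using mhomD(4)[OF f \<eta>_closed[OF that(1)] that(2)] coinducedD(3)[OF fc[OF that(2)] that(1) rone_closed] that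
      by (simp add: e_def coinduced_simps)
    have 3: "i n (act A 0 n (\<eta> k) x) = act B 0 n (\<eta> k) (i n x)" if "k \<in> carrier K" "x \<in> carrier (mgrp A n)" for k x
      using mhomD(4)[OF i \<eta>_closed[OF that(1)] that(2)] by simp
    have 4: "e n x = \<one>\<^bsub>mgrp M n\<^esub>" if "x \<in> carrier (mgrp A n)" "i n x = \<one>\<^bsub>mgrp B n\<^esub>" for x
    proof -
      have "x = \<one>\<^bsub>mgrp A n\<^esub>" using that mhom_one[OF A B i, of n] inj[of n] by (auto simp: inj_on_def)
      then show ?thesis using hom_one[OF 1] A.mg.is_group M.mg.is_group by simp
    qed
    show ?thesis
    proof (rule extend_linear_map[where u = "i n" and v = "e n" and U = "mgrp A n" and a = "\<lambda>c x. act A 0 n (\<eta> c) x"])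
      show "scalar_action K (mgrp A n) (\<lambda>c x. act A 0 n (\<eta> c) x)"
        "scalar_action K (mgrp B n) (\<lambda>c x. act B 0 n (\<eta> c) x)"
        "scalar_action K (mgrp M n) (\<lambda>c x. act M 0 n (\<eta> c) x)"
        by (rule scalar_action_module; fact)+
    qed (use 1 2 3 4 mhomD(1)[OF i] in \<open>assumption | blast\<close>)+
  qed
  define G where "G n = (SOME g. g \<in> hom (mgrp B n) (mgrp M n) \<and>
      (\<forall>k\<in>carrier K. \<forall>x\<in>carrier (mgrp B n). g (act B 0 n (\<eta> k) x) = act M 0 n (\<eta> k) (g x)) \<and>
      (\<forall>x\<in>carrier (mgrp A n). g (i n x) = e n x))" for n
  have G: "G n \<in> hom (mgrp B n) (mgrp M n)"
      "k \<in> carrier K \<Longrightarrow> x \<in> carrier (mgrp B n) \<Longrightarrow> G n (act B 0 n (\<eta> k) x) = act M 0 n (\<eta> k) (G n x)"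
      "y \<in> carrier (mgrp A n) \<Longrightarrow> G n (i n y) = e n y" for n k x y
    using someI_ex[OF ext, of n] unfolding G_def[symmetric] by blast+
  have Gc [simp]: "G n x \<in> carrier (mgrp M n)" if "x \<in> carrier (mgrp B n)" for n x
    using G(1)[of n] that by (auto simp: hom_def)
  have Gm: "G n (x \<otimes>\<^bsub>mgrp B n\<^esub> y) = G n x \<otimes>\<^bsub>mgrp M n\<^esub> G n y"
    if "x \<in> carrier (mgrp B n)" "y \<in> carrier (mgrp B n)" for n x y
    using G(1)[of n] that by (auto simp: hom_def)
  define g where "g n y = (\<lambda>p. \<lambda>r\<in>carrier (rgrp R p). G (p + n) (act B p n r y))" for n y
  have gc: "g n y \<in> carrier (mgrp (coinduced M) n)" if y: "y \<in> carrier (mgrp B n)" for n y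
  proof (rule coinducedI)
    fix c p r assume c: "c \<in> carrier K" and r: "r \<in> carrier (rgrp R p)"
    show "g n y p (rmul R 0 p (\<eta> c) r) = act M 0 (p + n) (\<eta> c) (g n y p r)"
      using B.act_assoc[of "\<eta> c" 0 r p y n] rmul_closed[of "\<eta> c" 0 r p] c r y by (simp add: g_def G(2))
  qed (auto simp: g_def y B.act_add Gm)
  have "g \<in> mhom R B (coinduced M)"
  proof (rule mhomI)
    fix n x assume x: "x \<in> carrier (mgrp B n)"
    show "g n x \<in> carrier (mgrp (coinduced M) n)" using gc[OF x] .
    show "g n (x \<otimes>\<^bsub>mgrp B n\<^esub> y) = g n x \<otimes>\<^bsub>mgrp (coinduced M) n\<^esub> g n y"
      if y: "y \<in> carrier (mgrp B n)" for y
    proof (rule coinduced_eqI[of _ n])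
      fix p r assume "r \<in> carrier (rgrp R p)"
      then show "g n (x \<otimes>\<^bsub>mgrp B n\<^esub> y) p r = (g n x \<otimes>\<^bsub>mgrp (coinduced M) n\<^esub> g n y) p r"
        using x y by (simp add: coinduced_simps g_def B.act_distrib Gm)
    qed (simp_all add: gc x y coinduced_mult_closed)
    show "g (p + n) (act B p n r x) = act (coinduced M) p n r (g n x)"
      if r: "r \<in> carrier (rgrp R p)" for p r
    proof (rule coinduced_eqI[of _ "p + n"])
      fix q s assume "s \<in> carrier (rgrp R q)"
      then show "g (p + n) (act B p n r x) q s = act (coinduced M) p n r (g n x) q s"
        using r x rmul_closed[of s q r p] by (simp add: coinduced_simps g_def B.act_assoc add.assoc)
    qed (simp_all add: gc x r coinduced_act_closed)
  qed
  moreover have "g n (i n x) = f n x" if x: "x \<in> carrier (mgrp A n)" for n x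
  proof (rule coinduced_eqI[of _ n])
    show "g n (i n x) \<in> carrier (mgrp (coinduced M) n)" using gc mhomD(2)[OF i x] by simp
    show "f n x \<in> carrier (mgrp (coinduced M) n)" using fc x by simp
    fix p r assume r: "r \<in> carrier (rgrp R p)"
    have "g n (i n x) p r = G (p + n) (i (p + n) (act A p n r x))"
      using r x mhomD(4)[OF i r x] by (simp add: g_def)
    also have "\<dots> = f n x p r"
      using r x mhomD(4)[OF f r x] by (simp add: G(3) e_def coinduced_simps)
    finally show "g n (i n x) p r = f n x p r" .
  qed
  ultimately show ?thesis by blast
qed

end

text \<open>
  The coinduced module has its elements in the type \<open>int \<Rightarrow> 'r \<Rightarrow> 'u\<close>; a large type \<open>'u\<close> admits an
  injection from it, along which the module is copied back into \<open>'u\<close>.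
\<close>

lemma enough_injectives:
  fixes M :: "('r, 'u) gmod"
  assumes size: "large_type TYPE('r) TYPE('u)" and M: "gmodule R M"
  shows "\<exists>(E :: ('r, 'u) gmod) i. ginjective R E \<and> i \<in> mhom R M E \<and> (\<forall>n. inj_on (i n) (carrier (mgrp M n)))"
proof -
  obtain \<phi> :: "(int \<Rightarrow> 'r \<Rightarrow> 'u) \<Rightarrow> 'u" where \<phi>: "inj \<phi>" using size by (auto simp: large_type_def)
  define E where "E = encode \<phi> (coinduced M)"
  note enc = encode[OF graded_ring gmodule_coinduced[OF M] \<phi>, folded E_def]
  have "ginjective R E"
    unfolding ginjective_def
  proof (intro conjI allI impI)
    show "gmodule R E" by (rule enc(1))
    fix N' N :: "('r, 'u) gmod" and i f
    assume a: "gmodule R N' \<and> gmodule R N \<and> i \<in> mhom R N' N \<and>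
        (\<forall>n. inj_on (i n) (carrier (mgrp N' n))) \<and> f \<in> mhom R N' E"
    then obtain g where g: "g \<in> mhom R N (coinduced M)"
      "\<And>n x. x \<in> carrier (mgrp N' n) \<Longrightarrow> g n (i n x) = inv_into UNIV \<phi> (f n x)"
      using coinduced_extension[OF M, of N' N i "\<lambda>n x. inv_into UNIV \<phi> (f n x)"] mhom_comp[OF _ enc(3)] by blast
    have "f n x \<in> range \<phi>" if "x \<in> carrier (mgrp N' n)" for n x
      using a mhomD(2)[of f R N' E x n] that by (auto simp: E_def encode_def)
    then show "\<exists>g\<in>mhom R N E. \<forall>n. \<forall>x\<in>carrier (mgrp N' n). g n (i n x) = f n x"
      using mhom_comp[OF g(1) enc(2)] by (intro bexI[of _ "\<lambda>n x. \<phi> (g n x)"]) (auto simp: g(2) f_inv_into_f)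
  qed
  moreover have "(\<lambda>n x. \<phi> (coinduced_unit M n x)) \<in> mhom R M E"
    using mhom_comp[OF coinduced_unit_mhom[OF M] enc(2)] .
  moreover have "inj_on (\<lambda>x. \<phi> (coinduced_unit M n x)) (carrier (mgrp M n))" for n
    using coinduced_unit_inj[OF M, of n] \<phi> by (auto simp: inj_on_def)
  ultimately show ?thesis by blast
qed

end

section \<open>Injective resolutions and lifts of homomorphisms\<close>

lemma (in graded_left_module) gmodule_submod:
  assumes N: "gsubmodule R M N"
  shows "gmodule R (submod M N)"
proof (rule gmoduleI)
  show "comm_group (mgrp (submod M N) n)" for n
    using mg.subgroup_imp_group[OF gsubmoduleD(1)[OF N]] gsubmoduleD(2)[OF N]
    by (intro group.group_comm_groupI) (auto simp: submod_def intro: mg.m_comm)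
qed (use gsubmoduleD(2,6)[OF N] in \<open>auto simp: submod_def act_distrib act_add act_assoc\<close>)

lemma gsubmodule_image:
  assumes R: "graded_ring R" and M: "gmodule R M" and N: "gmodule R N" and f: "f \<in> mhom R M N"
  shows "gsubmodule R N (\<lambda>n. f n ` carrier (mgrp M n))"
proof -
  interpret M: graded_left_module R M using R M by unfold_locales
  have "f (p + q) (act M p q r x) \<in> f (p + q) ` carrier (mgrp M (p + q))"
    if "r \<in> carrier (rgrp R p)" "x \<in> carrier (mgrp M q)" for p q r x using that by simp
  then show ?thesis
    unfolding gsubmodule_def
    using group_hom.img_is_subgroup[OF mhom_group_hom[OF M N f]] by (auto simp: mhomD(4)[OF f, symmetric])
qed

text \<open>
  Injectivity only speaks of injections, so \<open>u\<close> is first factored through its image, a submodule of \<open>B\<close>.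
\<close>

lemma ginjective_extend:
  fixes A B E :: "('r, 'u) gmod"
  assumes R: "graded_ring R" and E: "ginjective R E" and A: "gmodule R A" and B: "gmodule R B"
    and u: "u \<in> mhom R A B" and v: "v \<in> mhom R A E"
    and ker: "\<And>n x. x \<in> carrier (mgrp A n) \<Longrightarrow> u n x = \<one>\<^bsub>mgrp B n\<^esub> \<Longrightarrow> v n x = \<one>\<^bsub>mgrp E n\<^esub>"
  shows "\<exists>g\<in>mhom R B E. \<forall>n. \<forall>x\<in>carrier (mgrp A n). g n (u n x) = v n x"
proof -
  have Em: "gmodule R E" using E by (simp add: ginjective_def)
  interpret A: graded_left_module R A using R A by unfold_locales
  interpret B: graded_left_module R B using R B by unfold_locales
  interpret E: graded_left_module R E using R Em by unfold_locales
  have fac: "v n x = v n y" if "x \<in> carrier (mgrp A n)" "y \<in> carrier (mgrp A n)" "u n x = u n y" for n x y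
  proof -
    interpret u: group_hom "mgrp A n" "mgrp B n" "u n" by (rule mhom_group_hom[OF A B u])
    interpret v: group_hom "mgrp A n" "mgrp E n" "v n" by (rule mhom_group_hom[OF A Em v])
    have "u n (x \<otimes>\<^bsub>mgrp A n\<^esub> inv\<^bsub>mgrp A n\<^esub> y) = \<one>\<^bsub>mgrp B n\<^esub>" using that by simp
    then have "v n x \<otimes>\<^bsub>mgrp E n\<^esub> inv\<^bsub>mgrp E n\<^esub> v n y = \<one>\<^bsub>mgrp E n\<^esub>" using ker[of "x \<otimes>\<^bsub>mgrp A n\<^esub> inv\<^bsub>mgrp A n\<^esub> y" n] that by simp
    then have "v n x \<otimes>\<^bsub>mgrp E n\<^esub> inv\<^bsub>mgrp E n\<^esub> v n y \<otimes>\<^bsub>mgrp E n\<^esub> v n y = v n y" using that by simp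
    then show ?thesis using that by (simp add: E.mg.m_assoc)
  qed
  define I where "I = (\<lambda>n. u n ` carrier (mgrp A n))"
  have I: "gsubmodule R B I" unfolding I_def by (rule gsubmodule_image[OF R A B u])
  define N' where "N' = submod B I"
  have N': "gmodule R N'" unfolding N'_def by (rule B.gmodule_submod[OF I])
  define f where "f n y = v n (SOME x. x \<in> carrier (mgrp A n) \<and> u n x = y)" for n y
  have f: "f n (u n x) = v n x" if x: "x \<in> carrier (mgrp A n)" for n x
  proof -
    have "\<exists>z. z \<in> carrier (mgrp A n) \<and> u n z = u n x" using x by blast
    from someI_ex[OF this] show ?thesis unfolding f_def using fac x by blast
  qed
  have "f \<in> mhom R N' E"
  proof (rule mhomI)
    fix n y assume "y \<in> carrier (mgrp N' n)"
    then obtain x where x: "x \<in> carrier (mgrp A n)" "y = u n x" by (auto simp: N'_def I_def submod_def)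
    then show "f n y \<in> carrier (mgrp E n)" using mhomD(2)[OF v] by (simp add: f)
    {
      fix y' assume "y' \<in> carrier (mgrp N' n)"
      then obtain x' where x': "x' \<in> carrier (mgrp A n)" "y' = u n x'" by (auto simp: N'_def I_def submod_def)
      have "y \<otimes>\<^bsub>mgrp N' n\<^esub> y' = u n (x \<otimes>\<^bsub>mgrp A n\<^esub> x')"
        using x x' mhomD(3)[OF u] by (simp add: N'_def submod_def)
      then show "f n (y \<otimes>\<^bsub>mgrp N' n\<^esub> y') = f n y \<otimes>\<^bsub>mgrp E n\<^esub> f n y'"
        using x x' mhomD(3)[OF v] by (simp add: f)
    }
    fix p r assume r: "r \<in> carrier (rgrp R p)"
    have "act N' p n r y = u (p + n) (act A p n r x)" using x r mhomD(4)[OF u] by (simp add: N'_def submod_def)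
    then show "f (p + n) (act N' p n r y) = act E p n r (f n y)"
      using x r mhomD(4)[OF v] by (simp add: f)
  qed
  moreover have "(\<lambda>n x. x) \<in> mhom R N' B"
    by (rule mhomI) (auto simp: N'_def submod_def gsubmoduleD(2)[OF I])
  ultimately obtain g where "g \<in> mhom R B E" "\<And>n x. x \<in> carrier (mgrp N' n) \<Longrightarrow> g n x = f n x"
    using E N' B unfolding ginjective_def by (metis inj_on_id2)
  moreover have "u n x \<in> carrier (mgrp N' n)" if "x \<in> carrier (mgrp A n)" for n x
    using that by (simp add: N'_def I_def submod_def)
  ultimately show ?thesis using f by (intro bexI[of _ g]) auto
qed

lemma embedding_with_cokernel:
  fixes M :: "('r, 'u) gmod"
  assumes R: "graded_ring R" and M: "gmodule R M"
    and enough: "\<exists>(E :: ('r, 'u) gmod) i. ginjective R E \<and> i \<in> mhom R M E \<and> (\<forall>n. inj_on (i n) (carrier (mgrp M n)))"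
  shows "\<exists>(E :: ('r, 'u) gmod) i (C :: ('r, 'u) gmod) p. ginjective R E \<and> i \<in> mhom R M E \<and>
    (\<forall>n. inj_on (i n) (carrier (mgrp M n))) \<and> gmodule R C \<and> p \<in> mhom R E C \<and>
    (\<forall>n. p n ` carrier (mgrp E n) = carrier (mgrp C n)) \<and>
    (\<forall>n. i n ` carrier (mgrp M n) = kernel (mgrp E n) (mgrp C n) (p n))"
proof -
  obtain E :: "('r, 'u) gmod" and i where E: "ginjective R E" "i \<in> mhom R M E" "\<forall>n. inj_on (i n) (carrier (mgrp M n))"
    using enough by blast
  have Em: "gmodule R E" using E by (simp add: ginjective_def)
  interpret E: graded_left_module R E using R Em by unfold_locales
  define P where "P = (\<lambda>n. i n ` carrier (mgrp M n))"
  have P: "gsubmodule R E P" unfolding P_def by (rule gsubmodule_image[OF R M Em E(2)])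
  have ker: "i n ` carrier (mgrp M n) = kernel (mgrp E n) (mgrp (cokernel_mod E P) n) (coset_rep E P n)" for n
    unfolding fun_cong[OF P_def, symmetric]
    using E.coset_rep_kernel[OF P] gsubmoduleD(2)[OF P] by (auto simp: kernel_def)
  have img: "coset_rep E P n ` carrier (mgrp E n) = carrier (mgrp (cokernel_mod E P) n)" for n
    by (simp add: cokernel_mod_def)
  show ?thesis
    by (intro exI[of _ E] exI[of _ i] exI[of _ "cokernel_mod E P"] exI[of _ "coset_rep E P"] conjI allI
        E(1,2) E(3)[rule_format] E.gmodule_cokernel[OF P] E.coset_rep_mhom[OF P] ker img)
qed

text \<open>
  Splicing: embed \<open>M\<close> into an injective module, then its cokernel, and so on. The differential is the
  projection to the next cokernel followed by the embedding of that cokernel.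
\<close>

lemma injective_resolution_exists:
  fixes M :: "('r, 'u) gmod"
  assumes R: "graded_ring R" and M: "gmodule R M"
    and enough: "\<And>M :: ('r, 'u) gmod. gmodule R M \<Longrightarrow>
      \<exists>(E :: ('r, 'u) gmod) i. ginjective R E \<and> i \<in> mhom R M E \<and> (\<forall>n. inj_on (i n) (carrier (mgrp M n)))"
  shows "\<exists>E. injective_resolution R M E"
proof -
  define ok :: "('r, 'u) gmod \<Rightarrow> ('r, 'u) gmod \<times> (int \<Rightarrow> 'u \<Rightarrow> 'u) \<times> ('r, 'u) gmod \<times> (int \<Rightarrow> 'u \<Rightarrow> 'u) \<Rightarrow> bool"
    where "ok N = (\<lambda>(E, i, C, p). ginjective R E \<and> i \<in> mhom R N E \<and>
      (\<forall>n. inj_on (i n) (carrier (mgrp N n))) \<and> gmodule R C \<and> p \<in> mhom R E C \<and>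
      (\<forall>n. p n ` carrier (mgrp E n) = carrier (mgrp C n)) \<and>
      (\<forall>n. i n ` carrier (mgrp N n) = kernel (mgrp E n) (mgrp C n) (p n)))" for N
  define pick where "pick N = (SOME t. ok N t)" for N
  have pick: "ok N (pick N)" if "gmodule R N" for N
  proof -
    have "\<exists>t. ok N t" using embedding_with_cokernel[OF R that enough[OF that]] by (simp add: ok_def)
    then show ?thesis unfolding pick_def by (rule someI_ex)
  qed
  define E i C p where "E N = fst (pick N)" and "i N = fst (snd (pick N))"
    and "C N = fst (snd (snd (pick N)))" and "p N = snd (snd (snd (pick N)))" for N
  have step: "ginjective R (E N)" "i N \<in> mhom R N (E N)" "inj_on (i N n) (carrier (mgrp N n))"
    "gmodule R (C N)" "p N \<in> mhom R (E N) (C N)"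
    "p N n ` carrier (mgrp (E N) n) = carrier (mgrp (C N) n)"
    "i N n ` carrier (mgrp N n) = kernel (mgrp (E N) n) (mgrp (C N) n) (p N n)" if "gmodule R N" for N n
    using pick[OF that] by (auto simp: ok_def E_def i_def C_def p_def split: prod.splits)
  define syz where "syz k = (C ^^ k) M" for k
  have syz_Suc: "syz (Suc k) = C (syz k)" for k by (simp add: syz_def)
  have syz: "gmodule R (syz k)" for k by (induction k) (simp_all add: syz_def M step(4))
  define F where "F = \<lparr>res_term = (\<lambda>k. E (syz k)), aug = i M,
    diff = (\<lambda>k n x. i (syz (Suc k)) n (p (syz k) n x))\<rparr>"
  have sC: "p (syz k) \<in> mhom R (E (syz k)) (syz (Suc k))" for k using step(5)[OF syz] by (simp add: syz_Suc)
  have d: "diff F k \<in> mhom R (res_term F k) (res_term F (Suc k))" for k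
    unfolding F_def using mhom_comp[OF sC step(2)[OF syz]] by simp
  have ker: "kernel (mgrp (res_term F k) n) (mgrp (res_term F (Suc k)) n) (diff F k n) =
      i (syz k) n ` carrier (mgrp (syz k) n)" for k n
  proof -
    have one: "i (syz (Suc k)) n \<one>\<^bsub>mgrp (syz (Suc k)) n\<^esub> = \<one>\<^bsub>mgrp (E (syz (Suc k))) n\<^esub>"
      using mhom_one[OF syz _ step(2)[OF syz]] step(1)[OF syz] by (simp add: ginjective_def)
    have 1: "\<one>\<^bsub>mgrp (syz (Suc k)) n\<^esub> \<in> carrier (mgrp (syz (Suc k)) n)"
    proof -
      interpret S: graded_left_module R "syz (Suc k)" using R syz by unfold_locales
      show ?thesis by simp
    qed
    have "i (syz (Suc k)) n z = \<one>\<^bsub>mgrp (E (syz (Suc k))) n\<^esub> \<longleftrightarrow> z = \<one>\<^bsub>mgrp (syz (Suc k)) n\<^esub>"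
      if "z \<in> carrier (mgrp (syz (Suc k)) n)" for z
      using one 1 that step(3)[OF syz, of "Suc k" n] by (metis inj_onD)
    then show ?thesis
      unfolding step(7)[OF syz] F_def using mhomD(2)[OF sC, of _ k n]
      by (auto simp: kernel_def syz_Suc[symmetric])
  qed
  have "injective_resolution R M F"
    unfolding injective_resolution_def
  proof (intro conjI allI)
    show "ginjective R (res_term F k)" for k using step(1)[OF syz] by (simp add: F_def)
    show "aug F \<in> mhom R M (res_term F 0)" using step(2)[OF M] by (simp add: F_def syz_def)
    show "diff F k \<in> mhom R (res_term F k) (res_term F (Suc k))" for k by (rule d)
    show "inj_on (aug F n) (carrier (mgrp M n))" for n using step(3)[OF M] by (simp add: F_def)
    show "aug F n ` carrier (mgrp M n) = kernel (mgrp (res_term F 0) n) (mgrp (res_term F 1) n) (diff F 0 n)" for n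
      using ker[of 0 n] by (simp add: F_def syz_def)
    show "diff F k n ` carrier (mgrp (res_term F k) n) =
        kernel (mgrp (res_term F (Suc k)) n) (mgrp (res_term F (Suc (Suc k))) n) (diff F (Suc k) n)" for k n
      unfolding ker using step(6)[OF syz, of k n] by (simp add: F_def syz_Suc image_image[symmetric])
  qed
  then show ?thesis by blast
qed

lemma injective_resolutionD:
  assumes "injective_resolution R M E"
  shows "ginjective R (res_term E k)" "gmodule R (res_term E k)"
    "aug E \<in> mhom R M (res_term E 0)" "diff E k \<in> mhom R (res_term E k) (res_term E (Suc k))"
    "inj_on (aug E n) (carrier (mgrp M n))"
    "x \<in> carrier (mgrp M n) \<Longrightarrow> diff E 0 n (aug E n x) = \<one>\<^bsub>mgrp (res_term E 1) n\<^esub>"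
    "y \<in> carrier (mgrp (res_term E 0) n) \<Longrightarrow> diff E 0 n y = \<one>\<^bsub>mgrp (res_term E 1) n\<^esub> \<Longrightarrow>
      y \<in> aug E n ` carrier (mgrp M n)"
    "y \<in> carrier (mgrp (res_term E k) n) \<Longrightarrow>
      diff E (Suc k) n (diff E k n y) = \<one>\<^bsub>mgrp (res_term E (Suc (Suc k))) n\<^esub>"
    "z \<in> carrier (mgrp (res_term E (Suc k)) n) \<Longrightarrow> diff E (Suc k) n z = \<one>\<^bsub>mgrp (res_term E (Suc (Suc k))) n\<^esub> \<Longrightarrow>
      z \<in> diff E k n ` carrier (mgrp (res_term E k) n)"
proof -
  show "ginjective R (res_term E k)" "aug E \<in> mhom R M (res_term E 0)"
    "diff E k \<in> mhom R (res_term E k) (res_term E (Suc k))" "inj_on (aug E n) (carrier (mgrp M n))"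
    using assms by (simp_all add: injective_resolution_def)
  then show "gmodule R (res_term E k)" by (simp add: ginjective_def)
  have "aug E n ` carrier (mgrp M n) = kernel (mgrp (res_term E 0) n) (mgrp (res_term E 1) n) (diff E 0 n)"
    using assms by (simp add: injective_resolution_def)
  then show "x \<in> carrier (mgrp M n) \<Longrightarrow> diff E 0 n (aug E n x) = \<one>\<^bsub>mgrp (res_term E 1) n\<^esub>"
    "y \<in> carrier (mgrp (res_term E 0) n) \<Longrightarrow> diff E 0 n y = \<one>\<^bsub>mgrp (res_term E 1) n\<^esub> \<Longrightarrow>
      y \<in> aug E n ` carrier (mgrp M n)"
    by (auto simp: kernel_def)
  have "diff E k n ` carrier (mgrp (res_term E k) n) =
      kernel (mgrp (res_term E (Suc k)) n) (mgrp (res_term E (Suc (Suc k))) n) (diff E (Suc k) n)"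
    using assms by (simp add: injective_resolution_def)
  then show "y \<in> carrier (mgrp (res_term E k) n) \<Longrightarrow>
      diff E (Suc k) n (diff E k n y) = \<one>\<^bsub>mgrp (res_term E (Suc (Suc k))) n\<^esub>"
    "z \<in> carrier (mgrp (res_term E (Suc k)) n) \<Longrightarrow> diff E (Suc k) n z = \<one>\<^bsub>mgrp (res_term E (Suc (Suc k))) n\<^esub> \<Longrightarrow>
      z \<in> diff E k n ` carrier (mgrp (res_term E k) n)"
    by (auto simp: kernel_def)
qed

text \<open>
  The lift \<open>\<phi>\<^sub>k\<^sub>+\<^sub>1\<close> extends \<open>\<delta> \<circ> \<phi>\<^sub>k\<close> along the differential. This is possible once \<open>\<delta> \<circ> \<phi>\<^sub>k\<close> kills the
  kernel of the differential, so that property is carried along in the recursion as an invariant; it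
  passes on because the kernel in the next term consists of boundaries.
\<close>

lemma comparison_map_exists:
  fixes M N :: "('r, 'u) gmod"
  assumes R: "graded_ring R" and M: "gmodule R M" and N: "gmodule R N" and f: "f \<in> mhom R M N"
    and E: "injective_resolution R M E" and F: "injective_resolution R N F"
  shows "\<exists>\<phi>. (\<forall>k. \<phi> k \<in> mhom R (res_term E k) (res_term F k)) \<and>
     (\<forall>n. \<forall>x\<in>carrier (mgrp M n). \<phi> 0 n (aug E n x) = aug F n (f n x)) \<and>
     (\<forall>k n. \<forall>x\<in>carrier (mgrp (res_term E k) n). \<phi> (Suc k) n (diff E k n x) = diff F k n (\<phi> k n x))"
proof -
  note E' = injective_resolutionD[OF E] and F' = injective_resolutionD[OF F]
  define P where "P k \<phi> \<longleftrightarrow> \<phi> \<in> mhom R (res_term E k) (res_term F k) \<and>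
    (k = 0 \<longrightarrow> (\<forall>n. \<forall>x\<in>carrier (mgrp M n). \<phi> n (aug E n x) = aug F n (f n x))) \<and>
    (\<forall>n. \<forall>x\<in>carrier (mgrp (res_term E k) n). diff E k n x = \<one>\<^bsub>mgrp (res_term E (Suc k)) n\<^esub> \<longrightarrow>
       diff F k n (\<phi> n x) = \<one>\<^bsub>mgrp (res_term F (Suc k)) n\<^esub>)" for k \<phi>
  have "\<exists>\<phi>. \<forall>k. P k (\<phi> k) \<and> (\<forall>n. \<forall>x\<in>carrier (mgrp (res_term E k) n). \<phi> (Suc k) n (diff E k n x) = diff F k n (\<phi> k n x))"
  proof (rule dependent_nat_choice)
    have "x = \<one>\<^bsub>mgrp M n\<^esub>" if "x \<in> carrier (mgrp M n)" "aug E n x = \<one>\<^bsub>mgrp (res_term E 0) n\<^esub>" for n x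
    proof -
      interpret M: graded_left_module R M using R M by unfold_locales
      show ?thesis using that E'(5)[of n] mhom_one[OF M E'(2) E'(3), of n] by (metis M.mg.one_closed inj_onD)
    qed
    moreover have "aug F n (f n \<one>\<^bsub>mgrp M n\<^esub>) = \<one>\<^bsub>mgrp (res_term F 0) n\<^esub>" for n
      using mhom_one[OF M F'(2) mhom_comp[OF f F'(3)]] .
    ultimately obtain g where g: "g \<in> mhom R (res_term E 0) (res_term F 0)"
      "\<And>n x. x \<in> carrier (mgrp M n) \<Longrightarrow> g n (aug E n x) = aug F n (f n x)"
      using ginjective_extend[OF R F'(1) M E'(2) E'(3) mhom_comp[OF f F'(3)]] by metis
    have "diff F 0 n (g n x) = \<one>\<^bsub>mgrp (res_term F 1) n\<^esub>"
      if "x \<in> carrier (mgrp (res_term E 0) n)" "diff E 0 n x = \<one>\<^bsub>mgrp (res_term E 1) n\<^esub>" for n x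
      using E'(7)[OF that] g(2) F'(6) mhomD(2)[OF f] by auto
    then show "\<exists>g. P 0 g" using g by (auto simp: P_def)
  next
    fix \<phi> k assume \<phi>: "P k \<phi>"
    then have \<phi>h: "\<phi> \<in> mhom R (res_term E k) (res_term F k)" by (simp add: P_def)
    obtain g where g: "g \<in> mhom R (res_term E (Suc k)) (res_term F (Suc k))"
      "\<And>n x. x \<in> carrier (mgrp (res_term E k) n) \<Longrightarrow> g n (diff E k n x) = diff F k n (\<phi> n x)"
      using ginjective_extend[OF R F'(1) E'(2) E'(2) E'(4) mhom_comp[OF \<phi>h F'(4)]] \<phi> unfolding P_def by metis
    have "diff F (Suc k) n (g n x) = \<one>\<^bsub>mgrp (res_term F (Suc (Suc k))) n\<^esub>"
      if "x \<in> carrier (mgrp (res_term E (Suc k)) n)" "diff E (Suc k) n x = \<one>\<^bsub>mgrp (res_term E (Suc (Suc k))) n\<^esub>" for n x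
      using E'(9)[OF that] g(2) F'(8) mhomD(2)[OF \<phi>h] by auto
    then show "\<exists>g. P (Suc k) g \<and> (\<forall>n. \<forall>x\<in>carrier (mgrp (res_term E k) n). g n (diff E k n x) = diff F k n (\<phi> n x))"
      using g by (auto simp: P_def)
  qed
  then obtain \<phi> where "\<And>k. P k (\<phi> k)"
    "\<And>k n x. x \<in> carrier (mgrp (res_term E k) n) \<Longrightarrow> \<phi> (Suc k) n (diff E k n x) = diff F k n (\<phi> k n x)" by blast
  then show ?thesis by (intro exI[of _ \<phi>]) (simp add: P_def)
qed

lemma inj_res:
  fixes M :: "('r, 'u) gmod"
  assumes R: "graded_ring R" and M: "gmodule R M"
    and enough: "\<And>M :: ('r, 'u) gmod. gmodule R M \<Longrightarrow>
      \<exists>(E :: ('r, 'u) gmod) i. ginjective R E \<and> i \<in> mhom R M E \<and> (\<forall>n. inj_on (i n) (carrier (mgrp M n)))"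
  shows "injective_resolution R M (inj_res R M)"
  unfolding inj_res_def by (rule someI_ex) (rule injective_resolution_exists[OF R M enough])

lemma inj_res_map:
  fixes M N :: "('r, 'u) gmod"
  assumes R: "graded_ring R" and M: "gmodule R M" and N: "gmodule R N" and f: "f \<in> mhom R M N"
    and E: "injective_resolution R M (inj_res R M)" and F: "injective_resolution R N (inj_res R N)"
  shows "inj_res_map R M N f k \<in> mhom R (res_term (inj_res R M) k) (res_term (inj_res R N) k)"
    and "x \<in> carrier (mgrp (res_term (inj_res R M) k) n) \<Longrightarrow>
      inj_res_map R M N f (Suc k) n (diff (inj_res R M) k n x) =
      diff (inj_res R N) k n (inj_res_map R M N f k n x)"
  using someI_ex[OF comparison_map_exists[OF R M N f E F]] unfolding inj_res_map_def[symmetric] by blast+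

section \<open>Directed colimits of subquotients\<close>

text \<open>
  The conditions say that the maps \<open>\<psi>\<^sub>i : G\<^sub>i \<rightarrow> H\<close> exhibit \<open>H\<close> as the colimit of the system. Then two pairs
  \<open>(i, x)\<close> and \<open>(j, y)\<close> are equivalent iff they have the same image in \<open>H\<close>. A class is therefore a fibre
  of the map \<open>(i, x) \<mapsto> \<psi>\<^sub>i x\<close>, and \<open>h\<close> corresponds to the fibre over it.
\<close>

lemma colim_grp_iso:
  fixes \<psi> :: "'i \<Rightarrow> 'x \<Rightarrow> 'h"
  defines "fib \<equiv> \<lambda>S G h. {(i, x). i \<in> S \<and> x \<in> carrier (G i) \<and> \<psi> i x = h}"
  assumes ne: "S \<noteq> {}" and dir: "\<And>i j. i \<in> S \<Longrightarrow> j \<in> S \<Longrightarrow> \<exists>k\<in>S. r i k \<and> r j k"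
    and t: "\<And>i k x. i \<in> S \<Longrightarrow> k \<in> S \<Longrightarrow> r i k \<Longrightarrow> x \<in> carrier (G i) \<Longrightarrow> t i k x \<in> carrier (G k) \<and> \<psi> k (t i k x) = \<psi> i x"
    and mult: "\<And>k x y. k \<in> S \<Longrightarrow> x \<in> carrier (G k) \<Longrightarrow> y \<in> carrier (G k) \<Longrightarrow>
      x \<otimes>\<^bsub>G k\<^esub> y \<in> carrier (G k) \<and> \<psi> k (x \<otimes>\<^bsub>G k\<^esub> y) = \<psi> k x \<otimes>\<^bsub>H\<^esub> \<psi> k y"
    and closed: "\<And>k x. k \<in> S \<Longrightarrow> x \<in> carrier (G k) \<Longrightarrow> \<psi> k x \<in> carrier H"
    and surj: "\<And>h. h \<in> carrier H \<Longrightarrow> \<exists>i\<in>S. \<exists>x\<in>carrier (G i). \<psi> i x = h"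
    and inj: "\<And>i j x y. i \<in> S \<Longrightarrow> j \<in> S \<Longrightarrow> x \<in> carrier (G i) \<Longrightarrow> y \<in> carrier (G j) \<Longrightarrow> \<psi> i x = \<psi> j y \<Longrightarrow>
      \<exists>k\<in>S. r i k \<and> r j k \<and> t i k x = t j k y"
  shows "fib S G \<in> iso H (colim_grp S r G t)"
    and "i \<in> S \<Longrightarrow> x \<in> carrier (G i) \<Longrightarrow> colim_class S r G t i x = fib S G (\<psi> i x)"
proof -
  have cls: "colim_class S r G t i x = fib S G (\<psi> i x)" if i: "i \<in> S" "x \<in> carrier (G i)" for i x
  proof -
    have "(\<exists>k\<in>S. r i k \<and> r j k \<and> t i k x = t j k y) \<longleftrightarrow> \<psi> j y = \<psi> i x"
      if "j \<in> S" "y \<in> carrier (G j)" for j y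
      using inj[OF i(1) that(1) i(2) that(2)] t[OF i(1) _ _ i(2)] t[OF that(1) _ _ that(2)] by metis
    then show ?thesis by (auto simp: colim_class_def fib_def)
  qed
  then show "i \<in> S \<Longrightarrow> x \<in> carrier (G i) \<Longrightarrow> colim_class S r G t i x = fib S G (\<psi> i x)" .
  have carr: "carrier (colim_grp S r G t) = fib S G ` carrier H"
  proof
    show "carrier (colim_grp S r G t) \<subseteq> fib S G ` carrier H"
      using cls closed by (auto simp: colim_grp_def)
    show "fib S G ` carrier H \<subseteq> carrier (colim_grp S r G t)"
    proof
      fix X assume "X \<in> fib S G ` carrier H"
      then obtain h where "h \<in> carrier H" "X = fib S G h" by blast
      then obtain i x where "i \<in> S" "x \<in> carrier (G i)" "X = colim_class S r G t i x" using surj[of h] cls by metis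
      then show "X \<in> carrier (colim_grp S r G t)" by (auto simp: colim_grp_def)
    qed
  qed
  have inj_fib: "inj_on (fib S G) (carrier H)"
  proof (rule inj_onI)
    fix h h' assume "h \<in> carrier H" and e: "fib S G h = fib S G h'"
    then obtain i x where "(i, x) \<in> fib S G h" using surj[of h] by (auto simp: fib_def)
    then show "h = h'" using e by (auto simp: fib_def)
  qed
  have "fib S G \<in> hom H (colim_grp S r G t)"
  proof (rule homI)
    show "fib S G h \<in> carrier (colim_grp S r G t)" if "h \<in> carrier H" for h using that carr by simp
    fix h h' assume h: "h \<in> carrier H" and h': "h' \<in> carrier H"
    let ?U = "{colim_class S r G t k (t i k x \<otimes>\<^bsub>G k\<^esub> t j k y) |i x j y k.
        (i, x) \<in> fib S G h \<and> (j, y) \<in> fib S G h' \<and> k \<in> S \<and> r i k \<and> r j k}"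
    have each: "colim_class S r G t k (t i k x \<otimes>\<^bsub>G k\<^esub> t j k y) = fib S G (h \<otimes>\<^bsub>H\<^esub> h')"
      if "(i, x) \<in> fib S G h" "(j, y) \<in> fib S G h'" "k \<in> S" "r i k" "r j k" for i x j y k
    proof -
      have ix: "i \<in> S" "x \<in> carrier (G i)" "\<psi> i x = h" and jy: "j \<in> S" "y \<in> carrier (G j)" "\<psi> j y = h'"
        using that by (auto simp: fib_def)
      show ?thesis
        using t[OF ix(1) that(3,4) ix(2)] t[OF jy(1) that(3,5) jy(2)] mult[OF that(3), of "t i k x" "t j k y"] cls[OF that(3)] ix jy
        by simp
    qed
    have ex: "fib S G (h \<otimes>\<^bsub>H\<^esub> h') \<in> ?U"
    proof -
      obtain i x j y where ix: "i \<in> S" "x \<in> carrier (G i)" "\<psi> i x = h" and jy: "j \<in> S" "y \<in> carrier (G j)" "\<psi> j y = h'"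
        using surj[OF h] surj[OF h'] by blast
      obtain k where k: "k \<in> S" "r i k" "r j k" using dir[OF ix(1) jy(1)] by blast
      have m: "(i, x) \<in> fib S G h" "(j, y) \<in> fib S G h'" using ix jy by (auto simp: fib_def)
      show ?thesis using each[OF m k] m k by (smt (verit) mem_Collect_eq)
    qed
    have "?U = {fib S G (h \<otimes>\<^bsub>H\<^esub> h')}"
    proof
      show "?U \<subseteq> {fib S G (h \<otimes>\<^bsub>H\<^esub> h')}"
      proof
        fix Y assume "Y \<in> ?U"
        then obtain i x j y k where "Y = colim_class S r G t k (t i k x \<otimes>\<^bsub>G k\<^esub> t j k y)"
          "(i, x) \<in> fib S G h" "(j, y) \<in> fib S G h'" "k \<in> S" "r i k" "r j k" by (smt (verit) mem_Collect_eq)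
        then show "Y \<in> {fib S G (h \<otimes>\<^bsub>H\<^esub> h')}" using each by simp
      qed
    qed (use ex in simp)
    then show "fib S G (h \<otimes>\<^bsub>H\<^esub> h') = fib S G h \<otimes>\<^bsub>colim_grp S r G t\<^esub> fib S G h'"
      by (simp add: colim_grp_def)
  qed
  then show "fib S G \<in> iso H (colim_grp S r G t)"
    using inj_fib carr by (auto simp: iso_def bij_betw_def)
qed

lemma coset_map_coset:
  assumes G: "comm_group G" and G': "comm_group G'" and h: "h \<in> hom G G'"
    and B: "subgroup B G" and B': "subgroup B' G'" and hB: "h ` B \<subseteq> B'" and x: "x \<in> carrier G"
  shows "coset_map G' B' h (B #>\<^bsub>G\<^esub> x) = B' #>\<^bsub>G'\<^esub> h x"
proof -
  interpret G: comm_group G by fact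
  interpret G': comm_group G' by fact
  have "B' #>\<^bsub>G'\<^esub> h z = B' #>\<^bsub>G'\<^esub> h x" if "z \<in> B #>\<^bsub>G\<^esub> x" for z
  proof -
    obtain b where b: "b \<in> B" "z = b \<otimes>\<^bsub>G\<^esub> x" using \<open>z \<in> B #>\<^bsub>G\<^esub> x\<close> by (auto simp: r_coset_def)
    have bc: "b \<in> carrier G" using b subgroup.subset[OF B] by blast
    have "h z = h b \<otimes>\<^bsub>G'\<^esub> h x" using h b bc x by (simp add: hom_mult)
    moreover have "h b \<in> B'" "h b \<in> carrier G'" "h x \<in> carrier G'" using hB b h bc x by (auto simp: hom_def)
    ultimately show ?thesis using subgroup.subset[OF B'] B'
      by (metis G'.coset_mult_assoc G'.coset_join2)
  qed
  moreover have "x \<in> B #>\<^bsub>G\<^esub> x" using G.rcos_self[OF x B] .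
  ultimately show ?thesis unfolding coset_map_def by blast
qed

lemma subquotient_carrier: "carrier (G\<lparr>carrier := Z\<rparr> Mod B) = (\<lambda>x. B #>\<^bsub>G\<^esub> x) ` Z"
  by (simp add: carrier_FactGroup r_coset_def)

lemma subquotient_mult:
  assumes G: "comm_group G" and B: "subgroup B G" and x: "x \<in> carrier G" "y \<in> carrier G"
  shows "(B #>\<^bsub>G\<^esub> x) \<otimes>\<^bsub>G\<lparr>carrier := Z\<rparr> Mod B\<^esub> (B #>\<^bsub>G\<^esub> y) = B #>\<^bsub>G\<^esub> (x \<otimes>\<^bsub>G\<^esub> y)"
proof -
  interpret G: comm_group G by fact
  interpret B: normal B G using G.subgroup_imp_normal[OF B] .
  show ?thesis using B.rcos_sum[OF x] by (simp add: FactGroup_def set_mult_def)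
qed

text \<open>
  Exactness of directed colimits for a system of groups \<open>G\<^sub>i\<close> that embed compatibly into one group \<open>H\<close>: if
  \<open>Z\<close> and \<open>B\<close> are the unions of the images of \<open>Z\<^sub>i\<close> and \<open>B\<^sub>i\<close>, then \<open>Z / B\<close> is the colimit of \<open>Z\<^sub>i / B\<^sub>i\<close>.
  The point is injectivity: two classes that agree in \<open>Z / B\<close> differ by an element of some \<open>B\<^sub>l\<close>, so
  they already agree at every stage beyond \<open>i\<close>, \<open>j\<close> and \<open>l\<close>.
\<close>

lemma colim_subquotient:
  fixes S :: "'i set" and G :: "'i \<Rightarrow> 'x monoid" and H :: "'h monoid" and ev :: "'i \<Rightarrow> 'x \<Rightarrow> 'h"
    and Z B :: "'h set" and Zi Bi :: "'i \<Rightarrow> 'x set" and t :: "'i \<Rightarrow> 'i \<Rightarrow> 'x \<Rightarrow> 'x"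
  defines "\<psi> \<equiv> \<lambda>i. coset_map H B (ev i)"
  defines "Q \<equiv> \<lambda>i. (G i)\<lparr>carrier := Zi i\<rparr> Mod Bi i" and "T \<equiv> \<lambda>i k. coset_map (G k) (Bi k) (t i k)"
  assumes ne: "S \<noteq> {}" and dir: "\<And>i j. i \<in> S \<Longrightarrow> j \<in> S \<Longrightarrow> \<exists>k\<in>S. r i k \<and> r j k"
    and trans: "\<And>i j k. r i j \<Longrightarrow> r j k \<Longrightarrow> r i k"
    and H: "comm_group H" and Z: "subgroup Z H" and B: "subgroup B H" and BZ: "B \<subseteq> Z"
    and G: "\<And>i. i \<in> S \<Longrightarrow> comm_group (G i)" and Zi: "\<And>i. i \<in> S \<Longrightarrow> subgroup (Zi i) (G i)"
    and Bi: "\<And>i. i \<in> S \<Longrightarrow> subgroup (Bi i) (G i)"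
    and ev: "\<And>i. i \<in> S \<Longrightarrow> ev i \<in> hom (G i) H" and inj: "\<And>i. i \<in> S \<Longrightarrow> inj_on (ev i) (carrier (G i))"
    and t: "\<And>i k. i \<in> S \<Longrightarrow> k \<in> S \<Longrightarrow> r i k \<Longrightarrow> t i k \<in> hom (G i) (G k)"
    and evt: "\<And>i k x. i \<in> S \<Longrightarrow> k \<in> S \<Longrightarrow> r i k \<Longrightarrow> x \<in> carrier (G i) \<Longrightarrow> ev k (t i k x) = ev i x"
    and tZ: "\<And>i k x. i \<in> S \<Longrightarrow> k \<in> S \<Longrightarrow> r i k \<Longrightarrow> x \<in> Zi i \<Longrightarrow> t i k x \<in> Zi k"
    and tB: "\<And>i k x. i \<in> S \<Longrightarrow> k \<in> S \<Longrightarrow> r i k \<Longrightarrow> x \<in> Bi i \<Longrightarrow> t i k x \<in> Bi k"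
    and Z_eq: "Z = (\<Union>i\<in>S. ev i ` Zi i)" and B_eq: "B = (\<Union>i\<in>S. ev i ` Bi i)"
  shows "(\<lambda>h. {(i, x). i \<in> S \<and> x \<in> carrier (Q i) \<and> \<psi> i x = h}) \<in> iso (H\<lparr>carrier := Z\<rparr> Mod B) (colim_grp S r Q T)"
    and "i \<in> S \<Longrightarrow> X \<in> carrier (Q i) \<Longrightarrow>
      colim_class S r Q T i X = {(j, Y). j \<in> S \<and> Y \<in> carrier (Q j) \<and> \<psi> j Y = \<psi> i X}"
    and "i \<in> S \<Longrightarrow> x \<in> Zi i \<Longrightarrow> \<psi> i (Bi i #>\<^bsub>G i\<^esub> x) = B #>\<^bsub>H\<^esub> ev i x"
proof -
  interpret H: comm_group H by fact
  have Zc: "x \<in> carrier (G i)" if "i \<in> S" "x \<in> Zi i" for i x using subgroup.subset[OF Zi] that by blast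
  have Bc: "x \<in> carrier (G i)" if "i \<in> S" "x \<in> Bi i" for i x using subgroup.subset[OF Bi] that by blast
  have evc: "ev i x \<in> carrier H" if "i \<in> S" "x \<in> carrier (G i)" for i x using ev that by (auto simp: hom_def)
  have tc: "t i k x \<in> carrier (G k)" if "i \<in> S" "k \<in> S" "r i k" "x \<in> carrier (G i)" for i k x
    using t that by (auto simp: hom_def)
  have \<psi>: "\<psi> i (Bi i #>\<^bsub>G i\<^esub> x) = B #>\<^bsub>H\<^esub> ev i x" if "i \<in> S" "x \<in> carrier (G i)" for i x
    unfolding \<psi>_def
    by (rule coset_map_coset[OF G[OF that(1)] H ev[OF that(1)] Bi[OF that(1)] B _ that(2)]) (use that B_eq in blast)
  then show "i \<in> S \<Longrightarrow> x \<in> Zi i \<Longrightarrow> \<psi> i (Bi i #>\<^bsub>G i\<^esub> x) = B #>\<^bsub>H\<^esub> ev i x" using Zc by blast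
  have T: "T i k (Bi i #>\<^bsub>G i\<^esub> x) = Bi k #>\<^bsub>G k\<^esub> t i k x" if "i \<in> S" "k \<in> S" "r i k" "x \<in> carrier (G i)" for i k x
    unfolding T_def
    by (rule coset_map_coset[OF G[OF that(1)] G[OF that(2)] t[OF that(1-3)] Bi[OF that(1)] Bi[OF that(2)] _ that(4)])
      (use that tB in blast)
  have Q: "carrier (Q i) = (\<lambda>x. Bi i #>\<^bsub>G i\<^esub> x) ` Zi i" for i by (simp add: Q_def subquotient_carrier)
  have tQ: "T i k X \<in> carrier (Q k) \<and> \<psi> k (T i k X) = \<psi> i X"
    if i: "i \<in> S" "k \<in> S" "r i k" and X: "X \<in> carrier (Q i)" for i k X
  proof -
    obtain x where x: "x \<in> Zi i" "X = Bi i #>\<^bsub>G i\<^esub> x" using X by (auto simp: Q)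
    then show ?thesis using i Zc tZ tc evt by (auto simp: T Q \<psi>)
  qed
  have mQ: "X \<otimes>\<^bsub>Q k\<^esub> Y \<in> carrier (Q k) \<and> \<psi> k (X \<otimes>\<^bsub>Q k\<^esub> Y) = \<psi> k X \<otimes>\<^bsub>H\<lparr>carrier := Z\<rparr> Mod B\<^esub> \<psi> k Y"
    if k: "k \<in> S" and X: "X \<in> carrier (Q k)" and Y: "Y \<in> carrier (Q k)" for k X Y
  proof -
    obtain x y where x: "x \<in> Zi k" "X = Bi k #>\<^bsub>G k\<^esub> x" and y: "y \<in> Zi k" "Y = Bi k #>\<^bsub>G k\<^esub> y" using X Y by (auto simp: Q)
    have xy: "x \<otimes>\<^bsub>G k\<^esub> y \<in> Zi k" using x y subgroup.m_closed[OF Zi[OF k]] by blast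
    have m: "X \<otimes>\<^bsub>Q k\<^esub> Y = Bi k #>\<^bsub>G k\<^esub> (x \<otimes>\<^bsub>G k\<^esub> y)"
      unfolding Q_def x y by (rule subquotient_mult[OF G[OF k] Bi[OF k]]) (use k x y Zc in auto)
    moreover have "\<psi> k X \<otimes>\<^bsub>H\<lparr>carrier := Z\<rparr> Mod B\<^esub> \<psi> k Y = B #>\<^bsub>H\<^esub> (ev k x \<otimes>\<^bsub>H\<^esub> ev k y)"
      using k x y Zc evc by (simp add: \<psi> subquotient_mult[OF H B] del: mult_FactGroup)
    ultimately show ?thesis using xy k x y Zc hom_mult[OF ev[OF k]] by (simp add: Q \<psi>)
  qed
  have cQ: "\<psi> k X \<in> carrier (H\<lparr>carrier := Z\<rparr> Mod B)" if k: "k \<in> S" and X: "X \<in> carrier (Q k)" for k X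
  proof -
    obtain x where "x \<in> Zi k" "X = Bi k #>\<^bsub>G k\<^esub> x" using X by (auto simp: Q)
    moreover have "ev k x \<in> Z" using k calculation by (auto simp: Z_eq)
    ultimately show ?thesis using k Zc by (simp add: \<psi> subquotient_carrier)
  qed
  have sQ: "\<exists>i\<in>S. \<exists>x\<in>carrier (Q i). \<psi> i x = h" if h: "h \<in> carrier (H\<lparr>carrier := Z\<rparr> Mod B)" for h
  proof -
    obtain i x where "i \<in> S" "x \<in> Zi i" "h = B #>\<^bsub>H\<^esub> ev i x" using h by (auto simp: subquotient_carrier Z_eq)
    then show ?thesis using Zc by (intro bexI[of _ i] bexI[of _ "Bi i #>\<^bsub>G i\<^esub> x"]) (auto simp: Q \<psi>)
  qed
  have iQ: "\<exists>k\<in>S. r i k \<and> r j k \<and> T i k X = T j k Y"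
    if i: "i \<in> S" and j: "j \<in> S" and X: "X \<in> carrier (Q i)" and Y: "Y \<in> carrier (Q j)" and e: "\<psi> i X = \<psi> j Y" for i j X Y
  proof -
    obtain x where x: "x \<in> carrier (G i)" "X = Bi i #>\<^bsub>G i\<^esub> x" using X i Zc by (auto simp: Q)
    obtain y where y: "y \<in> carrier (G j)" "Y = Bi j #>\<^bsub>G j\<^esub> y" using Y j Zc by (auto simp: Q)
    have "ev i x \<otimes>\<^bsub>H\<^esub> inv\<^bsub>H\<^esub> ev j y \<in> B"
      using e i j x y evc by (simp add: \<psi> H.coset_eq_iff[OF B])
    then obtain l b where l: "l \<in> S" "b \<in> Bi l" "ev i x \<otimes>\<^bsub>H\<^esub> inv\<^bsub>H\<^esub> ev j y = ev l b" by (auto simp: B_eq)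
    obtain m where m: "m \<in> S" "r i m" "r j m" using dir[OF i j] by blast
    obtain k where k: "k \<in> S" "r m k" "r l k" using dir[OF m(1) l(1)] by blast
    have ik: "r i k" "r j k" using trans m k by blast+
    interpret Gk: comm_group "G k" using G[OF k(1)] .
    interpret evk: group_hom "G k" H "ev k" using ev[OF k(1)] by unfold_locales
    have "ev k (t i k x \<otimes>\<^bsub>G k\<^esub> inv\<^bsub>G k\<^esub> t j k y) = ev k (t l k b)"
      using i j k ik l x y tc evt Bc by simp
    then have "t i k x \<otimes>\<^bsub>G k\<^esub> inv\<^bsub>G k\<^esub> t j k y = t l k b"
      using inj_onD[OF inj[OF k(1)]] i j k ik l x y tc Bc by simp
    then have "t i k x \<otimes>\<^bsub>G k\<^esub> inv\<^bsub>G k\<^esub> t j k y \<in> Bi k" using tB l k by simp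
    then have "T i k X = T j k Y" using i j k ik x y tc by (simp add: T Gk.coset_eq_iff[OF Bi])
    then show ?thesis using k ik by blast
  qed
  note iso = colim_grp_iso[where \<psi> = \<psi> and S = S and r = r and G = Q and t = T and H = "H\<lparr>carrier := Z\<rparr> Mod B",
      OF ne dir tQ mQ cQ sQ iQ]
  show "(\<lambda>h. {(i, x). i \<in> S \<and> x \<in> carrier (Q i) \<and> \<psi> i x = h}) \<in> iso (H\<lparr>carrier := Z\<rparr> Mod B) (colim_grp S r Q T)"
    by (rule iso(1))
  show "i \<in> S \<Longrightarrow> X \<in> carrier (Q i) \<Longrightarrow>
      colim_class S r Q T i X = {(j, Y). j \<in> S \<and> Y \<in> carrier (Q j) \<and> \<psi> j Y = \<psi> i X}"
    by (rule iso(2))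
qed

section \<open>Homomorphisms out of a cyclic module\<close>

context graded_left_module
begin

lemma quot_mod_simps:
  assumes P: "gsubmodule R M P"
  shows "carrier (mgrp (quot_mod M P) n) = (\<lambda>x. P n #>\<^bsub>mgrp M n\<^esub> x) ` carrier (mgrp M n)"
    and "x \<in> carrier (mgrp M n) \<Longrightarrow> y \<in> carrier (mgrp M n) \<Longrightarrow>
      (P n #>\<^bsub>mgrp M n\<^esub> x) \<otimes>\<^bsub>mgrp (quot_mod M P) n\<^esub> (P n #>\<^bsub>mgrp M n\<^esub> y) = P n #>\<^bsub>mgrp M n\<^esub> (x \<otimes>\<^bsub>mgrp M n\<^esub> y)"
    and "r \<in> carrier (rgrp R p) \<Longrightarrow> x \<in> carrier (mgrp M n) \<Longrightarrow>
      act (quot_mod M P) p n r (P n #>\<^bsub>mgrp M n\<^esub> x) = P (p + n) #>\<^bsub>mgrp M (p + n)\<^esub> act M p n r x"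
proof -
  show "carrier (mgrp (quot_mod M P) n) = (\<lambda>x. P n #>\<^bsub>mgrp M n\<^esub> x) ` carrier (mgrp M n)"
    by (simp add: quot_mod_def carrier_FactGroup)
  show "(P n #>\<^bsub>mgrp M n\<^esub> x) \<otimes>\<^bsub>mgrp (quot_mod M P) n\<^esub> (P n #>\<^bsub>mgrp M n\<^esub> y) = P n #>\<^bsub>mgrp M n\<^esub> (x \<otimes>\<^bsub>mgrp M n\<^esub> y)"
    if "x \<in> carrier (mgrp M n)" "y \<in> carrier (mgrp M n)"
  proof -
    interpret P: normal "P n" "mgrp M n" using mg.subgroup_imp_normal[OF gsubmoduleD(1)[OF P]] .
    show ?thesis using P.rcos_sum[OF that] by (simp add: quot_mod_def)
  qed
  show "act (quot_mod M P) p n r (P n #>\<^bsub>mgrp M n\<^esub> x) = P (p + n) #>\<^bsub>mgrp M (p + n)\<^esub> act M p n r x"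
    if "r \<in> carrier (rgrp R p)" "x \<in> carrier (mgrp M n)"
    using coset_map_coset[OF mg.comm_group_axioms mg.comm_group_axioms act_hom[OF that(1)]
        gsubmoduleD(1)[OF P] gsubmoduleD(1)[OF P] _ that(2)] gsubmoduleD(6)[OF P that(1)]
    by (simp add: quot_mod_def image_subset_iff)
qed

end

context graded_ring_over
begin

lemma ring_quot_simps:
  assumes I: "gsubmodule R (reg R) I"
  shows "carrier (mgrp (ring_quot R I) n) = (\<lambda>x. I n #>\<^bsub>rgrp R n\<^esub> x) ` carrier (rgrp R n)"
    and "x \<in> carrier (rgrp R n) \<Longrightarrow> y \<in> carrier (rgrp R n) \<Longrightarrow>
      (I n #>\<^bsub>rgrp R n\<^esub> x) \<otimes>\<^bsub>mgrp (ring_quot R I) n\<^esub> (I n #>\<^bsub>rgrp R n\<^esub> y) = I n #>\<^bsub>rgrp R n\<^esub> (x \<otimes>\<^bsub>rgrp R n\<^esub> y)"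
    and "r \<in> carrier (rgrp R p) \<Longrightarrow> x \<in> carrier (rgrp R n) \<Longrightarrow>
      act (ring_quot R I) p n r (I n #>\<^bsub>rgrp R n\<^esub> x) = I (p + n) #>\<^bsub>rgrp R (p + n)\<^esub> rmul R p n r x"
proof -
  interpret reg: graded_left_module R "reg R" using regular_module by unfold_locales
  show "carrier (mgrp (ring_quot R I) n) = (\<lambda>x. I n #>\<^bsub>rgrp R n\<^esub> x) ` carrier (rgrp R n)"
    using reg.quot_mod_simps(1)[OF I, of n] by (simp add: ring_quot_def reg_def)
  show "x \<in> carrier (rgrp R n) \<Longrightarrow> y \<in> carrier (rgrp R n) \<Longrightarrow>
      (I n #>\<^bsub>rgrp R n\<^esub> x) \<otimes>\<^bsub>mgrp (ring_quot R I) n\<^esub> (I n #>\<^bsub>rgrp R n\<^esub> y) = I n #>\<^bsub>rgrp R n\<^esub> (x \<otimes>\<^bsub>rgrp R n\<^esub> y)"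
    using reg.quot_mod_simps(2)[OF I, of x n y] by (simp add: ring_quot_def reg_def)
  show "r \<in> carrier (rgrp R p) \<Longrightarrow> x \<in> carrier (rgrp R n) \<Longrightarrow>
      act (ring_quot R I) p n r (I n #>\<^bsub>rgrp R n\<^esub> x) = I (p + n) #>\<^bsub>rgrp R (p + n)\<^esub> rmul R p n r x"
    using reg.quot_mod_simps(3)[OF I, of r p x n] by (simp add: ring_quot_def reg_def)
qed

lemma quot_proj_coset:
  assumes I: "gsubmodule R (reg R) I" and J: "gsubmodule R (reg R) J" and JI: "J \<le> I"
    and r: "r \<in> carrier (rgrp R n)"
  shows "quot_proj R I n (J n #>\<^bsub>rgrp R n\<^esub> r) = I n #>\<^bsub>rgrp R n\<^esub> r"
  unfolding quot_proj_def
  using coset_map_coset[OF rg.comm_group_axioms rg.comm_group_axioms, of "\<lambda>x. x" n n "J n" "I n" r]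
    gsubmoduleD(1)[OF I, of n] gsubmoduleD(1)[OF J, of n] JI r
  by (auto simp: reg_def le_fun_def hom_def)

end

definition killed :: "('r, 'x) gmod \<Rightarrow> 'r gideal \<Rightarrow> int \<Rightarrow> 'x set" where
  "killed M I d = {x \<in> carrier (mgrp M d). \<forall>p. \<forall>r\<in>I p. act M p d r x = \<one>\<^bsub>mgrp M (p + d)\<^esub>}"

lemma killed_antimono: "J \<le> I \<Longrightarrow> killed M I d \<subseteq> killed M J d"
  by (auto simp: killed_def le_fun_def)

text \<open>
  The homomorphism from the \<open>d\<close>-fold suspension of \<open>R/I\<close> that sends the coset of \<open>1\<close> to \<open>x\<close>. The coset of
  \<open>r\<close> goes to \<open>r x\<close>, which does not depend on the choice of \<open>r\<close> if \<open>I\<close> kills \<open>x\<close>.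
\<close>

definition hom_of_killed :: "('r, 'x) gmod \<Rightarrow> 'r gring \<Rightarrow> 'r gideal \<Rightarrow> int \<Rightarrow> 'x \<Rightarrow> int \<Rightarrow> 'r set \<Rightarrow> 'x" where
  "hom_of_killed M R I d x = (\<lambda>k. \<lambda>X\<in>carrier (mgrp (ring_quot R I) (k - d)). act M (k - d) d (SOME r. r \<in> X) x)"

definition eval_one :: "'r gring \<Rightarrow> 'r gideal \<Rightarrow> int \<Rightarrow> (int \<Rightarrow> 'r set \<Rightarrow> 'x) \<Rightarrow> 'x" where
  "eval_one R I d h = h d (I 0 #>\<^bsub>rgrp R 0\<^esub> rone R)"

context graded_left_module
begin

lemma killed_subgroup:
  assumes I: "gsubmodule R (reg R) I"
  shows "subgroup (killed M I d) (mgrp M d)"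
proof (rule mg.subgroupI)
  have Ic: "r \<in> carrier (rgrp R p)" if "r \<in> I p" for r p using gsubmoduleD(2)[OF I that] by (simp add: reg_def)
  show "killed M I d \<subseteq> carrier (mgrp M d)" by (auto simp: killed_def)
  show "killed M I d \<noteq> {}" using Ic by (auto simp: killed_def intro!: exI[of _ "\<one>\<^bsub>mgrp M d\<^esub>"])
  show "inv\<^bsub>mgrp M d\<^esub> a \<in> killed M I d" if "a \<in> killed M I d" for a
    using that Ic by (auto simp: killed_def act_inv)
  show "a \<otimes>\<^bsub>mgrp M d\<^esub> b \<in> killed M I d" if "a \<in> killed M I d" "b \<in> killed M I d" for a b
    using that Ic by (auto simp: killed_def act_distrib)
qed

context
  fixes I :: "'r gideal" and d :: int
  assumes I: "gsubmodule R (reg R) I"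
begin

abbreviation "HomI \<equiv> fobj (hom_fun R (ring_quot R I)) M d"

lemma hom_of_killed_coset:
  assumes x: "x \<in> killed M I d" and r: "r \<in> carrier (rgrp R (k - d))"
  shows "hom_of_killed M R I d x k (I (k - d) #>\<^bsub>rgrp R (k - d)\<^esub> r) = act M (k - d) d r x"
proof -
  have xc: "x \<in> carrier (mgrp M d)" using x by (simp add: killed_def)
  define X where "X = I (k - d) #>\<^bsub>rgrp R (k - d)\<^esub> r"
  have s: "subgroup (I (k - d)) (rgrp R (k - d))" using gsubmoduleD(1)[OF I, of "k - d"] by (simp add: reg_def)
  have "r \<in> X" unfolding X_def using rg.rcos_self[OF r s] .
  then have "(SOME r. r \<in> X) \<in> X" by (rule someI)
  then obtain b where b: "b \<in> I (k - d)" "(SOME r. r \<in> X) = b \<otimes>\<^bsub>rgrp R (k - d)\<^esub> r" by (auto simp: X_def r_coset_def)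
  have bc: "b \<in> carrier (rgrp R (k - d))" using subgroup.subset[OF s] b by blast
  have "act M (k - d) d (SOME r. r \<in> X) x = act M (k - d) d r x"
    using act_add[OF bc r xc] act_closed[OF r xc] x b by (simp add: killed_def)
  moreover have "X \<in> carrier (mgrp (ring_quot R I) (k - d))" using r by (simp add: X_def ring_quot_simps[OF I])
  ultimately show ?thesis by (simp add: hom_of_killed_def X_def)
qed

lemma hom_carrier_iff:
  "h \<in> carrier HomI \<longleftrightarrow> h \<in> mhom R (susp d (ring_quot R I)) M \<and>
     (\<forall>k. h k \<in> extensional (carrier (mgrp (ring_quot R I) (k - d))))"
  by (simp add: hom_fun_def susp_def)

lemma hom_of_killed_closed:
  assumes x: "x \<in> killed M I d"
  shows "hom_of_killed M R I d x \<in> carrier HomI"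
  unfolding hom_carrier_iff
proof (intro conjI allI)
  have xc: "x \<in> carrier (mgrp M d)" using x by (simp add: killed_def)
  show "hom_of_killed M R I d x \<in> mhom R (susp d (ring_quot R I)) M"
  proof (rule mhomI)
    fix k X assume "X \<in> carrier (mgrp (susp d (ring_quot R I)) k)"
    then obtain r where r: "r \<in> carrier (rgrp R (k - d))" "X = I (k - d) #>\<^bsub>rgrp R (k - d)\<^esub> r"
      by (auto simp: susp_def ring_quot_simps[OF I])
    show "hom_of_killed M R I d x k X \<in> carrier (mgrp M k)"
      using act_closed[OF r(1) xc] by (simp add: r hom_of_killed_coset[OF x])
    {
      fix Y assume "Y \<in> carrier (mgrp (susp d (ring_quot R I)) k)"
      then obtain s where s: "s \<in> carrier (rgrp R (k - d))" "Y = I (k - d) #>\<^bsub>rgrp R (k - d)\<^esub> s"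
        by (auto simp: susp_def ring_quot_simps[OF I])
      have "X \<otimes>\<^bsub>mgrp (susp d (ring_quot R I)) k\<^esub> Y = I (k - d) #>\<^bsub>rgrp R (k - d)\<^esub> (r \<otimes>\<^bsub>rgrp R (k - d)\<^esub> s)"
        using r s by (simp add: susp_def ring_quot_simps[OF I])
      then show "hom_of_killed M R I d x k (X \<otimes>\<^bsub>mgrp (susp d (ring_quot R I)) k\<^esub> Y) =
          hom_of_killed M R I d x k X \<otimes>\<^bsub>mgrp M k\<^esub> hom_of_killed M R I d x k Y"
        using r s act_add[OF r(1) s(1) xc] by (simp add: hom_of_killed_coset[OF x])
    }
    fix p s assume s: "s \<in> carrier (rgrp R p)"
    have "act (susp d (ring_quot R I)) p k s X = I (p + k - d) #>\<^bsub>rgrp R (p + k - d)\<^esub> rmul R p (k - d) s r"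
      using r s by (simp add: susp_def ring_quot_simps[OF I] add_diff_eq)
    moreover have "rmul R p (k - d) s r \<in> carrier (rgrp R (p + k - d))"
      using rmul_closed[OF s r(1)] by (simp add: add_diff_eq)
    ultimately show "hom_of_killed M R I d x (p + k) (act (susp d (ring_quot R I)) p k s X) =
        act M p k s (hom_of_killed M R I d x k X)"
      using act_assoc[OF s r(1) xc] r by (simp add: hom_of_killed_coset[OF x] add_diff_eq)
  qed
  show "hom_of_killed M R I d x k \<in> extensional (carrier (mgrp (ring_quot R I) (k - d)))" for k
    by (simp add: hom_of_killed_def)
qed

lemma eval_hom_of_killed: "x \<in> killed M I d \<Longrightarrow> eval_one R I d (hom_of_killed M R I d x) = x"
  using hom_of_killed_coset[of x "rone R" d] by (simp add: eval_one_def killed_def)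

lemma hom_coset:
  assumes h: "h \<in> carrier HomI" and r: "r \<in> carrier (rgrp R (k - d))"
  shows "h k (I (k - d) #>\<^bsub>rgrp R (k - d)\<^esub> r) = act M (k - d) d r (eval_one R I d h)"
proof -
  have h': "h \<in> mhom R (susp d (ring_quot R I)) M" using h by (simp add: hom_carrier_iff)
  have "I 0 #>\<^bsub>rgrp R 0\<^esub> rone R \<in> carrier (mgrp (susp d (ring_quot R I)) d)"
    by (simp add: susp_def ring_quot_simps[OF I])
  moreover have "act (susp d (ring_quot R I)) (k - d) d r (I 0 #>\<^bsub>rgrp R 0\<^esub> rone R) = I (k - d) #>\<^bsub>rgrp R (k - d)\<^esub> r"
    using r ring_quot_simps(3)[OF I r rone_closed] by (simp add: susp_def)
  ultimately show ?thesis using mhomD(4)[OF h' r, of "I 0 #>\<^bsub>rgrp R 0\<^esub> rone R" d] by (simp add: eval_one_def)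
qed

lemma eval_one_killed:
  assumes h: "h \<in> carrier HomI"
  shows "eval_one R I d h \<in> killed M I d"
proof -
  have h': "h \<in> mhom R (susp d (ring_quot R I)) M" using h by (simp add: hom_carrier_iff)
  have c: "eval_one R I d h \<in> carrier (mgrp M d)"
    unfolding eval_one_def by (rule mhomD(2)[OF h']) (simp add: susp_def ring_quot_simps[OF I])
  moreover have "act M p d r (eval_one R I d h) = \<one>\<^bsub>mgrp M (p + d)\<^esub>" if r: "r \<in> I p" for p r
  proof -
    have rc: "r \<in> carrier (rgrp R p)" using gsubmoduleD(2)[OF I r] by (simp add: reg_def)
    have s: "subgroup (I p) (rgrp R p)" using gsubmoduleD(1)[OF I, of p] by (simp add: reg_def)
    have "I p #>\<^bsub>rgrp R p\<^esub> r = I p #>\<^bsub>rgrp R p\<^esub> \<one>\<^bsub>rgrp R p\<^esub>" using r rc by (simp add: rg.coset_eq_iff[OF s])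
    then have "act M p d r (eval_one R I d h) = act M p d \<one>\<^bsub>rgrp R p\<^esub> (eval_one R I d h)"
      using hom_coset[OF h, of r "p + d"] hom_coset[OF h, of "\<one>\<^bsub>rgrp R p\<^esub>" "p + d"] rc by simp
    then show ?thesis using act_zero[OF c] by simp
  qed
  ultimately show ?thesis by (simp add: killed_def)
qed

lemma hom_eqI:
  assumes g: "\<And>k. g k \<in> extensional (carrier (mgrp (ring_quot R I) (k - d)))" and x: "x \<in> killed M I d"
    and eq: "\<And>k r. r \<in> carrier (rgrp R (k - d)) \<Longrightarrow> g k (I (k - d) #>\<^bsub>rgrp R (k - d)\<^esub> r) = act M (k - d) d r x"
  shows "g = hom_of_killed M R I d x"
proof
  fix k show "g k = hom_of_killed M R I d x k"
  proof (rule extensionalityI[OF g])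
    show "hom_of_killed M R I d x k \<in> extensional (carrier (mgrp (ring_quot R I) (k - d)))"
      by (simp add: hom_of_killed_def)
    fix X assume "X \<in> carrier (mgrp (ring_quot R I) (k - d))"
    then obtain r where "r \<in> carrier (rgrp R (k - d))" "X = I (k - d) #>\<^bsub>rgrp R (k - d)\<^esub> r"
      by (auto simp: ring_quot_simps[OF I])
    then show "g k X = hom_of_killed M R I d x k X" by (simp add: eq hom_of_killed_coset[OF x])
  qed
qed

lemma hom_of_killed_eval:
  assumes h: "h \<in> carrier HomI" shows "hom_of_killed M R I d (eval_one R I d h) = h"
  by (rule hom_eqI[symmetric]) (use h eval_one_killed[OF h] hom_coset[OF h] in \<open>auto simp: hom_carrier_iff\<close>)

lemma hom_of_killed_mult:
  assumes x: "x \<in> killed M I d" and y: "y \<in> killed M I d"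
  shows "hom_of_killed M R I d (x \<otimes>\<^bsub>mgrp M d\<^esub> y) = hom_of_killed M R I d x \<otimes>\<^bsub>HomI\<^esub> hom_of_killed M R I d y"
proof (rule hom_eqI[symmetric])
  show "x \<otimes>\<^bsub>mgrp M d\<^esub> y \<in> killed M I d" using subgroup.m_closed[OF killed_subgroup[OF I] x y] .
  fix k show "(hom_of_killed M R I d x \<otimes>\<^bsub>HomI\<^esub> hom_of_killed M R I d y) k \<in> extensional (carrier (mgrp (ring_quot R I) (k - d)))"
    by (simp add: hom_fun_def susp_def)
  fix r assume r: "r \<in> carrier (rgrp R (k - d))"
  have "(hom_of_killed M R I d x \<otimes>\<^bsub>HomI\<^esub> hom_of_killed M R I d y) k (I (k - d) #>\<^bsub>rgrp R (k - d)\<^esub> r) =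
      act M (k - d) d r x \<otimes>\<^bsub>mgrp M k\<^esub> act M (k - d) d r y"
    using r by (simp add: hom_fun_def susp_def hom_of_killed_coset[OF x] hom_of_killed_coset[OF y] ring_quot_simps[OF I])
  then show "(hom_of_killed M R I d x \<otimes>\<^bsub>HomI\<^esub> hom_of_killed M R I d y) k (I (k - d) #>\<^bsub>rgrp R (k - d)\<^esub> r) =
      act M (k - d) d r (x \<otimes>\<^bsub>mgrp M d\<^esub> y)"
    using r x y act_distrib[of r "k - d" x d y] by (simp add: killed_def)
qed

lemma hom_of_killed_one: "hom_of_killed M R I d \<one>\<^bsub>mgrp M d\<^esub> = \<one>\<^bsub>HomI\<^esub>"
proof (rule hom_eqI[symmetric])
  show "\<one>\<^bsub>mgrp M d\<^esub> \<in> killed M I d" using subgroup.one_closed[OF killed_subgroup[OF I]] .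
  fix k show "\<one>\<^bsub>HomI\<^esub> k \<in> extensional (carrier (mgrp (ring_quot R I) (k - d)))"
    by (simp add: hom_fun_def susp_def)
  fix r assume r: "r \<in> carrier (rgrp R (k - d))"
  then show "\<one>\<^bsub>HomI\<^esub> k (I (k - d) #>\<^bsub>rgrp R (k - d)\<^esub> r) = act M (k - d) d r \<one>\<^bsub>mgrp M d\<^esub>"
    using act_one[OF r, of d] by (simp add: hom_fun_def susp_def ring_quot_simps[OF I])
qed

lemma hom_image: "hom_of_killed M R I d ` killed M I d = carrier HomI"
  using hom_of_killed_closed eval_one_killed hom_of_killed_eval by (auto intro!: image_eqI)

text \<open>
  The group structure is transported from the subgroup of elements killed by \<open>I\<close>; this includes that
  the sum of two homomorphisms is again a homomorphism.
\<close>

lemma comm_group_hom: "comm_group HomI"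
proof (rule comm_group_surj_image[where \<pi> = "hom_of_killed M R I d"])
  have s: "subgroup (killed M I d) (mgrp M d)" by (rule killed_subgroup[OF I])
  show "comm_group ((mgrp M d)\<lparr>carrier := killed M I d\<rparr>)"
    using mg.subgroup_imp_group[OF s] subgroup.subset[OF s]
    by (intro group.group_comm_groupI) (auto intro: mg.m_comm)
qed (simp_all add: hom_image hom_of_killed_mult hom_of_killed_one)

lemma eval_one_hom: "eval_one R I d \<in> hom HomI (mgrp M d)"
proof (rule homI)
  show "eval_one R I d h \<in> carrier (mgrp M d)" if "h \<in> carrier HomI" for h
    using eval_one_killed[OF that] by (simp add: killed_def)
  show "eval_one R I d (h \<otimes>\<^bsub>HomI\<^esub> g) = eval_one R I d h \<otimes>\<^bsub>mgrp M d\<^esub> eval_one R I d g"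
    if "h \<in> carrier HomI" "g \<in> carrier HomI" for h g
    using that by (simp add: eval_one_def hom_fun_def susp_def ring_quot_simps[OF I])
qed

lemma eval_one_inj: "inj_on (eval_one R I d) (carrier HomI)"
  using hom_of_killed_eval by (metis inj_onI)

lemma eval_one_image: "eval_one R I d ` carrier HomI = killed M I d"
  using hom_of_killed_closed eval_one_killed eval_hom_of_killed by (auto intro!: image_eqI)

end

text \<open>
  Under evaluation at \<open>1\<close>, restriction along \<open>R/J \<rightarrow> R/I\<close> becomes the inclusion of the elements
  killed by \<open>I\<close> into those killed by \<open>J\<close>.
\<close>

lemma hom_precomp_proj:
  assumes I: "gsubmodule R (reg R) I" and J: "gsubmodule R (reg R) J" and JI: "J \<le> I"
    and h: "h \<in> carrier (fobj (hom_fun R (ring_quot R I)) M d)"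
  shows "hom_precomp (ring_quot R J) (quot_proj R I) d h = hom_of_killed M R J d (eval_one R I d h)"
proof (rule hom_eqI[OF J])
  show "eval_one R I d h \<in> killed M J d" using eval_one_killed[OF I h] killed_antimono[OF JI, of M d] by blast
  show "hom_precomp (ring_quot R J) (quot_proj R I) d h k \<in> extensional (carrier (mgrp (ring_quot R J) (k - d)))" for k
    by (simp add: hom_precomp_def susp_def)
  show "hom_precomp (ring_quot R J) (quot_proj R I) d h k (J (k - d) #>\<^bsub>rgrp R (k - d)\<^esub> r) =
      act M (k - d) d r (eval_one R I d h)" if r: "r \<in> carrier (rgrp R (k - d))" for k r
    using r hom_coset[OF I h r] by (simp add: hom_precomp_def susp_def ring_quot_simps[OF J] quot_proj_coset[OF I J JI])
qed

end

lemma killed_mhom: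
  assumes R: "graded_ring R" and M: "gmodule R M" and N: "gmodule R N" and f: "f \<in> mhom R M N"
    and I: "gsubmodule R (reg R) I" and x: "x \<in> killed M I d"
  shows "f d x \<in> killed N I d"
proof -
  have "act N p d r (f d x) = \<one>\<^bsub>mgrp N (p + d)\<^esub>" if "r \<in> I p" for p r
  proof -
    have "r \<in> carrier (rgrp R p)" using gsubmoduleD(2)[OF I that] by (simp add: reg_def)
    then have "act N p d r (f d x) = f (p + d) (act M p d r x)"
      using mhomD(4)[OF f] x by (simp add: killed_def)
    then show ?thesis using x that mhom_one[OF M N f] by (simp add: killed_def)
  qed
  then show ?thesis using x mhomD(2)[OF f] by (simp add: killed_def)
qed

lemma hom_fun_fmor:
  assumes R: "graded_ring R" and M: "gmodule R M" and N: "gmodule R N" and f: "f \<in> mhom R M N"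
    and I: "gsubmodule R (reg R) I" and h: "h \<in> carrier (fobj (hom_fun R (ring_quot R I)) M d)"
  shows "fmor (hom_fun R (ring_quot R I)) M N f d h = hom_of_killed N R I d (f d (eval_one R I d h))"
proof -
  interpret M: graded_left_module R M using R M by unfold_locales
  interpret N: graded_left_module R N using R N by unfold_locales
  have e: "eval_one R I d h \<in> killed M I d" by (rule M.eval_one_killed[OF I h])
  show ?thesis
  proof (rule N.hom_eqI[OF I])
    show "f d (eval_one R I d h) \<in> killed N I d" by (rule killed_mhom[OF R M N f I e])
    show "fmor (hom_fun R (ring_quot R I)) M N f d h k \<in> extensional (carrier (mgrp (ring_quot R I) (k - d)))" for k
      by (simp add: hom_fun_def susp_def)
    show "fmor (hom_fun R (ring_quot R I)) M N f d h k (I (k - d) #>\<^bsub>rgrp R (k - d)\<^esub> r) =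
        act N (k - d) d r (f d (eval_one R I d h))" if r: "r \<in> carrier (rgrp R (k - d))" for k r
      using r M.hom_coset[OF I h r] mhomD(4)[OF f r, of "eval_one R I d h" d] e
      by (simp add: hom_fun_def susp_def M.ring_quot_simps[OF I] killed_def)
  qed
qed

section \<open>Derived functors of torsion functors\<close>

lemma (in group_hom) subgroup_preimage:
  assumes A: "subgroup A H" shows "subgroup {x \<in> carrier G. h x \<in> A} G"
  by (rule G.subgroupI)
    (auto simp: subgroup.one_closed[OF A] subgroup.m_inv_closed[OF A] subgroup.m_closed[OF A] intro!: exI[of _ "\<one>\<^bsub>G\<^esub>"])

lemma (in group) subgroup_directed_Union:
  assumes ne: "S \<noteq> {}" and dir: "\<And>i j. i \<in> S \<Longrightarrow> j \<in> S \<Longrightarrow> \<exists>k\<in>S. A i \<subseteq> A k \<and> A j \<subseteq> A k"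
    and sub: "\<And>i. i \<in> S \<Longrightarrow> subgroup (A i) G"
  shows "subgroup (\<Union>i\<in>S. A i) G"
proof (rule subgroupI)
  show "(\<Union>i\<in>S. A i) \<subseteq> carrier G" using subgroup.subset[OF sub] by blast
  show "(\<Union>i\<in>S. A i) \<noteq> {}" using ne subgroup.one_closed[OF sub] by blast
  fix a assume "a \<in> (\<Union>i\<in>S. A i)"
  then obtain i where i: "i \<in> S" "a \<in> A i" by blast
  then show "inv a \<in> (\<Union>i\<in>S. A i)" using subgroup.m_inv_closed[OF sub] by blast
  fix b assume "b \<in> (\<Union>i\<in>S. A i)"
  then obtain j where j: "j \<in> S" "b \<in> A j" by blast
  obtain k where k: "k \<in> S" "A i \<subseteq> A k" "A j \<subseteq> A k" using dir i j by blast
  then show "a \<otimes> b \<in> (\<Union>i\<in>S. A i)" using subgroup.m_closed[OF sub[OF k(1)]] i j by blast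
qed

text \<open>
  Modules have their elements in the type \<open>'u\<close>. The set \<open>T\<close> defines the torsion functor \<open>H\<^sup>0\<^sub>T\<close>, while the
  colimits are taken over the directed family \<open>I\<close>. The two are related only through the last
  assumption, so that the same argument serves for the distinguished ideals, indexed by themselves,
  and for the ideals \<open>I\<^sub>j\<close>, indexed by the natural numbers.
\<close>

locale torsion_system = graded_ring_over R for R :: "'r gring" +
  fixes T :: "'r gideal set"
    and S :: "'i set" and r :: "'i \<Rightarrow> 'i \<Rightarrow> bool" and I :: "'i \<Rightarrow> 'r gideal"
  assumes resolution: "\<And>M :: ('r, 'u) gmod. gmodule R M \<Longrightarrow> injective_resolution R M (inj_res R M)"
    and ne: "S \<noteq> {}" and dir: "\<And>i j. i \<in> S \<Longrightarrow> j \<in> S \<Longrightarrow> \<exists>k\<in>S. r i k \<and> r j k"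
    and tr: "\<And>i j k. r i j \<Longrightarrow> r j k \<Longrightarrow> r i k"
    and ideal: "\<And>i. i \<in> S \<Longrightarrow> gsubmodule R (reg R) (I i)"
    and decreasing: "\<And>i j. i \<in> S \<Longrightarrow> j \<in> S \<Longrightarrow> r i j \<Longrightarrow> I j \<le> I i"
    and torsion: "\<And>(M :: ('r, 'u) gmod) d. gmodule R M \<Longrightarrow> H0 R M T d = (\<Union>i\<in>S. killed M (I i) d)"
begin

abbreviation E :: "('r, 'u) gmod \<Rightarrow> nat \<Rightarrow> ('r, 'u) gmod" where "E M \<equiv> res_term (inj_res R M)"
abbreviation \<delta> :: "('r, 'u) gmod \<Rightarrow> nat \<Rightarrow> int \<Rightarrow> 'u \<Rightarrow> 'u" where "\<delta> M \<equiv> diff (inj_res R M)"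
abbreviation torsion_fun :: "('r, 'u, 'u) gfun" where "torsion_fun \<equiv> forget (H0_fun R T)"
abbreviation homs :: "'i \<Rightarrow> ('r, 'u, int \<Rightarrow> 'r set \<Rightarrow> 'u) gfun" where "homs i \<equiv> hom_fun R (ring_quot R (I i))"

text \<open>
  The cocycles and coboundaries of degree \<open>n\<close> that come from the subsets \<open>P\<close> of the term of index \<open>n\<close> and,
  respectively, of the term of index \<open>n - 1\<close> of the resolution, with the conventions for \<open>n < 0\<close> and
  \<open>n \<le> 0\<close> of the general definition. For \<open>P\<close> one takes the torsion submodule or the elements killed by
  an ideal.
\<close>

definition cocycles_in :: "int \<Rightarrow> ('r, 'u) gmod \<Rightarrow> int \<Rightarrow> 'u set \<Rightarrow> 'u set" where
  "cocycles_in n M d P = {x \<in> P. if n < 0 then x = \<one>\<^bsub>mgrp (E M (nat n)) d\<^esub>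
     else \<delta> M (nat n) d x = \<one>\<^bsub>mgrp (E M (Suc (nat n))) d\<^esub>}"

definition coboundaries_of :: "int \<Rightarrow> ('r, 'u) gmod \<Rightarrow> int \<Rightarrow> 'u set \<Rightarrow> 'u set" where
  "coboundaries_of n M d P = (if n \<le> 0 then {\<one>\<^bsub>mgrp (E M (nat n)) d\<^esub>} else \<delta> M (nat (n - 1)) d ` P)"

lemma torsion_subgroup:
  fixes M :: "('r, 'u) gmod"
  assumes M: "gmodule R M" shows "subgroup (H0 R M T d) (mgrp M d)"
proof -
  interpret M: graded_left_module R M using M by unfold_locales
  show ?thesis
    unfolding torsion[OF M]
  proof (rule M.mg.subgroup_directed_Union[OF ne])
    show "\<exists>k\<in>S. killed M (I i) d \<subseteq> killed M (I k) d \<and> killed M (I j) d \<subseteq> killed M (I k) d" if "i \<in> S" "j \<in> S" for i j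
      using dir[OF that] killed_antimono decreasing that by metis
  qed (rule M.killed_subgroup[OF ideal])
qed

lemma torsion_fun_simps:
  "fobj torsion_fun M d = (mgrp M d)\<lparr>carrier := H0 R M T d\<rparr>" "fmor torsion_fun M N f d = f d"
  by (simp_all add: forget_def H0_fun_def submod_def)

lemma nat_shift: "0 < n \<Longrightarrow> nat n = Suc (nat (n - 1))" "0 \<le> n \<Longrightarrow> nat (n + 1) = Suc (nat n)" for n :: int
  by auto

context
  fixes M :: "('r, 'u) gmod" assumes M: "gmodule R M"
begin

\<comment> \<open>Keeps \<open>nat n\<close> intact for negative \<open>n\<close>, so that facts about the term of this index still match.\<close>
declare nat_le_0 [simp del]

lemma resolutionD:
  shows "gmodule R (E M k)" "\<delta> M k \<in> mhom R (E M k) (E M (Suc k))"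
    "y \<in> carrier (mgrp (E M k) n) \<Longrightarrow> \<delta> M (Suc k) n (\<delta> M k n y) = \<one>\<^bsub>mgrp (E M (Suc (Suc k))) n\<^esub>"
  using injective_resolutionD[OF resolution[OF M]] by blast+

lemma comm_group_term: "comm_group (mgrp (E M k) d)"
  using resolutionD(1) by (simp add: gmodule_def ggroup_def)

lemma cocycles_in_subgroup:
  assumes P: "subgroup P (mgrp (E M (nat n)) d)" shows "subgroup (cocycles_in n M d P) (mgrp (E M (nat n)) d)"
proof -
  interpret K: comm_group "mgrp (E M (nat n)) d" by (rule comm_group_term)
  interpret \<delta>: group_hom "mgrp (E M (nat n)) d" "mgrp (E M (Suc (nat n))) d" "\<delta> M (nat n) d"
    by (rule mhom_group_hom) (rule resolutionD)+
  have Pc: "x \<in> carrier (mgrp (E M (nat n)) d)" if "x \<in> P" for x using subgroup.subset[OF P] that by blast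
  show ?thesis
    by (rule K.subgroupI)
      (auto simp: cocycles_in_def Pc subgroup.one_closed[OF P] subgroup.m_inv_closed[OF P] subgroup.m_closed[OF P]
        split: if_splits intro!: exI[of _ "\<one>\<^bsub>mgrp (E M (nat n)) d\<^esub>"])
qed

lemma coboundaries_of_subgroup:
  assumes P: "subgroup P (mgrp (E M (nat (n - 1))) d)" shows "subgroup (coboundaries_of n M d P) (mgrp (E M (nat n)) d)"
proof (cases "n \<le> 0")
  case True
  interpret K: comm_group "mgrp (E M (nat n)) d" by (rule comm_group_term)
  show ?thesis using True K.triv_subgroup by (simp add: coboundaries_of_def)
next
  case False
  then have "group_hom (mgrp (E M (nat (n - 1))) d) (mgrp (E M (nat n)) d) (\<delta> M (nat (n - 1)) d)"
    using resolutionD(2)[of "nat (n - 1)"] nat_shift(1)[of n]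
    by (intro mhom_group_hom[OF resolutionD(1) resolutionD(1)]) simp
  then show ?thesis using False group_hom.subgroup_img_is_subgroup[OF _ P] by (simp add: coboundaries_of_def)
qed

lemma cocycles_in_iff:
  "subgroup P (mgrp (E M (nat n)) d) \<Longrightarrow> cocycles_in n M d P = (if n < 0 then {\<one>\<^bsub>mgrp (E M (nat n)) d\<^esub>}
     else {x \<in> P. \<delta> M (nat n) d x = \<one>\<^bsub>mgrp (E M (Suc (nat n))) d\<^esub>})"
  using subgroup.one_closed[of P] by (auto simp: cocycles_in_def)

lemma torsion_cocycles:
  "cochains R torsion_fun n M d = (mgrp (E M (nat n)) d)\<lparr>carrier := H0 R (E M (nat n)) T d\<rparr>"
  "cocycles R torsion_fun n M d = cocycles_in n M d (H0 R (E M (nat n)) T d)"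
  "coboundaries R torsion_fun n M d = coboundaries_of n M d (H0 R (E M (nat (n - 1))) T d)"
  unfolding cocycles_def coboundaries_def cochains_def coboundary_map_def
  by (auto simp: torsion_fun_simps cocycles_in_iff[OF torsion_subgroup[OF resolutionD(1)]] coboundaries_of_def kernel_def nat_shift)

text \<open>
  Evaluation at \<open>1\<close> carries the complex \<open>hom(R/I\<^sub>i, E)\<close> to the subcomplex of the elements killed by
  \<open>I\<^sub>i\<close>, because it is injective and natural.
\<close>

lemma hom_cocycles:
  assumes i: "i \<in> S"
  shows "cochains R (homs i) n M d = fobj (homs i) (E M (nat n)) d"
    and "cocycles R (homs i) n M d = {h \<in> carrier (fobj (homs i) (E M (nat n)) d).
      eval_one R (I i) d h \<in> cocycles_in n M d (killed (E M (nat n)) (I i) d)}" (is ?Z)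
    and "coboundaries R (homs i) n M d = {h \<in> carrier (fobj (homs i) (E M (nat n)) d).
      eval_one R (I i) d h \<in> coboundaries_of n M d (killed (E M (nat (n - 1))) (I i) d)}" (is ?B)
proof -
  show "cochains R (homs i) n M d = fobj (homs i) (E M (nat n)) d" by (simp add: cochains_def)
  interpret K: graded_left_module R "E M (nat n)" using resolutionD(1) by unfold_locales
  interpret K1: graded_left_module R "E M (Suc (nat n))" using resolutionD(1) by unfold_locales
  interpret K0: graded_left_module R "E M (nat (n - 1))" using resolutionD(1) by unfold_locales
  note id = ideal[OF i]
  interpret G: comm_group "fobj (homs i) (E M (nat n)) d" by (rule K.comm_group_hom[OF id])
  have one: "eval_one R (I i) d \<one>\<^bsub>fobj (homs i) (E M (nat n)) d\<^esub> = \<one>\<^bsub>mgrp (E M (nat n)) d\<^esub>"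
    using hom_one[OF K.eval_one_hom[OF id] G.is_group K.mg.is_group] .
  have one_iff: "h = \<one>\<^bsub>fobj (homs i) (E M (nat n)) d\<^esub> \<longleftrightarrow> eval_one R (I i) d h = \<one>\<^bsub>mgrp (E M (nat n)) d\<^esub>"
    if "h \<in> carrier (fobj (homs i) (E M (nat n)) d)" for h
    using one K.eval_one_inj[OF id] that by (metis G.one_closed inj_onD)
  show ?Z
  proof (cases "n < 0")
    case True
    then show ?thesis
      using one_iff subgroup.one_closed[OF K.killed_subgroup[OF id]]
      by (auto simp: cocycles_def cochains_def cocycles_in_iff[OF K.killed_subgroup[OF id]] one)
  next
    case False
    have "fmor (homs i) (E M (nat n)) (E M (Suc (nat n))) (\<delta> M (nat n)) d h = \<one>\<^bsub>fobj (homs i) (E M (Suc (nat n))) d\<^esub>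
        \<longleftrightarrow> \<delta> M (nat n) d (eval_one R (I i) d h) = \<one>\<^bsub>mgrp (E M (Suc (nat n))) d\<^esub>"
      if h: "h \<in> carrier (fobj (homs i) (E M (nat n)) d)" for h
    proof -
      have "\<delta> M (nat n) d (eval_one R (I i) d h) \<in> killed (E M (Suc (nat n))) (I i) d"
        using killed_mhom[OF graded_ring resolutionD(1) resolutionD(1) resolutionD(2) id K.eval_one_killed[OF id h]] .
      then show ?thesis
        unfolding hom_fun_fmor[OF graded_ring resolutionD(1) resolutionD(1) resolutionD(2) id h]
        using K1.hom_of_killed_one[OF id, of d] K1.eval_hom_of_killed[OF id] subgroup.one_closed[OF K1.killed_subgroup[OF id]]
        by metis
    qed
    then show ?thesis
      using False K.eval_one_killed[OF id]
      by (auto simp: cocycles_def cochains_def coboundary_map_def kernel_def cocycles_in_def nat_shift)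
  qed
  show ?B
  proof (cases "n \<le> 0")
    case True
    then show ?thesis using one_iff one by (auto simp: coboundaries_def cochains_def coboundaries_of_def)
  next
    case False
    then have S: "nat n = Suc (nat (n - 1))" by simp
    have \<delta>: "\<delta> M (nat (n - 1)) \<in> mhom R (E M (nat (n - 1))) (E M (nat n))" using resolutionD(2)[of "nat (n - 1)"] S by simp
    note fm = hom_fun_fmor[OF graded_ring resolutionD(1) resolutionD(1) \<delta> id]
    have "coboundaries R (homs i) n M d = fmor (homs i) (E M (nat (n - 1))) (E M (nat n)) (\<delta> M (nat (n - 1))) d `
        carrier (fobj (homs i) (E M (nat (n - 1))) d)"
      using False S by (simp add: coboundaries_def cochains_def coboundary_map_def)
    also have "\<dots> = (\<lambda>h. hom_of_killed (E M (nat n)) R (I i) d (\<delta> M (nat (n - 1)) d (eval_one R (I i) d h))) `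
        carrier (fobj (homs i) (E M (nat (n - 1))) d)"
      using fm by (intro image_cong) auto
    also have "\<dots> = hom_of_killed (E M (nat n)) R (I i) d ` (\<delta> M (nat (n - 1)) d ` (eval_one R (I i) d `
        carrier (fobj (homs i) (E M (nat (n - 1))) d)))" by (simp add: image_image)
    also have "\<dots> = hom_of_killed (E M (nat n)) R (I i) d ` coboundaries_of n M d (killed (E M (nat (n - 1))) (I i) d)"
      using False by (simp add: K0.eval_one_image[OF id] coboundaries_of_def)
    also have "\<dots> = {h \<in> carrier (fobj (homs i) (E M (nat n)) d).
        eval_one R (I i) d h \<in> coboundaries_of n M d (killed (E M (nat (n - 1))) (I i) d)}"
    proof -
      have sub: "coboundaries_of n M d (killed (E M (nat (n - 1))) (I i) d) \<subseteq> killed (E M (nat n)) (I i) d"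
        using False killed_mhom[OF graded_ring resolutionD(1) resolutionD(1) \<delta> id] by (auto simp: coboundaries_of_def)
      then show ?thesis
        using K.hom_of_killed_closed[OF id] K.eval_hom_of_killed[OF id] K.hom_of_killed_eval[OF id]
        by (force simp: image_iff)
    qed
    finally show ?B .
  qed
qed

lemma eval_image_cocycles:
  assumes i: "i \<in> S"
  shows "eval_one R (I i) d ` cocycles R (homs i) n M d = cocycles_in n M d (killed (E M (nat n)) (I i) d)"
    and "eval_one R (I i) d ` coboundaries R (homs i) n M d = coboundaries_of n M d (killed (E M (nat (n - 1))) (I i) d)"
proof -
  interpret K: graded_left_module R "E M (nat n)" using resolutionD(1) by unfold_locales
  note id = ideal[OF i]
  have im: "A = eval_one R (I i) d ` {h \<in> carrier (fobj (homs i) (E M (nat n)) d). eval_one R (I i) d h \<in> A}"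
    if "A \<subseteq> killed (E M (nat n)) (I i) d" for A
    using that K.eval_one_image[OF id, of d] by (auto simp: image_iff)
  show "eval_one R (I i) d ` cocycles R (homs i) n M d = cocycles_in n M d (killed (E M (nat n)) (I i) d)"
    unfolding hom_cocycles[OF i] by (rule im[symmetric]) (auto simp: cocycles_in_def)
  have "coboundaries_of n M d (killed (E M (nat (n - 1))) (I i) d) \<subseteq> killed (E M (nat n)) (I i) d"
  proof (cases "n \<le> 0")
    case True
    then show ?thesis using subgroup.one_closed[OF K.killed_subgroup[OF id]] by (simp add: coboundaries_of_def)
  next
    case False
    then have "\<delta> M (nat (n - 1)) \<in> mhom R (E M (nat (n - 1))) (E M (nat n))" using resolutionD(2)[of "nat (n - 1)"] nat_shift(1)[of n] by simp
    from killed_mhom[OF graded_ring resolutionD(1) resolutionD(1) this id] False show ?thesis by (auto simp: coboundaries_of_def)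
  qed
  then show "eval_one R (I i) d ` coboundaries R (homs i) n M d = coboundaries_of n M d (killed (E M (nat (n - 1))) (I i) d)"
    unfolding hom_cocycles[OF i] by (rule im[symmetric])
qed

lemma cocycles_in_Union: "cocycles_in n M d (\<Union>i\<in>S. A i) = (\<Union>i\<in>S. cocycles_in n M d (A i))"
  by (auto simp: cocycles_in_def)

lemma coboundaries_of_Union: "coboundaries_of n M d (\<Union>i\<in>S. A i) = (\<Union>i\<in>S. coboundaries_of n M d (A i))"
  using ne by (auto simp: coboundaries_of_def)

lemma cocycles_in_mono: "P \<subseteq> P' \<Longrightarrow> cocycles_in n M d P \<subseteq> cocycles_in n M d P'" by (auto simp: cocycles_in_def)

lemma coboundaries_of_mono: "P \<subseteq> P' \<Longrightarrow> coboundaries_of n M d P \<subseteq> coboundaries_of n M d P'" by (auto simp: coboundaries_of_def)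

lemma coboundaries_subset_cocycles:
  assumes "P' \<subseteq> carrier (mgrp (E M (nat (n - 1))) d)" "coboundaries_of n M d P' \<subseteq> P"
  shows "coboundaries_of n M d P' \<subseteq> cocycles_in n M d P"
proof
  fix x assume x: "x \<in> coboundaries_of n M d P'"
  show "x \<in> cocycles_in n M d P"
  proof (cases "n \<le> 0")
    case True
    have "\<delta> M (nat n) d \<one>\<^bsub>mgrp (E M (nat n)) d\<^esub> = \<one>\<^bsub>mgrp (E M (Suc (nat n))) d\<^esub>"
      by (rule mhom_one) (rule resolutionD)+
    then show ?thesis using True x assms by (auto simp: coboundaries_of_def cocycles_in_def)
  next
    case False
    then obtain y where y: "y \<in> P'" "x = \<delta> M (nat (n - 1)) d y" using x by (auto simp: coboundaries_of_def)
    then have "\<delta> M (nat n) d x = \<one>\<^bsub>mgrp (E M (Suc (nat n))) d\<^esub>"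
      using resolutionD(3)[of y "nat (n - 1)" d] assms(1) nat_shift(1)[of n] False by auto
    then show ?thesis using False x assms by (auto simp: cocycles_in_def)
  qed
qed

lemma coboundaries_of_torsion: "coboundaries_of n M d (H0 R (E M (nat (n - 1))) T d) \<subseteq> H0 R (E M (nat n)) T d"
proof -
  have "coboundaries_of n M d (killed (E M (nat (n - 1))) (I i) d) \<subseteq> killed (E M (nat n)) (I i) d" if i: "i \<in> S" for i
  proof -
    interpret K: graded_left_module R "E M (nat n)" using resolutionD(1) by unfold_locales
    show ?thesis
    proof
      fix x assume "x \<in> coboundaries_of n M d (killed (E M (nat (n - 1))) (I i) d)"
      then obtain h where "x = eval_one R (I i) d h" "h \<in> coboundaries R (homs i) n M d"
        unfolding eval_image_cocycles(2)[OF i, symmetric] by blast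
      then show "x \<in> killed (E M (nat n)) (I i) d"
        using K.eval_one_killed[OF ideal[OF i]] by (simp add: hom_cocycles[OF i])
    qed
  qed
  then show ?thesis unfolding torsion[OF resolutionD(1)] coboundaries_of_Union by blast
qed

abbreviation "LC n d \<equiv> fobj (rderived R n torsion_fun) M d"
abbreviation "ExtI n i d \<equiv> fobj (Ext_fun R n (ring_quot R (I i))) M d"
abbreviation "res n i j d \<equiv> Ext_restrict R n (ring_quot R (I j)) (quot_proj R (I i)) M d"
abbreviation "cmp_map n i d \<equiv> coset_map (mgrp (E M (nat n)) d) (coboundaries R torsion_fun n M d) (eval_one R (I i) d)"

text \<open>
  The torsion subcomplex is the union of the subcomplexes killed by the ideals \<open>I\<^sub>i\<close>, which are the images of
  the complexes \<open>hom(R/I\<^sub>i, E)\<close> under evaluation at \<open>1\<close>.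
\<close>

lemma comparison:
  shows "(\<lambda>h. {(i, X). i \<in> S \<and> X \<in> carrier (ExtI n i d) \<and> cmp_map n i d X = h}) \<in> iso (LC n d)
      (colim_grp S r (\<lambda>i. ExtI n i d) (\<lambda>i j. res n i j d))"
    and "i \<in> S \<Longrightarrow> X \<in> carrier (ExtI n i d) \<Longrightarrow>
      colim_class S r (\<lambda>i. ExtI n i d) (\<lambda>i j. res n i j d) i X =
        {(j, Y). j \<in> S \<and> Y \<in> carrier (ExtI n j d) \<and> cmp_map n j d Y = cmp_map n i d X}"
    and "i \<in> S \<Longrightarrow> h \<in> cocycles R (homs i) n M d \<Longrightarrow>
      cmp_map n i d (coboundaries R (homs i) n M d #>\<^bsub>cochains R (homs i) n M d\<^esub> h) =
      coboundaries R torsion_fun n M d #>\<^bsub>mgrp (E M (nat n)) d\<^esub> eval_one R (I i) d h"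
proof -
  let ?K = "mgrp (E M (nat n)) d"
  let ?Z = "cocycles R torsion_fun n M d" and ?B = "coboundaries R torsion_fun n M d"
  let ?Zi = "\<lambda>i. cocycles R (homs i) n M d" and ?Bi = "\<lambda>i. coboundaries R (homs i) n M d"
  let ?G = "\<lambda>i. fobj (homs i) (E M (nat n)) d"
  let ?t = "\<lambda>i j. hom_precomp (ring_quot R (I j)) (quot_proj R (I i)) d"
  interpret K: graded_left_module R "E M (nat n)" using resolutionD(1) by unfold_locales
  interpret K0: graded_left_module R "E M (nat (n - 1))" using resolutionD(1) by unfold_locales
  have gh: "group_hom (?G i) ?K (eval_one R (I i) d)" if "i \<in> S" for i
    using K.comm_group_hom[OF ideal[OF that]] K.eval_one_hom[OF ideal[OF that]]
    by (simp add: group_hom_def group_hom_axioms_def comm_group_def)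
  have pre: "?t i k h = hom_of_killed (E M (nat n)) R (I k) d (eval_one R (I i) d h)"
    "eval_one R (I i) d h \<in> killed (E M (nat n)) (I k) d"
    if "i \<in> S" "k \<in> S" "r i k" "h \<in> carrier (?G i)" for i k h
    using that K.hom_precomp_proj[OF ideal ideal decreasing] K.eval_one_killed[OF ideal]
      killed_antimono[OF decreasing, of i k "E M (nat n)" d] by auto
  have evt: "eval_one R (I k) d (?t i k h) = eval_one R (I i) d h" "?t i k h \<in> carrier (?G k)"
    if "i \<in> S" "k \<in> S" "r i k" "h \<in> carrier (?G i)" for i k h
    using pre[OF that] K.eval_hom_of_killed[OF ideal[OF that(2)]] K.hom_of_killed_closed[OF ideal[OF that(2)]] by simp_all
  have c1: "comm_group ?K" by (rule comm_group_term)
  have c2: "subgroup ?Z ?K" unfolding torsion_cocycles by (rule cocycles_in_subgroup[OF torsion_subgroup[OF resolutionD(1)]])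
  have c3: "subgroup ?B ?K" unfolding torsion_cocycles by (rule coboundaries_of_subgroup[OF torsion_subgroup[OF resolutionD(1)]])
  have c4: "?B \<subseteq> ?Z" unfolding torsion_cocycles
    by (rule coboundaries_subset_cocycles[OF subgroup.subset[OF torsion_subgroup[OF resolutionD(1)]] coboundaries_of_torsion])
  have c5: "comm_group (?G i)" if "i \<in> S" for i by (rule K.comm_group_hom[OF ideal[OF that]])
  have c6: "subgroup (?Zi i) (?G i)" if "i \<in> S" for i unfolding hom_cocycles[OF that]
    by (rule group_hom.subgroup_preimage[OF gh[OF that] cocycles_in_subgroup[OF K.killed_subgroup[OF ideal[OF that]]]])
  have c7: "subgroup (?Bi i) (?G i)" if "i \<in> S" for i unfolding hom_cocycles[OF that]
    by (rule group_hom.subgroup_preimage[OF gh[OF that] coboundaries_of_subgroup[OF K0.killed_subgroup[OF ideal[OF that]]]])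
  have c8: "eval_one R (I i) d \<in> hom (?G i) ?K" "inj_on (eval_one R (I i) d) (carrier (?G i))" if "i \<in> S" for i
    using K.eval_one_hom[OF ideal[OF that]] K.eval_one_inj[OF ideal[OF that]] by auto
  have c9: "?t i k \<in> hom (?G i) (?G k)" if ik: "i \<in> S" "k \<in> S" "r i k" for i k
  proof (rule homI)
    fix h g assume h: "h \<in> carrier (?G i)"
    show "?t i k h \<in> carrier (?G k)" using evt(2)[OF ik h] .
    assume g: "g \<in> carrier (?G i)"
    interpret G: comm_group "?G i" by (rule c5[OF ik(1)])
    show "?t i k (h \<otimes>\<^bsub>?G i\<^esub> g) = ?t i k h \<otimes>\<^bsub>?G k\<^esub> ?t i k g"
      using pre[OF ik h] pre[OF ik g] pre[OF ik, of "h \<otimes>\<^bsub>?G i\<^esub> g"] h g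
        hom_mult[OF c8(1)[OF ik(1)] h g] K.hom_of_killed_mult[OF ideal[OF ik(2)]] by simp
  qed
  have c10: "?t i k h \<in> ?Zi k" if ik: "i \<in> S" "k \<in> S" "r i k" and h: "h \<in> ?Zi i" for i k h
    using h evt[OF ik, of h] subsetD[OF cocycles_in_mono[OF killed_antimono[OF decreasing[OF ik]]]]
    by (simp add: hom_cocycles ik)
  have c11: "?t i k h \<in> ?Bi k" if ik: "i \<in> S" "k \<in> S" "r i k" and h: "h \<in> ?Bi i" for i k h
    using h evt[OF ik, of h] subsetD[OF coboundaries_of_mono[OF killed_antimono[OF decreasing[OF ik]]]]
    by (simp add: hom_cocycles ik)
  have c12: "?Z = (\<Union>i\<in>S. eval_one R (I i) d ` ?Zi i)"
    by (simp add: torsion_cocycles torsion[OF resolutionD(1)] cocycles_in_Union eval_image_cocycles)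
  have c13: "?B = (\<Union>i\<in>S. eval_one R (I i) d ` ?Bi i)"
    by (simp add: torsion_cocycles torsion[OF resolutionD(1)] coboundaries_of_Union eval_image_cocycles)
  note main = colim_subquotient[where S = S and r = r and G = ?G and H = ?K and Z = ?Z and B = ?B and Zi = ?Zi and Bi = ?Bi
      and t = ?t and ev = "\<lambda>i. eval_one R (I i) d", OF ne dir tr c1 c2 c3 c4 c5 c6 c7 c8(1) c8(2) c9 evt(1) c10 c11 c12 c13]
  have LC: "LC n d = ?K\<lparr>carrier := ?Z\<rparr> Mod ?B" by (simp add: rderived_def torsion_cocycles)
  have ExtI: "ExtI n i d = (?G i)\<lparr>carrier := ?Zi i\<rparr> Mod ?Bi i" for i by (simp add: Ext_fun_def rderived_def cochains_def)
  have res: "res n i k d = coset_map (?G k) (?Bi k) (?t i k)" for i k by (simp add: Ext_restrict_def cochains_def)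
  show "(\<lambda>h. {(i, X). i \<in> S \<and> X \<in> carrier (ExtI n i d) \<and> cmp_map n i d X = h}) \<in> iso (LC n d)
      (colim_grp S r (\<lambda>i. ExtI n i d) (\<lambda>i j. res n i j d))"
    unfolding LC ExtI res by (rule main(1))
  show "i \<in> S \<Longrightarrow> X \<in> carrier (ExtI n i d) \<Longrightarrow>
      colim_class S r (\<lambda>i. ExtI n i d) (\<lambda>i j. res n i j d) i X =
        {(j, Y). j \<in> S \<and> Y \<in> carrier (ExtI n j d) \<and> cmp_map n j d Y = cmp_map n i d X}"
    unfolding ExtI res by (rule main(2))
  show "i \<in> S \<Longrightarrow> h \<in> cocycles R (homs i) n M d \<Longrightarrow>
      cmp_map n i d (coboundaries R (homs i) n M d #>\<^bsub>cochains R (homs i) n M d\<^esub> h) =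
      coboundaries R torsion_fun n M d #>\<^bsub>mgrp (E M (nat n)) d\<^esub> eval_one R (I i) d h"
    unfolding cochains_def by (rule main(3))
qed

end

lemma comparison_natural:
  fixes M N :: "('r, 'u) gmod"
  assumes M: "gmodule R M" and N: "gmodule R N" and f: "f \<in> mhom R M N"
    and i: "i \<in> S" and X: "X \<in> carrier (fobj (Ext_fun R n (ring_quot R (I i))) M d)"
  shows "fmor (Ext_fun R n (ring_quot R (I i))) M N f d X \<in> carrier (fobj (Ext_fun R n (ring_quot R (I i))) N d)"
    and "cmp_map N n i d (fmor (Ext_fun R n (ring_quot R (I i))) M N f d X) =
      fmor (rderived R n torsion_fun) M N f d (cmp_map M n i d X)"
proof -
  define \<phi> where "\<phi> k = inj_res_map R M N f k" for k
  let ?KM = "E M (nat n)" and ?KN = "E N (nat n)"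
  note rM = resolutionD[OF M] and rN = resolutionD[OF N]
  note id = ideal[OF i]
  interpret KM: graded_left_module R ?KM using rM(1) by unfold_locales
  interpret KN: graded_left_module R ?KN using rN(1) by unfold_locales
  interpret KM0: graded_left_module R "E M (nat (n - 1))" using rM(1) by unfold_locales
  interpret KN0: graded_left_module R "E N (nat (n - 1))" using rN(1) by unfold_locales
  have \<phi>: "\<phi> k \<in> mhom R (E M k) (E N k)"
    "x \<in> carrier (mgrp (E M k) m) \<Longrightarrow> \<phi> (Suc k) m (\<delta> M k m x) = \<delta> N k m (\<phi> k m x)" for k m x
    unfolding \<phi>_def using inj_res_map[OF graded_ring M N f resolution[OF M] resolution[OF N]] by blast+
  let ?G = "\<lambda>M. fobj (homs i) (E M (nat n)) d"
  let ?Z = "\<lambda>M. cocycles R (homs i) n M d" and ?B = "\<lambda>M. coboundaries R (homs i) n M d"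
  let ?ev = "eval_one R (I i) d"
  let ?fm = "fmor (homs i) ?KM ?KN (\<phi> (nat n)) d"
  have fm: "?fm h = hom_of_killed ?KN R (I i) d (\<phi> (nat n) d (?ev h))" if "h \<in> carrier (?G M)" for h
    using hom_fun_fmor[OF graded_ring rM(1) rN(1) \<phi>(1) id that] .
  have kN: "\<phi> (nat n) d x \<in> killed ?KN (I i) d" if "x \<in> killed ?KM (I i) d" for x
    using killed_mhom[OF graded_ring rM(1) rN(1) \<phi>(1) id that] .
  have fmc: "?fm h \<in> carrier (?G N)" "?ev (?fm h) = \<phi> (nat n) d (?ev h)" if h: "h \<in> carrier (?G M)" for h
    using fm[OF h] KN.hom_of_killed_closed[OF id] KN.eval_hom_of_killed[OF id] kN[OF KM.eval_one_killed[OF id h]] by simp_all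
  have one: "\<phi> k m \<one>\<^bsub>mgrp (E M k) m\<^esub> = \<one>\<^bsub>mgrp (E N k) m\<^esub>" for k m
    by (rule mhom_one[OF rM(1) rN(1) \<phi>(1)])
  have cyc: "\<phi> (nat n) d x \<in> cocycles_in n N d P'"
    if x: "x \<in> cocycles_in n M d P" and P: "P \<subseteq> carrier (mgrp ?KM d)" "\<And>x. x \<in> P \<Longrightarrow> \<phi> (nat n) d x \<in> P'" for x P P'
  proof (cases "n < 0")
    case True
    then show ?thesis using x P(2)[of x] one[of "nat n" d] by (auto simp: cocycles_in_def)
  next
    case False
    then have x': "x \<in> P" "\<delta> M (nat n) d x = \<one>\<^bsub>mgrp (E M (Suc (nat n))) d\<^esub>" using x by (simp_all add: cocycles_in_def)
    then have "\<delta> N (nat n) d (\<phi> (nat n) d x) = \<one>\<^bsub>mgrp (E N (Suc (nat n))) d\<^esub>"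
      using \<phi>(2)[of x "nat n" d] P one by auto
    then show ?thesis using False x' P by (simp add: cocycles_in_def)
  qed
  have bnd: "\<phi> (nat n) d x \<in> coboundaries_of n N d P'"
    if x: "x \<in> coboundaries_of n M d P" and P: "P \<subseteq> carrier (mgrp (E M (nat (n - 1))) d)"
      "\<And>x. x \<in> P \<Longrightarrow> \<phi> (nat (n - 1)) d x \<in> P'" for x P P'
  proof (cases "n \<le> 0")
    case True
    then show ?thesis using x one[of "nat n" d] by (simp add: coboundaries_of_def)
  next
    case False
    then obtain y where y: "y \<in> P" "x = \<delta> M (nat (n - 1)) d y" using x by (auto simp: coboundaries_of_def)
    then have "\<phi> (nat n) d x = \<delta> N (nat (n - 1)) d (\<phi> (nat (n - 1)) d y)"
      using \<phi>(2)[of y "nat (n - 1)" d] P nat_shift(1)[of n] False by auto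
    then show ?thesis using False y P by (auto simp: coboundaries_of_def)
  qed
  have fmZ: "?fm h \<in> ?Z N" if h: "h \<in> ?Z M" for h
  proof -
    have h': "h \<in> carrier (?G M)" "?ev h \<in> cocycles_in n M d (killed ?KM (I i) d)" using h by (simp_all add: hom_cocycles[OF M i])
    have "\<phi> (nat n) d (?ev h) \<in> cocycles_in n N d (killed ?KN (I i) d)"
      using cyc[OF h'(2)] kN by (simp add: killed_def)
    then show ?thesis using fmc[OF h'(1)] by (simp add: hom_cocycles[OF N i])
  qed
  have fmB: "?fm h \<in> ?B N" if h: "h \<in> ?B M" for h
  proof -
    have h': "h \<in> carrier (?G M)" "?ev h \<in> coboundaries_of n M d (killed (E M (nat (n - 1))) (I i) d)" using h by (simp_all add: hom_cocycles[OF M i])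
    have "\<phi> (nat n) d (?ev h) \<in> coboundaries_of n N d (killed (E N (nat (n - 1))) (I i) d)"
      using bnd[OF h'(2)] killed_mhom[OF graded_ring rM(1) rN(1) \<phi>(1) id] by (simp add: killed_def)
    then show ?thesis using fmc[OF h'(1)] by (simp add: hom_cocycles[OF N i])
  qed
  have fm_hom: "?fm \<in> hom (?G M) (?G N)"
  proof (rule homI)
    fix h g assume h: "h \<in> carrier (?G M)"
    show "?fm h \<in> carrier (?G N)" by (rule fmc(1)[OF h])
    assume g: "g \<in> carrier (?G M)"
    interpret G: comm_group "?G M" by (rule KM.comm_group_hom[OF id])
    note e = KM.eval_one_killed[OF id]
    have c: "?ev h \<in> carrier (mgrp ?KM d)" "?ev g \<in> carrier (mgrp ?KM d)" using e[OF h] e[OF g] by (simp_all add: killed_def)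
    show "?fm (h \<otimes>\<^bsub>?G M\<^esub> g) = ?fm h \<otimes>\<^bsub>?G N\<^esub> ?fm g"
      using fm[OF h] fm[OF g] fm[OF G.m_closed[OF h g]] hom_mult[OF KM.eval_one_hom[OF id] h g]
        mhomD(3)[OF \<phi>(1) c] KN.hom_of_killed_mult[OF id kN[OF e[OF h]] kN[OF e[OF g]]] by simp
  qed
  have subB: "subgroup (?B M) (?G M)" if M: "gmodule R M" for M
  proof -
    interpret K: graded_left_module R "E M (nat n)" using resolutionD(1)[OF M] by unfold_locales
    interpret K0: graded_left_module R "E M (nat (n - 1))" using resolutionD(1)[OF M] by unfold_locales
    have "group_hom (?G M) (mgrp (E M (nat n)) d) ?ev"
      using K.comm_group_hom[OF id] K.eval_one_hom[OF id] by (simp add: group_hom_def group_hom_axioms_def comm_group_def)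
    then show ?thesis unfolding hom_cocycles[OF M i]
      by (rule group_hom.subgroup_preimage[OF _ coboundaries_of_subgroup[OF M K0.killed_subgroup[OF id]]])
  qed
  obtain h where h: "h \<in> ?Z M" "X = ?B M #>\<^bsub>?G M\<^esub> h"
    using X by (auto simp: Ext_fun_def rderived_def subquotient_carrier cochains_def)
  have hc: "h \<in> carrier (?G M)" using h by (simp add: hom_cocycles[OF M i])
  have fX: "fmor (Ext_fun R n (ring_quot R (I i))) M N f d X = ?B N #>\<^bsub>?G N\<^esub> ?fm h"
    unfolding h(2) Ext_fun_def rderived_def cochains_def gfun.simps \<phi>_def[symmetric]
    by (rule coset_map_coset[OF KM.comm_group_hom[OF id] KN.comm_group_hom[OF id] fm_hom subB[OF M] subB[OF N] _ hc])
      (use fmB in blast)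
  show "fmor (Ext_fun R n (ring_quot R (I i))) M N f d X \<in> carrier (fobj (Ext_fun R n (ring_quot R (I i))) N d)"
    unfolding fX using fmZ[OF h(1)] by (simp add: Ext_fun_def rderived_def subquotient_carrier cochains_def)
  let ?BM = "coboundaries R torsion_fun n M d" and ?BN = "coboundaries R torsion_fun n N d"
  have cX: "cmp_map M n i d X = ?BM #>\<^bsub>mgrp ?KM d\<^esub> ?ev h"
    using comparison(3)[OF M i h(1)] h(2) by (simp add: cochains_def)
  have "cmp_map N n i d (fmor (Ext_fun R n (ring_quot R (I i))) M N f d X) = ?BN #>\<^bsub>mgrp ?KN d\<^esub> ?ev (?fm h)"
    using comparison(3)[OF N i fmZ[OF h(1)]] by (simp add: fX cochains_def)
  also have "\<dots> = ?BN #>\<^bsub>mgrp ?KN d\<^esub> \<phi> (nat n) d (?ev h)" by (simp add: fmc(2)[OF hc])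
  also have "\<dots> = coset_map (mgrp ?KN d) ?BN (\<phi> (nat n) d) (?BM #>\<^bsub>mgrp ?KM d\<^esub> ?ev h)"
  proof (rule coset_map_coset[symmetric])
    show "subgroup ?BM (mgrp ?KM d)" "subgroup ?BN (mgrp ?KN d)"
      unfolding torsion_cocycles[OF M] torsion_cocycles[OF N]
      by (rule coboundaries_of_subgroup[OF M torsion_subgroup[OF rM(1)]] coboundaries_of_subgroup[OF N torsion_subgroup[OF rN(1)]])+
    have "\<phi> (nat (n - 1)) d x \<in> H0 R (E N (nat (n - 1))) T d" if "x \<in> H0 R (E M (nat (n - 1))) T d" for x
      using that killed_mhom[OF graded_ring rM(1) rN(1) \<phi>(1) ideal] unfolding torsion[OF rM(1)] torsion[OF rN(1)] by blast
    then show "\<phi> (nat n) d ` ?BM \<subseteq> ?BN"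
      unfolding torsion_cocycles[OF M] torsion_cocycles[OF N]
      using bnd[OF _ subgroup.subset[OF torsion_subgroup[OF rM(1)]]] by blast
    show "?ev h \<in> carrier (mgrp ?KM d)" using KM.eval_one_killed[OF id hc] by (simp add: killed_def)
  qed (use comm_group_term M N mhomD(1)[OF \<phi>(1)] in auto)
  also have "\<dots> = fmor (rderived R n torsion_fun) M N f d (cmp_map M n i d X)"
    unfolding cX by (simp add: rderived_def torsion_cocycles(1)[OF N] torsion_fun_simps \<phi>_def coset_map_def r_coset_def)
  finally show "cmp_map N n i d (fmor (Ext_fun R n (ring_quot R (I i))) M N f d X) =
      fmor (rderived R n torsion_fun) M N f d (cmp_map M n i d X)" .
qed

theorem derived_torsion_colim_Ext:
  "nat_isomorphic R (rderived R n torsion_fun) (colim_Ext R n S r I)"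
proof -
  define \<theta> where "\<theta> M d c = {(i, X). i \<in> S \<and> X \<in> carrier (fobj (Ext_fun R n (ring_quot R (I i))) M d) \<and> cmp_map M n i d X = c}"
    for M d c
  show ?thesis
    unfolding nat_isomorphic_def
  proof (intro exI[of _ \<theta>] conjI allI impI ballI)
    fix M :: "('r, 'u) gmod" assume M: "gmodule R M"
    show "\<theta> M \<in> giso (fobj (rderived R n torsion_fun) M) (fobj (colim_Ext R n S r I) M)"
      unfolding giso_def colim_Ext_def colim_fun_def gfun.simps
      using comparison(1)[OF M, where n = n] unfolding \<theta>_def[abs_def] by blast
  next
    fix M N :: "('r, 'u) gmod" and f d c
    assume "gmodule R M \<and> gmodule R N \<and> f \<in> mhom R M N"
    then have M: "gmodule R M" and N: "gmodule R N" and f: "f \<in> mhom R M N" by auto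
    assume c: "c \<in> carrier (fobj (rderived R n torsion_fun) M d)"
    let ?F = "fmor (rderived R n torsion_fun) M N f d"
    let ?cl = "\<lambda>i Y. colim_class S r (\<lambda>i. fobj (Ext_fun R n (ring_quot R (I i))) N d)
      (\<lambda>i j. Ext_restrict R n (ring_quot R (I j)) (quot_proj R (I i)) N d) i Y"
    have each: "?cl i (fmor (Ext_fun R n (ring_quot R (I i))) M N f d X) = \<theta> N d (?F c)" if "(i, X) \<in> \<theta> M d c" for i X
    proof -
      have i: "i \<in> S" "X \<in> carrier (fobj (Ext_fun R n (ring_quot R (I i))) M d)" "cmp_map M n i d X = c"
        using that by (auto simp: \<theta>_def)
      show ?thesis
        using comparison(2)[OF N i(1) comparison_natural(1)[OF M N f i(1,2)]] comparison_natural(2)[OF M N f i(1,2)] i(3)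
        by (simp add: \<theta>_def)
    qed
    have "\<theta> M d c \<in> carrier (colim_grp S r (\<lambda>i. fobj (Ext_fun R n (ring_quot R (I i))) M d)
        (\<lambda>i j. Ext_restrict R n (ring_quot R (I j)) (quot_proj R (I i)) M d))"
      using comparison(1)[OF M, where n = n and d = d] c unfolding \<theta>_def by (auto simp: iso_def hom_def)
    then obtain i X where iX: "i \<in> S" "X \<in> carrier (fobj (Ext_fun R n (ring_quot R (I i))) M d)"
      "\<theta> M d c = colim_class S r (\<lambda>i. fobj (Ext_fun R n (ring_quot R (I i))) M d)
        (\<lambda>i j. Ext_restrict R n (ring_quot R (I j)) (quot_proj R (I i)) M d) i X"
      by (auto simp: colim_grp_def)
    then have "(i, X) \<in> \<theta> M d c" by (simp add: comparison(2)[OF M])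
    then have "(\<Union>(i, X)\<in>\<theta> M d c. ?cl i (fmor (Ext_fun R n (ring_quot R (I i))) M N f d X)) = \<theta> N d (?F c)"
      using each by fastforce
    then show "\<theta> N d (?F c) = fmor (colim_Ext R n S r I) M N f d (\<theta> M d c)"
      by (simp add: colim_Ext_def colim_fun_def)
  qed
qed

end

section \<open>Evaluation of formal tensors\<close>

context abelian_monoid
begin

lemma lsum_Nil [simp]: "lsum G [] = \<zero>" and lsum_Cons [simp]: "lsum G (x # xs) = x \<oplus> lsum G xs"
  by (simp_all add: lsum_def)

lemma lsum_closed [simp]: "set xs \<subseteq> carrier G \<Longrightarrow> lsum G xs \<in> carrier G"
  by (induction xs) auto

lemma lsum_append: "set xs \<subseteq> carrier G \<Longrightarrow> set ys \<subseteq> carrier G \<Longrightarrow> lsum G (xs @ ys) = lsum G xs \<oplus> lsum G ys"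
  by (induction xs) (auto simp: a_assoc)

lemma lsum_concat_map:
  "(\<And>x. x \<in> set xs \<Longrightarrow> set (F x) \<subseteq> carrier G) \<Longrightarrow>
    lsum G (concat (map F xs)) = lsum G (map (\<lambda>x. lsum G (F x)) xs)"
proof (induction xs)
  case (Cons x xs)
  have "set (concat (map F xs)) \<subseteq> carrier G" using Cons.prems by auto
  then show ?case using Cons by (simp add: lsum_append)
qed simp

lemma lsum_add:
  "(\<And>x. x \<in> set xs \<Longrightarrow> f x \<in> carrier G) \<Longrightarrow> (\<And>x. x \<in> set xs \<Longrightarrow> g x \<in> carrier G) \<Longrightarrow>
    lsum G (map (\<lambda>x. f x \<oplus> g x) xs) = lsum G (map f xs) \<oplus> lsum G (map g xs)"
proof (induction xs)
  case (Cons x xs)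
  have "lsum G (map f xs) \<in> carrier G" "lsum G (map g xs) \<in> carrier G"
    using Cons.prems by (auto intro!: lsum_closed)
  then show ?case using Cons by (simp add: a_ac)
qed simp

lemma lsum_hom:
  assumes "h \<zero> = zero W" "\<And>x y. x \<in> carrier G \<Longrightarrow> y \<in> carrier G \<Longrightarrow> h (x \<oplus> y) = add W (h x) (h y)"
  shows "set xs \<subseteq> carrier G \<Longrightarrow> h (lsum G xs) = lsum W (map h xs)"
  by (induction xs) (auto simp: assms lsum_def[of W])

text \<open>
  A map from symbols to an abelian monoid that respects the generating relations is well defined on
  formal sums up to the congruence.
\<close>

lemma fsum_eq_lsum:
  assumes E: "\<And>w. E w \<in> carrier G" and gen: "\<And>s t. (s, t) \<in> Q \<Longrightarrow> lsum G (map E s) = lsum G (map E t)"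
  shows "fsum_eq Q s t \<Longrightarrow> lsum G (map E s) = lsum G (map E t)"
proof (induction rule: fsum_eq.induct)
  case (app s s' t t')
  then show ?case using E by (simp add: lsum_append image_subset_iff)
next
  case (comm s t)
  have "lsum G (map E s) \<in> carrier G" "lsum G (map E t) \<in> carrier G" using E by (auto intro!: lsum_closed)
  then show ?case using E by (simp add: lsum_append image_subset_iff a_comm)
qed (simp_all add: gen)

end

lemma word_cases: obtains "u = []" | a where "u = [a]" | a b where "u = [a, b]" | a b c u' where "u = a # b # c # u'"
  by (metis list.exhaust)

locale coalgebra_over_field = field A for A :: "'a ring" (structure) +
  fixes C :: "('a, 'v) gcoalg"
  assumes coalgebra: "gcoalgebra A C"
begin

abbreviation V :: "int \<Rightarrow> ('a, 'v) module" where "V \<equiv> cvec C"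

sublocale V: module A "V n" for n using coalgebra by (simp add: gcoalgebra_def)

text \<open>
  The universal property of \<open>V \<otimes> V\<close> for formal tensors. Words of length other than two are sent to zero, as
  the relations also involve those.
\<close>

lemma lsum_bilinear:
  fixes W :: "('w, 'k) ring_scheme" (structure)
  assumes W: "abelian_monoid W"
    and cl: "\<And>i j a b. a \<in> carrier (V i) \<Longrightarrow> b \<in> carrier (V j) \<Longrightarrow> \<beta> i j a b \<in> carrier W"
    and add1: "\<And>i j a a' b. a \<in> carrier (V i) \<Longrightarrow> a' \<in> carrier (V i) \<Longrightarrow> b \<in> carrier (V j) \<Longrightarrow>
      \<beta> i j (a \<oplus>\<^bsub>V i\<^esub> a') b = \<beta> i j a b \<oplus>\<^bsub>W\<^esub> \<beta> i j a' b"
    and add2: "\<And>i j a b b'. a \<in> carrier (V i) \<Longrightarrow> b \<in> carrier (V j) \<Longrightarrow> b' \<in> carrier (V j) \<Longrightarrow>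
      \<beta> i j a (b \<oplus>\<^bsub>V j\<^esub> b') = \<beta> i j a b \<oplus>\<^bsub>W\<^esub> \<beta> i j a b'"
    and zero1: "\<And>i j b. b \<in> carrier (V j) \<Longrightarrow> \<beta> i j \<zero>\<^bsub>V i\<^esub> b = \<zero>\<^bsub>W\<^esub>"
    and zero2: "\<And>i j a. a \<in> carrier (V i) \<Longrightarrow> \<beta> i j a \<zero>\<^bsub>V j\<^esub> = \<zero>\<^bsub>W\<^esub>"
    and scal': "\<And>i j a b c. a \<in> carrier (V i) \<Longrightarrow> b \<in> carrier (V j) \<Longrightarrow> c \<in> carrier A \<Longrightarrow>
      \<beta> i j (c \<odot>\<^bsub>V i\<^esub> a) b = \<beta> i j a (c \<odot>\<^bsub>V j\<^esub> b)"
    and eq: "tensor_eq A V [[s, t]. (s, t) \<leftarrow> xs] [[s, t]. (s, t) \<leftarrow> ys]"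
    and v: "set xs \<subseteq> {((i, a), (j, b)). a \<in> carrier (V i) \<and> b \<in> carrier (V j)}"
      "set ys \<subseteq> {((i, a), (j, b)). a \<in> carrier (V i) \<and> b \<in> carrier (V j)}"
  shows "lsum W (map (\<lambda>((i, a), (j, b)). \<beta> i j a b) xs) = lsum W (map (\<lambda>((i, a), (j, b)). \<beta> i j a b) ys)"
proof -
  interpret W: abelian_monoid W by fact
  define E where "E w = (case w of [(i, a), (j, b)] \<Rightarrow>
    if a \<in> carrier (V i) \<and> b \<in> carrier (V j) then \<beta> i j a b else \<zero>\<^bsub>W\<^esub> | _ \<Rightarrow> \<zero>\<^bsub>W\<^esub>)" for w
  have E: "E w \<in> carrier W" for w using cl by (auto simp: E_def split: list.splits)
  have E2 [simp]: "E [(i, a), (j, b)] = (if a \<in> carrier (V i) \<and> b \<in> carrier (V j) then \<beta> i j a b else \<zero>\<^bsub>W\<^esub>)" for i a j b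
    by (simp add: E_def)
  have El: "length w \<noteq> 2 \<Longrightarrow> E w = \<zero>\<^bsub>W\<^esub>" for w by (auto simp: E_def split: list.splits)
  have gen: "lsum W (map E s) = lsum W (map E t)" if "(s, t) \<in> multilin_rels A V" for s t
    using that
  proof (cases rule: multilin_rels.cases)
    case (add u w x n y)
    show ?thesis unfolding add(1,2)
      by (cases u rule: word_cases; cases w rule: word_cases)
        (use add(3-) in \<open>auto simp: letters_def cl add1 add2 El\<close>)
  next
    case (zero u w n)
    show ?thesis unfolding zero(1,2)
      by (cases u rule: word_cases; cases w rule: word_cases)
        (use zero(3-) in \<open>auto simp: letters_def zero1 zero2 El\<close>)
  next
    case (scal u v w c x m y n)
    show ?thesis unfolding scal(1,2)
      by (cases u rule: word_cases; cases v rule: word_cases; cases w rule: word_cases)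
        (use scal(3-) scal' in \<open>auto simp: letters_def cl El\<close>)
  qed
  have ev: "lsum W (map E [[s, t]. (s, t) \<leftarrow> zs]) = lsum W (map (\<lambda>((i, a), (j, b)). \<beta> i j a b) zs)"
    if "set zs \<subseteq> {((i, a), (j, b)). a \<in> carrier (V i) \<and> b \<in> carrier (V j)}" for zs
    using that by (intro arg_cong[where f = "lsum W"]) (auto simp: split_beta)
  show ?thesis using W.fsum_eq_lsum[OF E gen eq] ev[OF v(1)] ev[OF v(2)] by simp
qed

lemma lsum_trilinear:
  fixes W :: "('w, 'k) ring_scheme" (structure)
  assumes W: "abelian_monoid W"
    and cl: "\<And>i j k x y z. x \<in> carrier (V i) \<Longrightarrow> y \<in> carrier (V j) \<Longrightarrow> z \<in> carrier (V k) \<Longrightarrow> \<beta> i j k x y z \<in> carrier W"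
    and add1: "\<And>i j k x x' y z. x \<in> carrier (V i) \<Longrightarrow> x' \<in> carrier (V i) \<Longrightarrow> y \<in> carrier (V j) \<Longrightarrow> z \<in> carrier (V k) \<Longrightarrow>
      \<beta> i j k (x \<oplus>\<^bsub>V i\<^esub> x') y z = \<beta> i j k x y z \<oplus>\<^bsub>W\<^esub> \<beta> i j k x' y z"
    and add2: "\<And>i j k x y y' z. x \<in> carrier (V i) \<Longrightarrow> y \<in> carrier (V j) \<Longrightarrow> y' \<in> carrier (V j) \<Longrightarrow> z \<in> carrier (V k) \<Longrightarrow>
      \<beta> i j k x (y \<oplus>\<^bsub>V j\<^esub> y') z = \<beta> i j k x y z \<oplus>\<^bsub>W\<^esub> \<beta> i j k x y' z"
    and add3: "\<And>i j k x y z z'. x \<in> carrier (V i) \<Longrightarrow> y \<in> carrier (V j) \<Longrightarrow> z \<in> carrier (V k) \<Longrightarrow> z' \<in> carrier (V k) \<Longrightarrow>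
      \<beta> i j k x y (z \<oplus>\<^bsub>V k\<^esub> z') = \<beta> i j k x y z \<oplus>\<^bsub>W\<^esub> \<beta> i j k x y z'"
    and zero1: "\<And>i j k y z. y \<in> carrier (V j) \<Longrightarrow> z \<in> carrier (V k) \<Longrightarrow> \<beta> i j k \<zero>\<^bsub>V i\<^esub> y z = \<zero>\<^bsub>W\<^esub>"
    and zero2: "\<And>i j k x z. x \<in> carrier (V i) \<Longrightarrow> z \<in> carrier (V k) \<Longrightarrow> \<beta> i j k x \<zero>\<^bsub>V j\<^esub> z = \<zero>\<^bsub>W\<^esub>"
    and zero3: "\<And>i j k x y. x \<in> carrier (V i) \<Longrightarrow> y \<in> carrier (V j) \<Longrightarrow> \<beta> i j k x y \<zero>\<^bsub>V k\<^esub> = \<zero>\<^bsub>W\<^esub>"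
    and scal12: "\<And>i j k x y z c. x \<in> carrier (V i) \<Longrightarrow> y \<in> carrier (V j) \<Longrightarrow> z \<in> carrier (V k) \<Longrightarrow> c \<in> carrier A \<Longrightarrow>
      \<beta> i j k (c \<odot>\<^bsub>V i\<^esub> x) y z = \<beta> i j k x (c \<odot>\<^bsub>V j\<^esub> y) z"
    and scal23: "\<And>i j k x y z c. x \<in> carrier (V i) \<Longrightarrow> y \<in> carrier (V j) \<Longrightarrow> z \<in> carrier (V k) \<Longrightarrow> c \<in> carrier A \<Longrightarrow>
      \<beta> i j k x (c \<odot>\<^bsub>V j\<^esub> y) z = \<beta> i j k x y (c \<odot>\<^bsub>V k\<^esub> z)"
    and eq: "tensor_eq A V [[s, t, q]. (s, t, q) \<leftarrow> xs] [[s, t, q]. (s, t, q) \<leftarrow> ys]"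
    and v: "set xs \<subseteq> {((i, x), (j, y), (k, z)). x \<in> carrier (V i) \<and> y \<in> carrier (V j) \<and> z \<in> carrier (V k)}"
      "set ys \<subseteq> {((i, x), (j, y), (k, z)). x \<in> carrier (V i) \<and> y \<in> carrier (V j) \<and> z \<in> carrier (V k)}"
  shows "lsum W (map (\<lambda>((i, x), (j, y), (k, z)). \<beta> i j k x y z) xs) =
    lsum W (map (\<lambda>((i, x), (j, y), (k, z)). \<beta> i j k x y z) ys)"
proof -
  interpret W: abelian_monoid W by fact
  define E where "E w = (case w of [(i, x), (j, y), (k, z)] \<Rightarrow>
    if x \<in> carrier (V i) \<and> y \<in> carrier (V j) \<and> z \<in> carrier (V k) then \<beta> i j k x y z else \<zero>\<^bsub>W\<^esub> | _ \<Rightarrow> \<zero>\<^bsub>W\<^esub>)" for w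
  have E: "E w \<in> carrier W" for w using cl by (auto simp: E_def split: list.splits)
  have E3 [simp]: "E [(i, x), (j, y), (k, z)] =
    (if x \<in> carrier (V i) \<and> y \<in> carrier (V j) \<and> z \<in> carrier (V k) then \<beta> i j k x y z else \<zero>\<^bsub>W\<^esub>)" for i x j y k z
    by (simp add: E_def)
  have El: "length w \<noteq> 3 \<Longrightarrow> E w = \<zero>\<^bsub>W\<^esub>" for w by (auto simp: E_def split: list.splits)
  have gen: "lsum W (map E s) = lsum W (map E t)" if "(s, t) \<in> multilin_rels A V" for s t
    using that
  proof (cases rule: multilin_rels.cases)
    case (add u w x n y)
    show ?thesis unfolding add(1,2)
      by (cases u rule: word_cases; cases w rule: word_cases)
        (use add(3-) in \<open>auto simp: letters_def cl add1 add2 add3 El\<close>)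
  next
    case (zero u w n)
    show ?thesis unfolding zero(1,2)
      by (cases u rule: word_cases; cases w rule: word_cases)
        (use zero(3-) in \<open>auto simp: letters_def zero1 zero2 zero3 El\<close>)
  next
    case (scal u v w c x m y n)
    show ?thesis unfolding scal(1,2)
      by (cases u rule: word_cases; cases v rule: word_cases; cases w rule: word_cases)
        (use scal(3-) in \<open>auto simp: letters_def cl scal12 scal23 El\<close>)
  qed
  have ev: "lsum W (map E [[s, t, q]. (s, t, q) \<leftarrow> zs]) = lsum W (map (\<lambda>((i, x), (j, y), (k, z)). \<beta> i j k x y z) zs)"
    if "set zs \<subseteq> {((i, x), (j, y), (k, z)). x \<in> carrier (V i) \<and> y \<in> carrier (V j) \<and> z \<in> carrier (V k)}" for zs
    using that by (intro arg_cong[where f = "lsum W"]) (auto simp: split_beta)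
  show ?thesis using W.fsum_eq_lsum[OF E gen eq] ev[OF v(1)] ev[OF v(2)] by simp
qed

end

section \<open>The dual of a coalgebra\<close>

lemma functionalsD:
  assumes "f \<in> functionals A W"
  shows "x \<in> carrier W \<Longrightarrow> f x \<in> carrier A" "f \<in> extensional (carrier W)"
    "x \<in> carrier W \<Longrightarrow> y \<in> carrier W \<Longrightarrow> f (x \<oplus>\<^bsub>W\<^esub> y) = f x \<oplus>\<^bsub>A\<^esub> f y"
    "c \<in> carrier A \<Longrightarrow> x \<in> carrier W \<Longrightarrow> f (c \<odot>\<^bsub>W\<^esub> x) = c \<otimes>\<^bsub>A\<^esub> f x"
  using assms by (auto simp: functionals_def PiE_def)

lemma functionalsI:
  assumes "\<And>x. x \<in> carrier W \<Longrightarrow> f x \<in> carrier A" "f \<in> extensional (carrier W)"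
    "\<And>x y. x \<in> carrier W \<Longrightarrow> y \<in> carrier W \<Longrightarrow> f (x \<oplus>\<^bsub>W\<^esub> y) = f x \<oplus>\<^bsub>A\<^esub> f y"
    "\<And>c x. c \<in> carrier A \<Longrightarrow> x \<in> carrier W \<Longrightarrow> f (c \<odot>\<^bsub>W\<^esub> x) = c \<otimes>\<^bsub>A\<^esub> f x"
  shows "f \<in> functionals A W"
  using assms by (auto simp: functionals_def PiE_def)

lemma functionals_eqI:
  assumes "f \<in> functionals A W" "g \<in> functionals A W" "\<And>x. x \<in> carrier W \<Longrightarrow> f x = g x"
  shows "f = g"
  by (rule extensionalityI[of _ "carrier W"]) (use assms functionalsD(2) in auto)

lemma (in abelian_monoid) lsum_map_concat:
  assumes "\<And>w. w \<in> set (concat (map F zs)) \<Longrightarrow> h w \<in> carrier G"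
  shows "lsum G (map h (concat (map F zs))) = lsum G (map (\<lambda>z. lsum G (map h (F z))) zs)"
  unfolding map_concat map_map o_def by (rule lsum_concat_map) (use assms in auto)

lemma (in module) comm_group_add: "comm_group (add_grp M)"
  by (rule comm_groupI) (auto simp: M.a_ac intro: bexI[of _ "\<ominus>\<^bsub>M\<^esub> _"] M.l_neg)

context coalgebra_over_field
begin

lemma functional_zero:
  assumes "f \<in> functionals A (V n)" shows "f \<zero>\<^bsub>V n\<^esub> = \<zero>"
proof -
  have "f \<zero>\<^bsub>V n\<^esub> \<oplus> f \<zero>\<^bsub>V n\<^esub> = f \<zero>\<^bsub>V n\<^esub>"
    using functionalsD(3)[OF assms, of "\<zero>\<^bsub>V n\<^esub>" "\<zero>\<^bsub>V n\<^esub>"] by simp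
  then show ?thesis using functionalsD(1)[OF assms, of "\<zero>\<^bsub>V n\<^esub>"] by (simp add: add.l_cancel_one')
qed

abbreviation R :: "('v \<Rightarrow> 'a) gring" where "R \<equiv> dual_ring A C"

lemma dual_carrier [simp]: "carrier (rgrp R p) = functionals A (V (- p))"
  by (simp add: gring_of_def dual_alg_def gdual_def)

lemma dual_simps:
  "f \<otimes>\<^bsub>rgrp R p\<^esub> g = (\<lambda>x\<in>carrier (V (- p)). f x \<oplus> g x)"
  "\<one>\<^bsub>rgrp R p\<^esub> = (\<lambda>x\<in>carrier (V (- p)). \<zero>)"
  "rone R = counit C"
  by (simp_all add: gring_of_def dual_alg_def gdual_def)

lemma iota_simps:
  "carrier (mgrp (iota C) n) = carrier (V n)"
  "x \<otimes>\<^bsub>mgrp (iota C) n\<^esub> y = x \<oplus>\<^bsub>V n\<^esub> y" "\<one>\<^bsub>mgrp (iota C) n\<^esub> = \<zero>\<^bsub>V n\<^esub>"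
  by (simp_all add: iota_def)

lemma counit_functional: "counit C \<in> functionals A (V 0)"
  using coalgebra by (simp add: gcoalgebra_def)

lemma comul_closed:
  assumes "x \<in> carrier (V n)" "((i, a), (j, b)) \<in> set (comul C n x)"
  shows "a \<in> carrier (V i)" "b \<in> carrier (V j)" "i + j = n"
proof -
  have "\<forall>((i, a), (j, b))\<in>set (comul C n x). a \<in> carrier (V i) \<and> b \<in> carrier (V j) \<and> i + j = n"
    using coalgebra assms(1) unfolding gcoalgebra_def by blast
  then show "a \<in> carrier (V i)" "b \<in> carrier (V j)" "i + j = n" using assms(2) by auto
qed

lemma comul_valid:
  "x \<in> carrier (V n) \<Longrightarrow> set (comul C n x) \<subseteq> {((i, a), (j, b)). a \<in> carrier (V i) \<and> b \<in> carrier (V j)}"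
proof
  fix z assume "x \<in> carrier (V n)" "z \<in> set (comul C n x)"
  then show "z \<in> {((i, a), (j, b)). a \<in> carrier (V i) \<and> b \<in> carrier (V j)}"
    by (cases z) (auto dest: comul_closed(1,2))
qed

text \<open>
  The contribution of \<open>a \<otimes> b\<close> to \<open>f \<cdot> x\<close>, for \<open>f\<close> of degree \<open>p\<close> and \<open>x\<close> of degree \<open>n\<close>. The condition on \<open>i\<close>
  holds for all terms of \<open>\<Delta> x\<close>; it makes the values lie in one vector space for all symbols.
\<close>

definition term_act :: "int \<Rightarrow> int \<Rightarrow> ('v \<Rightarrow> 'a) \<Rightarrow> int \<Rightarrow> int \<Rightarrow> 'v \<Rightarrow> 'v \<Rightarrow> 'v" where
  "term_act p n f i j a b = (if j = - p \<and> i = p + n then f b \<odot>\<^bsub>V (p + n)\<^esub> a else \<zero>\<^bsub>V (p + n)\<^esub>)"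

lemma term_act_closed:
  "f \<in> functionals A (V (- p)) \<Longrightarrow> a \<in> carrier (V i) \<Longrightarrow> b \<in> carrier (V j) \<Longrightarrow>
    term_act p n f i j a b \<in> carrier (V (p + n))"
  by (auto simp: term_act_def functionalsD)

lemma act_iota:
  assumes f: "f \<in> functionals A (V (- p))" and x: "x \<in> carrier (V n)"
  shows "act (iota C) p n f x = lsum (V (p + n)) (map (\<lambda>((i, a), (j, b)). term_act p n f i j a b) (comul C n x))"
proof -
  have "act (iota C) p n f x = lsum (V (p + n)) (concat (map (\<lambda>((i, a), (j, b)).
      if j = - p then [f b \<odot>\<^bsub>V (p + n)\<^esub> a] else []) (comul C n x)))"
    by (simp add: iota_def split_beta)
  also have "\<dots> = lsum (V (p + n)) (map (\<lambda>z. lsum (V (p + n)) ((\<lambda>((i, a), (j, b)).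
      if j = - p then [f b \<odot>\<^bsub>V (p + n)\<^esub> a] else []) z)) (comul C n x))"
    by (rule V.M.lsum_concat_map) (use comul_closed[OF x] f in \<open>fastforce split: if_splits simp: functionalsD\<close>)
  also have "\<dots> = lsum (V (p + n)) (map (\<lambda>((i, a), (j, b)). term_act p n f i j a b) (comul C n x))"
  proof (rule arg_cong[where f = "lsum (V (p + n))"], rule map_cong[OF HOL.refl])
    fix z assume z: "z \<in> set (comul C n x)"
    obtain i a j b where zz: "z = ((i, a), (j, b))" by (metis surj_pair)
    show "lsum (V (p + n)) ((\<lambda>((i, a), (j, b)). if j = - p then [f b \<odot>\<^bsub>V (p + n)\<^esub> a] else []) z) =
        ((\<lambda>((i, a), (j, b)). term_act p n f i j a b) z)"
      using comul_closed[OF x z[unfolded zz]] f unfolding zz by (auto simp: term_act_def functionalsD)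
  qed
  finally show ?thesis .
qed

lemma term_act_list_closed:
  assumes f: "f \<in> functionals A (V (- p))" and x: "x \<in> carrier (V n)"
  shows "set (map (\<lambda>((i, a), (j, b)). term_act p n f i j a b) (comul C n x)) \<subseteq> carrier (V (p + n))"
proof
  fix y assume "y \<in> set (map (\<lambda>((i, a), (j, b)). term_act p n f i j a b) (comul C n x))"
  then obtain i a j b where "((i, a), (j, b)) \<in> set (comul C n x)" "y = term_act p n f i j a b" by auto
  then show "y \<in> carrier (V (p + n))" using comul_closed(1,2)[OF x] term_act_closed[OF f] by simp
qed

lemma act_iota_closed:
  "f \<in> functionals A (V (- p)) \<Longrightarrow> x \<in> carrier (V n) \<Longrightarrow> act (iota C) p n f x \<in> carrier (V (p + n))"
  using term_act_list_closed by (simp add: act_iota V.M.lsum_closed)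

lemma term_act_cong:
  assumes f: "f \<in> functionals A (V (- p))"
    and eq: "tensor_eq A V [[s, t]. (s, t) \<leftarrow> xs] [[s, t]. (s, t) \<leftarrow> ys]"
    and v: "set xs \<subseteq> {((i, a), (j, b)). a \<in> carrier (V i) \<and> b \<in> carrier (V j)}"
      "set ys \<subseteq> {((i, a), (j, b)). a \<in> carrier (V i) \<and> b \<in> carrier (V j)}"
  shows "lsum (V (p + n)) (map (\<lambda>((i, a), (j, b)). term_act p n f i j a b) xs) =
    lsum (V (p + n)) (map (\<lambda>((i, a), (j, b)). term_act p n f i j a b) ys)"
proof (rule lsum_bilinear[OF _ _ _ _ _ _ _ eq v])
  show "abelian_monoid (V (p + n))" by (rule V.M.abelian_monoid_axioms)
  show "term_act p n f i j (c \<odot>\<^bsub>V i\<^esub> a) b = term_act p n f i j a (c \<odot>\<^bsub>V j\<^esub> b)"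
    if "a \<in> carrier (V i)" "b \<in> carrier (V j)" "c \<in> carrier A" for i j a b c
    using that f by (auto simp: term_act_def functionalsD V.smult_assoc1[symmetric] m_comm)
qed (use f in \<open>auto simp: term_act_def functionalsD functional_zero V.smult_r_distr V.smult_l_distr\<close>)

lemma act_iota_add:
  assumes f: "f \<in> functionals A (V (- p))" and x: "x \<in> carrier (V n)" and y: "y \<in> carrier (V n)"
  shows "act (iota C) p n f (x \<oplus>\<^bsub>V n\<^esub> y) = act (iota C) p n f x \<oplus>\<^bsub>V (p + n)\<^esub> act (iota C) p n f y"
proof -
  have "tensor_eq A V [[s, t]. (s, t) \<leftarrow> comul C n (x \<oplus>\<^bsub>V n\<^esub> y)] [[s, t]. (s, t) \<leftarrow> comul C n x @ comul C n y]"
    using coalgebra x y by (simp add: gcoalgebra_def)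
  from term_act_cong[OF f this, of n] comul_valid x y
  show ?thesis using V.M.lsum_append[OF term_act_list_closed[OF f x] term_act_list_closed[OF f y]]
    by (simp add: act_iota[OF f])
qed

lemma act_iota_smult:
  assumes f: "f \<in> functionals A (V (- p))" and x: "x \<in> carrier (V n)" and c: "c \<in> carrier A"
  shows "act (iota C) p n f (c \<odot>\<^bsub>V n\<^esub> x) = c \<odot>\<^bsub>V (p + n)\<^esub> act (iota C) p n f x"
proof -
  let ?ys = "map (\<lambda>((i, a), t). ((i, c \<odot>\<^bsub>V i\<^esub> a), t)) (comul C n x)"
  have "tensor_eq A V [[s, t]. (s, t) \<leftarrow> comul C n (c \<odot>\<^bsub>V n\<^esub> x)]
      [[(i, c \<odot>\<^bsub>V i\<^esub> a), t]. ((i, a), t) \<leftarrow> comul C n x]"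
    using coalgebra x c by (simp add: gcoalgebra_def)
  moreover have "[[(i, c \<odot>\<^bsub>V i\<^esub> a), t]. ((i, a), t) \<leftarrow> comul C n x] = [[s, t]. (s, t) \<leftarrow> ?ys]"
    by (simp add: split_beta)
  ultimately have eq: "tensor_eq A V [[s, t]. (s, t) \<leftarrow> comul C n (c \<odot>\<^bsub>V n\<^esub> x)] [[s, t]. (s, t) \<leftarrow> ?ys]" by simp
  have "set ?ys \<subseteq> {((i, a), (j, b)). a \<in> carrier (V i) \<and> b \<in> carrier (V j)}"
    using comul_closed[OF x] c by fastforce
  then have "act (iota C) p n f (c \<odot>\<^bsub>V n\<^esub> x) = lsum (V (p + n)) (map (\<lambda>((i, a), (j, b)). term_act p n f i j a b) ?ys)"
    using term_act_cong[OF f eq, of n] comul_valid x c by (simp add: act_iota[OF f])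
  also have "map (\<lambda>((i, a), (j, b)). term_act p n f i j a b) ?ys =
      map ((\<odot>\<^bsub>V (p + n)\<^esub>) c) (map (\<lambda>((i, a), (j, b)). term_act p n f i j a b) (comul C n x))"
  proof -
    have "term_act p n f i j (c \<odot>\<^bsub>V i\<^esub> a) b = c \<odot>\<^bsub>V (p + n)\<^esub> term_act p n f i j a b"
      if "((i, a), (j, b)) \<in> set (comul C n x)" for i a j b
      using comul_closed[OF x that] c f by (auto simp: term_act_def functionalsD V.smult_assoc1[symmetric] m_comm)
    then show ?thesis by (auto simp: split_beta)
  qed
  also have "lsum (V (p + n)) \<dots> = c \<odot>\<^bsub>V (p + n)\<^esub> act (iota C) p n f x"
    using V.M.lsum_hom[where h = "(\<odot>\<^bsub>V (p + n)\<^esub>) c" and W = "V (p + n)", OF _ _ term_act_list_closed[OF f x]] c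
    by (simp add: act_iota[OF f x] V.smult_r_distr)
  finally show ?thesis .
qed

lemma act_iota_plus:
  assumes f: "f \<in> functionals A (V (- p))" and g: "g \<in> functionals A (V (- p))" and x: "x \<in> carrier (V n)"
    and fg: "h \<in> functionals A (V (- p))" "\<And>y. y \<in> carrier (V (- p)) \<Longrightarrow> h y = f y \<oplus> g y"
  shows "act (iota C) p n h x = act (iota C) p n f x \<oplus>\<^bsub>V (p + n)\<^esub> act (iota C) p n g x"
proof -
  have "act (iota C) p n h x = lsum (V (p + n)) (map (\<lambda>z. ((\<lambda>((i, a), (j, b)). term_act p n f i j a b) z)
      \<oplus>\<^bsub>V (p + n)\<^esub> ((\<lambda>((i, a), (j, b)). term_act p n g i j a b) z)) (comul C n x))"
    unfolding act_iota[OF fg(1) x]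
  proof (rule arg_cong[where f = "lsum (V (p + n))"], rule map_cong[OF HOL.refl])
    fix z assume z: "z \<in> set (comul C n x)"
    obtain i a j b where zz: "z = ((i, a), (j, b))" by (metis surj_pair)
    show "((\<lambda>((i, a), (j, b)). term_act p n h i j a b) z) = ((\<lambda>((i, a), (j, b)). term_act p n f i j a b) z)
      \<oplus>\<^bsub>V (p + n)\<^esub> ((\<lambda>((i, a), (j, b)). term_act p n g i j a b) z)"
      using comul_closed[OF x z[unfolded zz]] f g fg unfolding zz
      by (auto simp: term_act_def functionalsD V.smult_l_distr)
  qed
  also have "\<dots> = act (iota C) p n f x \<oplus>\<^bsub>V (p + n)\<^esub> act (iota C) p n g x"
    unfolding act_iota[OF f x] act_iota[OF g x]
    by (rule V.M.lsum_add) (use term_act_list_closed[OF f x] term_act_list_closed[OF g x] in auto)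
  finally show ?thesis .
qed

lemma act_iota_counit:
  assumes x: "x \<in> carrier (V n)" shows "act (iota C) 0 n (counit C) x = x"
proof -
  have "lsum (V n) [counit C b \<odot>\<^bsub>V n\<^esub> a. ((i, a), (j, b)) \<leftarrow> comul C n x, j = 0] = x"
    using coalgebra x unfolding gcoalgebra_def by blast
  then show ?thesis by (simp add: iota_def cong: if_cong)
qed

text \<open>
  Convolution is expressed through the adjoint action: \<open>(f * g) x = \<Sum> f x' g x'' = f (\<Sum> x' g x'') = f (g \<cdot> x)\<close>. All
  properties of the product will be deduced from those of the action.
\<close>

lemma rmul_apply:
  assumes f: "f \<in> functionals A (V (- p))" and g: "g \<in> functionals A (V (- q))" and x: "x \<in> carrier (V (- (p + q)))"
  shows "rmul R p q f g x = f (act (iota C) q (- (p + q)) g x)"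
proof -
  let ?n = "- (p + q)"
  have q: "q + ?n = - p" by simp
  have "rmul R p q f g x = lsum A (concat (map (\<lambda>((i, a), (j, b)).
      if i = - p \<and> j = - q then [f a \<otimes> g b] else []) (comul C ?n x)))"
    using x by (simp add: gring_of_def dual_alg_def split_beta)
  also have "\<dots> = lsum A (map (\<lambda>z. lsum A ((\<lambda>((i, a), (j, b)).
      if i = - p \<and> j = - q then [f a \<otimes> g b] else []) z)) (comul C ?n x))"
    by (rule lsum_concat_map) (use comul_closed[OF x] f g in \<open>fastforce split: if_splits simp: functionalsD\<close>)
  also have "\<dots> = lsum A (map (\<lambda>z. f ((\<lambda>((i, a), (j, b)). term_act q ?n g i j a b) z)) (comul C ?n x))"
  proof (rule arg_cong[where f = "lsum A"], rule map_cong[OF HOL.refl])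
    fix z assume z: "z \<in> set (comul C ?n x)"
    obtain i a j b where zz: "z = ((i, a), (j, b))" by (metis surj_pair)
    show "lsum A ((\<lambda>((i, a), (j, b)). if i = - p \<and> j = - q then [f a \<otimes> g b] else []) z) =
        f ((\<lambda>((i, a), (j, b)). term_act q ?n g i j a b) z)"
      using comul_closed[OF x z[unfolded zz]] f g unfolding zz
      by (auto simp: term_act_def functionalsD m_comm functional_zero)
  qed
  also have "\<dots> = f (lsum (V (- p)) (map (\<lambda>((i, a), (j, b)). term_act q ?n g i j a b) (comul C ?n x)))"
  proof -
    have s: "set (map (\<lambda>((i, a), (j, b)). term_act q ?n g i j a b) (comul C ?n x)) \<subseteq> carrier (V (- p))"
      using term_act_list_closed[OF g x] by (simp only: q)
    show ?thesis
      using V.M.lsum_hom[where h = f and W = A, OF _ _ s] f by (simp add: functionalsD functional_zero o_def)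
  qed
  finally show ?thesis using act_iota[OF g x] q by simp
qed

lemma rmul_extensional: "rmul R p q f g \<in> extensional (carrier (V (- (p + q))))"
  by (simp add: gring_of_def dual_alg_def)

lemma rmul_functional:
  assumes f: "f \<in> functionals A (V (- p))" and g: "g \<in> functionals A (V (- q))"
  shows "rmul R p q f g \<in> functionals A (V (- (p + q)))"
proof (rule functionalsI)
  have q: "q + - (p + q) = - p" by simp
  note ac = act_iota_closed[OF g, of _ "- (p + q)", unfolded q]
  fix x assume x: "x \<in> carrier (V (- (p + q)))"
  show "rmul R p q f g x \<in> carrier A" using f ac[OF x] by (simp add: rmul_apply[OF f g x] functionalsD)
  show "rmul R p q f g (x \<oplus>\<^bsub>V (- (p + q))\<^esub> y) = rmul R p q f g x \<oplus> rmul R p q f g y"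
    if y: "y \<in> carrier (V (- (p + q)))" for y
    using act_iota_add[OF g x y] f ac[OF x] ac[OF y] x y V.M.a_closed[OF x y]
    by (simp add: rmul_apply[OF f g] functionalsD q del: minus_add_distrib)
  show "rmul R p q f g (c \<odot>\<^bsub>V (- (p + q))\<^esub> x) = c \<otimes> rmul R p q f g x" if c: "c \<in> carrier A" for c
    using act_iota_smult[OF g x c] f ac[OF x] x V.smult_closed[OF c x] c
    by (simp add: rmul_apply[OF f g] functionalsD q del: minus_add_distrib)
qed (rule rmul_extensional)

text \<open>
  Both sides are the sum of \<open>f b g c a\<close> over the terms \<open>a \<otimes> b \<otimes> c\<close> of the iterated comultiplication, for
  its two expansions; these agree by coassociativity.
\<close>

lemma act_iota_rmul:
  assumes f: "f \<in> functionals A (V (- p))" and g: "g \<in> functionals A (V (- q))" and x: "x \<in> carrier (V n)"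
  shows "act (iota C) (p + q) n (rmul R p q f g) x = act (iota C) p (q + n) f (act (iota C) q n g x)"
proof -
  let ?W = "V (p + q + n)"
  \<comment> \<open>The trilinear form that sends \<open>a \<otimes> b \<otimes> c\<close> to \<open>f b g c a\<close>.\<close>
  define \<beta> where "\<beta> i j k a b c = (if i = p + q + n \<and> j = - p \<and> k = - q then (f b \<otimes> g c) \<odot>\<^bsub>?W\<^esub> a else \<zero>\<^bsub>?W\<^esub>)" for i j k :: int and a b c
  let ?xs = "concat (map (\<lambda>((i, a), t). map (\<lambda>(s1, s2). (s1, s2, t)) (comul C i a)) (comul C n x))"
  let ?ys = "concat (map (\<lambda>(s, (j, b)). map (\<lambda>(t1, t2). (s, t1, t2)) (comul C j b)) (comul C n x))"
  let ?b = "\<lambda>((i, x), (j, y), (k, z)). \<beta> i j k x y z"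
  have eq: "tensor_eq A V [[s, t, u]. (s, t, u) \<leftarrow> ?xs] [[s, t, u]. (s, t, u) \<leftarrow> ?ys]"
  proof -
    have "tensor_eq A V [[s1, s2, t]. ((i, a), t) \<leftarrow> comul C n x, (s1, s2) \<leftarrow> comul C i a]
        [[s, t1, t2]. (s, (j, b)) \<leftarrow> comul C n x, (t1, t2) \<leftarrow> comul C j b]"
      using coalgebra x by (simp add: gcoalgebra_def)
    moreover have "[[s1, s2, t]. ((i, a), t) \<leftarrow> comul C n x, (s1, s2) \<leftarrow> comul C i a] = [[s, t, u]. (s, t, u) \<leftarrow> ?xs]"
      unfolding map_concat by (rule arg_cong[where f = concat]) (auto split: prod.splits)
    moreover have "[[s, t1, t2]. (s, (j, b)) \<leftarrow> comul C n x, (t1, t2) \<leftarrow> comul C j b] = [[s, t, u]. (s, t, u) \<leftarrow> ?ys]"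
      unfolding map_concat by (rule arg_cong[where f = concat]) (auto split: prod.splits)
    ultimately show ?thesis by simp
  qed
  have vx: "set ?xs \<subseteq> {((i, x), (j, y), (k, z)). x \<in> carrier (V i) \<and> y \<in> carrier (V j) \<and> z \<in> carrier (V k)}"
  proof
    fix w assume "w \<in> set ?xs"
    then obtain i a t s1 s2 where "((i, a), t) \<in> set (comul C n x)" "(s1, s2) \<in> set (comul C i a)" "w = (s1, s2, t)"
      by auto
    then show "w \<in> {((i, x), (j, y), (k, z)). x \<in> carrier (V i) \<and> y \<in> carrier (V j) \<and> z \<in> carrier (V k)}"
      by (cases s1; cases s2; cases t) (auto dest: comul_closed(1,2)[OF x] comul_closed(1,2)[rotated])
  qed
  have vy: "set ?ys \<subseteq> {((i, x), (j, y), (k, z)). x \<in> carrier (V i) \<and> y \<in> carrier (V j) \<and> z \<in> carrier (V k)}"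
  proof
    fix w assume "w \<in> set ?ys"
    then obtain s j b t1 t2 where "(s, (j, b)) \<in> set (comul C n x)" "(t1, t2) \<in> set (comul C j b)" "w = (s, t1, t2)"
      by auto
    then show "w \<in> {((i, x), (j, y), (k, z)). x \<in> carrier (V i) \<and> y \<in> carrier (V j) \<and> z \<in> carrier (V k)}"
      by (cases s; cases t1; cases t2) (auto dest: comul_closed(1,2)[OF x] comul_closed(1,2)[rotated])
  qed
  have tri: "lsum ?W (map ?b ?xs) = lsum ?W (map ?b ?ys)"
  proof (rule lsum_trilinear[OF _ _ _ _ _ _ _ _ _ _ eq vx vy])
    show "abelian_monoid ?W" by (rule V.M.abelian_monoid_axioms)
  qed (use f g in \<open>auto simp: \<beta>_def functionalsD functional_zero V.smult_r_distr V.smult_l_distr l_distr r_distr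
      V.smult_assoc1[symmetric] m_ac\<close>)
  have \<beta>c: "\<beta> i j k a b c \<in> carrier ?W" if "a \<in> carrier (V i)" "b \<in> carrier (V j)" "c \<in> carrier (V k)" for i j k a b c
    using that f g by (auto simp: \<beta>_def functionalsD)
  have bx: "?b w \<in> carrier ?W" if "w \<in> set ?xs" for w
    using subsetD[OF vx that] by (auto intro: \<beta>c)
  have b_y: "?b w \<in> carrier ?W" if "w \<in> set ?ys" for w
    using subsetD[OF vy that] by (auto intro: \<beta>c)
  have qn: "p + (q + n) = p + q + n" by simp
  have "act (iota C) p (q + n) f (act (iota C) q n g x) =
      lsum ?W (map (\<lambda>z. act (iota C) p (q + n) f ((\<lambda>((i, a), (j, b)). term_act q n g i j a b) z)) (comul C n x))"
  proof -
    have z: "act (iota C) p (q + n) f \<zero>\<^bsub>V (q + n)\<^esub> = \<zero>\<^bsub>?W\<^esub>"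
      using act_iota_smult[OF f V.M.zero_closed zero_closed, of "q + n"] act_iota_closed[OF f V.M.zero_closed, of "q + n"]
      by (simp add: qn V.smult_l_null)
    have a: "act (iota C) p (q + n) f (x \<oplus>\<^bsub>V (q + n)\<^esub> y) = act (iota C) p (q + n) f x \<oplus>\<^bsub>?W\<^esub> act (iota C) p (q + n) f y"
      if "x \<in> carrier (V (q + n))" "y \<in> carrier (V (q + n))" for x y
      using act_iota_add[OF f that] by (simp add: qn)
    show ?thesis
      unfolding act_iota[OF g x]
      by (subst V.M.lsum_hom[where h = "act (iota C) p (q + n) f" and W = ?W, OF z a term_act_list_closed[OF g x]]) (auto simp: o_def)
  qed
  also have "\<dots> = lsum ?W (map (\<lambda>z. lsum ?W (map ?b ((\<lambda>((i, a), t). map (\<lambda>(s1, s2). (s1, s2, t)) (comul C i a)) z))) (comul C n x))"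
  proof (rule arg_cong[where f = "lsum ?W"], rule map_cong[OF HOL.refl])
    fix z assume z: "z \<in> set (comul C n x)"
    obtain i a j b where zz: "z = ((i, a), (j, b))" by (metis surj_pair)
    note c = comul_closed[OF x z[unfolded zz]]
    have b0: "lsum ?W (map (\<lambda>_. \<zero>\<^bsub>?W\<^esub>) ls) = \<zero>\<^bsub>?W\<^esub>" for ls :: "((int \<times> 'v) \<times> (int \<times> 'v)) list" by (induction ls) auto
    show "act (iota C) p (q + n) f ((\<lambda>((i, a), (j, b)). term_act q n g i j a b) z) =
        lsum ?W (map ?b ((\<lambda>((i, a), t). map (\<lambda>(s1, s2). (s1, s2, t)) (comul C i a)) z))"
    proof (cases "j = - q")
      case True
      then have i: "i = q + n" using c by simp
      have gb: "g b \<in> carrier A" using g c True by (simp add: functionalsD)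
      have "act (iota C) p (q + n) f (term_act q n g i j a b) = g b \<odot>\<^bsub>?W\<^esub> act (iota C) p (q + n) f a"
        using act_iota_smult[OF f, of a "q + n" "g b"] c gb i True by (simp add: term_act_def qn)
      also have "\<dots> = lsum ?W (map ((\<odot>\<^bsub>?W\<^esub>) (g b)) (map (\<lambda>((i, a), (j, b)). term_act p (q + n) f i j a b) (comul C (q + n) a)))"
        using V.M.lsum_hom[where h = "(\<odot>\<^bsub>?W\<^esub>) (g b)" and W = ?W, OF _ _ term_act_list_closed[OF f, of a "q + n", unfolded qn]]
          c gb i by (simp add: act_iota[OF f] V.smult_r_distr qn)
      also have "map ((\<odot>\<^bsub>?W\<^esub>) (g b)) (map (\<lambda>((i, a), (j, b)). term_act p (q + n) f i j a b) (comul C (q + n) a)) =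
          map ?b (map (\<lambda>(s1, s2). (s1, s2, (j, b))) (comul C i a))"
      proof -
        have "g b \<odot>\<^bsub>?W\<^esub> term_act p (q + n) f i' j' a' b' = \<beta> i' j' j a' b' b"
          if "((i', a'), (j', b')) \<in> set (comul C (q + n) a)" for i' a' j' b'
          using comul_closed[OF _ that] c i gb f True
          by (auto simp: term_act_def \<beta>_def functionalsD qn V.smult_assoc1[symmetric] m_comm)
        then show ?thesis using i by (auto simp: split_beta)
      qed
      finally show ?thesis unfolding zz by simp
    next
      case False
      then show ?thesis unfolding zz
        using act_iota_smult[OF f V.M.zero_closed zero_closed, of "q + n"] act_iota_closed[OF f V.M.zero_closed, of "q + n"]
        by (simp add: term_act_def \<beta>_def qn V.smult_l_null split_beta o_def b0)
    qed
  qed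
  also have "\<dots> = lsum ?W (map ?b ?xs)"
    by (rule V.M.lsum_map_concat[symmetric]) (rule bx)
  also have "\<dots> = lsum ?W (map ?b ?ys)" by (rule tri)
  also have "\<dots> = lsum ?W (map (\<lambda>z. lsum ?W (map ?b ((\<lambda>(s, (j, b)). map (\<lambda>(t1, t2). (s, t1, t2)) (comul C j b)) z))) (comul C n x))"
    by (rule V.M.lsum_map_concat) (rule b_y)
  also have "\<dots> = lsum ?W (map (\<lambda>((i, a), (j, b)). term_act (p + q) n (rmul R p q f g) i j a b) (comul C n x))"
  proof (rule arg_cong[where f = "lsum ?W"], rule map_cong[OF HOL.refl])
    fix z assume z: "z \<in> set (comul C n x)"
    obtain i a j b where zz: "z = ((i, a), (j, b))" by (metis surj_pair)
    note c = comul_closed[OF x z[unfolded zz]]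
    have b0: "lsum ?W (map (\<lambda>_. \<zero>\<^bsub>?W\<^esub>) ls) = \<zero>\<^bsub>?W\<^esub>" for ls :: "((int \<times> 'v) \<times> (int \<times> 'v)) list" by (induction ls) auto
    show "lsum ?W (map ?b ((\<lambda>(s, (j, b)). map (\<lambda>(t1, t2). (s, t1, t2)) (comul C j b)) z)) =
        ((\<lambda>((i, a), (j, b)). term_act (p + q) n (rmul R p q f g) i j a b) z)"
    proof (cases "j = - (p + q)")
      case True
      then have i: "i = p + q + n" using c by simp
      have bc: "b \<in> carrier (V (- (p + q)))" using c True by simp
      have "rmul R p q f g b \<odot>\<^bsub>?W\<^esub> a = f (act (iota C) q (- (p + q)) g b) \<odot>\<^bsub>?W\<^esub> a"
        by (simp only: rmul_apply[OF f g bc])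
      also have "\<dots> = lsum ?W (map (\<lambda>y. f y \<odot>\<^bsub>?W\<^esub> a) (map (\<lambda>((i, a), (j, b)). term_act q (- (p + q)) g i j a b) (comul C (- (p + q)) b)))"
      proof -
        have q: "q + - (p + q) = - p" by simp
        have s: "set (map (\<lambda>((i, a), (j, b)). term_act q (- (p + q)) g i j a b) (comul C (- (p + q)) b)) \<subseteq> carrier (V (- p))"
          using term_act_list_closed[OF g bc] by (simp only: q)
        show ?thesis
          using V.M.lsum_hom[where h = "\<lambda>y. f y \<odot>\<^bsub>?W\<^esub> a" and W = ?W, OF _ _ s] f c i
          by (simp add: act_iota[OF g bc, unfolded q] functionalsD functional_zero V.smult_l_null V.smult_l_distr
              del: minus_add_distrib)
      qed
      also have "map (\<lambda>y. f y \<odot>\<^bsub>?W\<^esub> a) (map (\<lambda>((i, a), (j, b)). term_act q (- (p + q)) g i j a b) (comul C (- (p + q)) b)) =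
          map ?b (map (\<lambda>(t1, t2). ((i, a), t1, t2)) (comul C j b))"
      proof -
        have "f (term_act q (- (p + q)) g i' j' a' b') \<odot>\<^bsub>?W\<^esub> a = \<beta> i i' j' a a' b'"
          if "((i', a'), (j', b')) \<in> set (comul C (- (p + q)) b)" for i' a' j' b'
          using comul_closed[OF bc that] c i f g
          by (auto simp: term_act_def \<beta>_def functionalsD m_comm functional_zero V.smult_l_null)
        then show ?thesis using True by (auto simp: split_beta)
      qed
      finally show ?thesis unfolding zz using True i by (simp add: term_act_def)
    next
      case False
      have "\<beta> i i' j' a a' b' = \<zero>\<^bsub>?W\<^esub>" if "((i', a'), (j', b')) \<in> set (comul C j b)" for i' a' j' b'
        using comul_closed[OF c(2) that] False by (auto simp: \<beta>_def)
      then have m: "map ?b (map (\<lambda>(t1, t2). ((i, a), t1, t2)) (comul C j b)) = map (\<lambda>_. \<zero>\<^bsub>?W\<^esub>) (comul C j b)"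
        by (auto simp: split_beta)
      have "lsum ?W (map ?b (map (\<lambda>(t1, t2). ((i, a), t1, t2)) (comul C j b))) = \<zero>\<^bsub>?W\<^esub>"
        unfolding m by (rule b0)
      then show ?thesis unfolding zz using False by (simp add: term_act_def)
    qed
  qed
  also have "\<dots> = act (iota C) (p + q) n (rmul R p q f g) x"
    using act_iota[OF rmul_functional[OF f g] x] by simp
  finally show ?thesis by simp
qed

text \<open>
  By the other counit law, \<open>\<epsilon> (\<Sum> x' f x'') = f (\<Sum> \<epsilon> x' x'') = f x\<close>.
\<close>

lemma counit_act:
  assumes f: "f \<in> functionals A (V (- p))" and x: "x \<in> carrier (V (- p))"
  shows "counit C (act (iota C) p (- p) f x) = f x"
proof -
  have e: "counit C \<in> functionals A (V 0)" by (rule counit_functional)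
  have s: "set (map (\<lambda>((i, a), (j, b)). term_act p (- p) f i j a b) (comul C (- p) x)) \<subseteq> carrier (V 0)"
    using term_act_list_closed[OF f x] by simp
  define F where "F = (\<lambda>((i :: int, a), (j :: int, b)). if i = 0 then [counit C a \<odot>\<^bsub>V (- p)\<^esub> b] else [])"
  have Fc: "set (F z) \<subseteq> carrier (V (- p))" if "z \<in> set (comul C (- p) x)" for z
  proof -
    obtain i a j b where z: "z = ((i, a), (j, b))" by (metis surj_pair)
    show ?thesis using comul_closed[OF x that[unfolded z]] e unfolding z by (auto simp: F_def functionalsD)
  qed
  have "x = lsum (V (- p)) (concat (map F (comul C (- p) x)))"
    using coalgebra x unfolding gcoalgebra_def F_def by force
  also have "\<dots> = lsum (V (- p)) (map (\<lambda>z. lsum (V (- p)) (F z)) (comul C (- p) x))"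
    by (rule V.M.lsum_concat_map) (rule Fc)
  finally have "f x = f (lsum (V (- p)) (map (\<lambda>z. lsum (V (- p)) (F z)) (comul C (- p) x)))" by simp
  also have "\<dots> = lsum A (map f (map (\<lambda>z. lsum (V (- p)) (F z)) (comul C (- p) x)))"
    by (rule V.M.lsum_hom)
      (use f V.M.lsum_closed[OF Fc] in \<open>simp_all add: functionalsD functional_zero image_subset_iff\<close>)
  also have "\<dots> = lsum A (map (counit C) (map (\<lambda>((i, a), (j, b)). term_act p (- p) f i j a b) (comul C (- p) x)))"
    unfolding map_map o_def
  proof (rule arg_cong[where f = "lsum A"], rule map_cong[OF HOL.refl])
    fix z assume z: "z \<in> set (comul C (- p) x)"
    obtain i a j b where zz: "z = ((i, a), (j, b))" by (metis surj_pair)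
    show "f (lsum (V (- p)) (F z)) = counit C ((\<lambda>((i, a), (j, b)). term_act p (- p) f i j a b) z)"
      using comul_closed[OF x z[unfolded zz]] f e unfolding zz
      by (auto simp: F_def term_act_def functionalsD functional_zero m_comm)
  qed
  also have "\<dots> = counit C (lsum (V 0) (map (\<lambda>((i, a), (j, b)). term_act p (- p) f i j a b) (comul C (- p) x)))"
    by (rule V.M.lsum_hom[symmetric, OF _ _ s]) (use e in \<open>auto simp: functionalsD functional_zero\<close>)
  finally show ?thesis using act_iota[OF f x] by simp
qed

lemma comm_group_dual: "comm_group (rgrp R n)"
proof (rule comm_groupI)
  fix f g assume f: "f \<in> carrier (rgrp R n)" and g: "g \<in> carrier (rgrp R n)"
  show "f \<otimes>\<^bsub>rgrp R n\<^esub> g \<in> carrier (rgrp R n)"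
    unfolding dual_carrier dual_simps
    by (rule functionalsI) (use f g in \<open>auto simp: functionalsD r_distr a_ac\<close>)
  show "f \<otimes>\<^bsub>rgrp R n\<^esub> g = g \<otimes>\<^bsub>rgrp R n\<^esub> f"
    unfolding dual_simps by (rule restrict_ext) (use f g in \<open>auto simp: functionalsD a_comm\<close>)
  show "f \<otimes>\<^bsub>rgrp R n\<^esub> g \<otimes>\<^bsub>rgrp R n\<^esub> h = f \<otimes>\<^bsub>rgrp R n\<^esub> (g \<otimes>\<^bsub>rgrp R n\<^esub> h)"
    if h: "h \<in> carrier (rgrp R n)" for h
    unfolding dual_simps by (rule restrict_ext) (use f g h in \<open>auto simp: functionalsD a_assoc\<close>)
next
  show "\<one>\<^bsub>rgrp R n\<^esub> \<in> carrier (rgrp R n)"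
    unfolding dual_carrier dual_simps by (rule functionalsI) auto
  fix f assume f: "f \<in> carrier (rgrp R n)"
  then have fx: "f \<in> extensional (carrier (V (- n)))" by (simp add: functionalsD)
  show "\<one>\<^bsub>rgrp R n\<^esub> \<otimes>\<^bsub>rgrp R n\<^esub> f = f"
    unfolding dual_simps
    by (rule extensionalityI[OF _ fx]) (use f in \<open>auto simp: functionalsD\<close>)
  have "(\<lambda>x\<in>carrier (V (- n)). \<ominus> f x) \<in> carrier (rgrp R n)"
    unfolding dual_carrier
    by (rule functionalsI) (use f in \<open>auto simp: functionalsD r_minus minus_add\<close>)
  moreover have "(\<lambda>x\<in>carrier (V (- n)). \<ominus> f x) \<otimes>\<^bsub>rgrp R n\<^esub> f = \<one>\<^bsub>rgrp R n\<^esub>"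
    unfolding dual_simps by (rule restrict_ext) (use f in \<open>auto simp: functionalsD l_neg\<close>)
  ultimately show "\<exists>g\<in>carrier (rgrp R n). g \<otimes>\<^bsub>rgrp R n\<^esub> f = \<one>\<^bsub>rgrp R n\<^esub>" by blast
qed

lemma dual_sum_functional:
  "f \<in> functionals A (V (- n)) \<Longrightarrow> g \<in> functionals A (V (- n)) \<Longrightarrow> f \<otimes>\<^bsub>rgrp R n\<^esub> g \<in> functionals A (V (- n))"
  using monoid.m_closed[of "rgrp R n" f g] comm_group_dual[of n] by (simp add: comm_group_def comm_monoid_def)

lemma iota_gmodule: "gmodule R (iota C)"
proof (rule gmoduleI)
  show "comm_group (mgrp (iota C) n)" for n using V.comm_group_add by (simp add: iota_def)
qed (auto simp: iota_simps dual_simps(3) act_iota_closed act_iota_add act_iota_rmul act_iota_counit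
    dual_simps(1) dual_sum_functional[unfolded dual_simps(1)] intro!: act_iota_plus)

text \<open>
  Associativity is \<open>((f * g) * h) x = f (g \<cdot> (h \<cdot> x)) = (f * (g * h)) x\<close>, and the unit laws are the two
  counit laws.
\<close>

lemma dual_graded_ring: "graded_ring R"
  unfolding graded_ring_def
proof (intro conjI allI ballI)
  show "rone R \<in> carrier (rgrp R 0)" using counit_functional by (simp add: dual_simps)
  show "gmodule R (reg R)"
  proof (rule gmoduleI)
    show "comm_group (mgrp (reg R) n)" for n using comm_group_dual by (simp add: reg_def)
    show "act (reg R) p q r x \<in> carrier (mgrp (reg R) (p + q))"
      if "r \<in> carrier (rgrp R p)" "x \<in> carrier (mgrp (reg R) q)" for p q r x
      using that rmul_functional[of r p x q] by (simp add: reg_def)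
    show "act (reg R) p q r (f \<otimes>\<^bsub>mgrp (reg R) q\<^esub> g) = act (reg R) p q r f \<otimes>\<^bsub>mgrp (reg R) (p + q)\<^esub> act (reg R) p q r g"
      if r: "r \<in> carrier (rgrp R p)" and f: "f \<in> carrier (mgrp (reg R) q)" and g: "g \<in> carrier (mgrp (reg R) q)" for p q r f g
    proof -
      have f': "r \<in> functionals A (V (- p))" "f \<in> functionals A (V (- q))" "g \<in> functionals A (V (- q))"
        using r f g by (simp_all add: reg_def)
      note fg = dual_sum_functional[OF f'(2,3)]
      have "rmul R p q r (f \<otimes>\<^bsub>rgrp R q\<^esub> g) = rmul R p q r f \<otimes>\<^bsub>rgrp R (p + q)\<^esub> rmul R p q r g"
      proof (rule functionals_eqI)
        show "rmul R p q r (f \<otimes>\<^bsub>rgrp R q\<^esub> g) \<in> functionals A (V (- (p + q)))" by (rule rmul_functional[OF f'(1) fg])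
        show "rmul R p q r f \<otimes>\<^bsub>rgrp R (p + q)\<^esub> rmul R p q r g \<in> functionals A (V (- (p + q)))"
          by (rule dual_sum_functional[OF rmul_functional[OF f'(1,2)] rmul_functional[OF f'(1,3)]])
        fix x assume x: "x \<in> carrier (V (- (p + q)))"
        have q: "q + - (p + q) = - p" by simp
        have a: "act (iota C) q (- (p + q)) (f \<otimes>\<^bsub>rgrp R q\<^esub> g) x =
            act (iota C) q (- (p + q)) f x \<oplus>\<^bsub>V (- p)\<^esub> act (iota C) q (- (p + q)) g x"
          using act_iota_plus[OF f'(2,3) x fg] by (simp add: dual_simps q del: minus_add_distrib)
        show "rmul R p q r (f \<otimes>\<^bsub>rgrp R q\<^esub> g) x = (rmul R p q r f \<otimes>\<^bsub>rgrp R (p + q)\<^esub> rmul R p q r g) x"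
          unfolding rmul_apply[OF f'(1) fg x] a dual_simps(1)[of "p + q"] restrict_apply'[OF x]
            rmul_apply[OF f'(1,2) x] rmul_apply[OF f'(1,3) x]
          by (rule functionalsD(3)[OF f'(1)])
            (use act_iota_closed[OF f'(2) x, unfolded q] act_iota_closed[OF f'(3) x, unfolded q] in auto)
      qed
      then show ?thesis by (simp add: reg_def)
    qed
    show "act (reg R) p q (r \<otimes>\<^bsub>rgrp R p\<^esub> s) f = act (reg R) p q r f \<otimes>\<^bsub>mgrp (reg R) (p + q)\<^esub> act (reg R) p q s f"
      if r: "r \<in> carrier (rgrp R p)" and s: "s \<in> carrier (rgrp R p)" and f: "f \<in> carrier (mgrp (reg R) q)" for p q r s f
    proof -
      have f': "r \<in> functionals A (V (- p))" "s \<in> functionals A (V (- p))" "f \<in> functionals A (V (- q))"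
        using r f s by (simp_all add: reg_def)
      note rs = dual_sum_functional[OF f'(1,2)]
      have "rmul R p q (r \<otimes>\<^bsub>rgrp R p\<^esub> s) f = rmul R p q r f \<otimes>\<^bsub>rgrp R (p + q)\<^esub> rmul R p q s f"
      proof (rule functionals_eqI)
        show "rmul R p q (r \<otimes>\<^bsub>rgrp R p\<^esub> s) f \<in> functionals A (V (- (p + q)))" by (rule rmul_functional[OF rs f'(3)])
        show "rmul R p q r f \<otimes>\<^bsub>rgrp R (p + q)\<^esub> rmul R p q s f \<in> functionals A (V (- (p + q)))"
          by (rule dual_sum_functional[OF rmul_functional[OF f'(1,3)] rmul_functional[OF f'(2,3)]])
        fix x assume x: "x \<in> carrier (V (- (p + q)))"
        have q: "q + - (p + q) = - p" by simp
        show "rmul R p q (r \<otimes>\<^bsub>rgrp R p\<^esub> s) f x = (rmul R p q r f \<otimes>\<^bsub>rgrp R (p + q)\<^esub> rmul R p q s f) x"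
          unfolding rmul_apply[OF rs f'(3) x] dual_simps(1)[of "p + q"] restrict_apply'[OF x]
            rmul_apply[OF f'(1,3) x] rmul_apply[OF f'(2,3) x]
          using act_iota_closed[OF f'(3) x, unfolded q] by (simp add: dual_simps)
      qed
      then show ?thesis by (simp add: reg_def)
    qed
    show "act (reg R) (p + q) n (rmul R p q r s) f = act (reg R) p (q + n) r (act (reg R) q n s f)"
      if r: "r \<in> carrier (rgrp R p)" and s: "s \<in> carrier (rgrp R q)" and f: "f \<in> carrier (mgrp (reg R) n)" for p q n r s f
    proof -
      have f': "r \<in> functionals A (V (- p))" "s \<in> functionals A (V (- q))" "f \<in> functionals A (V (- n))"
        using r f s by (simp_all add: reg_def)
      note rs = rmul_functional[OF f'(1,2)] and sf = rmul_functional[OF f'(2,3)]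
      have i: "- (p + (q + n)) = - (p + q + n)" by simp
      have "rmul R (p + q) n (rmul R p q r s) f = rmul R p (q + n) r (rmul R q n s f)"
      proof (rule functionals_eqI)
        show "rmul R (p + q) n (rmul R p q r s) f \<in> functionals A (V (- (p + q + n)))" by (rule rmul_functional[OF rs f'(3)])
        show "rmul R p (q + n) r (rmul R q n s f) \<in> functionals A (V (- (p + q + n)))"
          using rmul_functional[OF f'(1) sf] by (simp only: i)
        fix x assume x: "x \<in> carrier (V (- (p + q + n)))"
        have n1: "n + - (p + q + n) = - (p + q)" by simp
        have fx: "act (iota C) n (- (p + q + n)) f x \<in> carrier (V (- (p + q)))"
          using act_iota_closed[OF f'(3) x] by (simp only: n1)
        have "rmul R (p + q) n (rmul R p q r s) f x = r (act (iota C) q (- (p + q)) s (act (iota C) n (- (p + q + n)) f x))"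
          by (simp only: rmul_apply[OF rs f'(3) x] rmul_apply[OF f'(1,2) fx])
        also have "\<dots> = r (act (iota C) (q + n) (- (p + q + n)) (rmul R q n s f) x)"
          by (simp only: act_iota_rmul[OF f'(2,3) x] n1)
        also have "\<dots> = rmul R p (q + n) r (rmul R q n s f) x"
          using rmul_apply[OF f'(1) sf, of x] x by (simp only: i)
        finally show "rmul R (p + q) n (rmul R p q r s) f x = rmul R p (q + n) r (rmul R q n s f) x" .
      qed
      then show ?thesis by (simp add: reg_def)
    qed
    show "act (reg R) 0 n (rone R) f = f" if f: "f \<in> carrier (mgrp (reg R) n)" for n f
    proof -
      have f': "f \<in> functionals A (V (- n))" and e: "counit C \<in> functionals A (V (- 0))"
        using f counit_functional by (simp_all add: reg_def)
      have "rmul R 0 n (counit C) f = f"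
      proof (rule functionals_eqI[OF _ f'])
        show "rmul R 0 n (counit C) f \<in> functionals A (V (- n))" using rmul_functional[OF e f'] by simp
        show "rmul R 0 n (counit C) f x = f x" if "x \<in> carrier (V (- n))" for x
          using rmul_apply[OF e f', of x] that counit_act[OF f' that] by simp
      qed
      then show ?thesis by (simp add: reg_def dual_simps)
    qed
  qed
  fix p r assume "r \<in> carrier (rgrp R p)"
  then have f': "r \<in> functionals A (V (- p))" and e: "counit C \<in> functionals A (V (- 0))"
    using counit_functional by simp_all
  have "rmul R p 0 r (counit C) = r"
  proof (rule functionals_eqI[OF _ f'])
    show "rmul R p 0 r (counit C) \<in> functionals A (V (- p))" using rmul_functional[OF f' e] by simp
    show "rmul R p 0 r (counit C) x = r x" if "x \<in> carrier (V (- p))" for x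
      using rmul_apply[OF f' e, of x] that act_iota_counit[OF that] by simp
  qed
  then show "rmul R p 0 r (rone R) = r" by (simp add: dual_simps)
qed

text \<open>
  The structure map of the dual algebra: the multiples of the counit, which is its unit.
\<close>

definition scalar :: "'a \<Rightarrow> 'v \<Rightarrow> 'a" where
  "scalar c = (\<lambda>x\<in>carrier (V 0). c \<otimes> counit C x)"

lemma scalar_functional: "c \<in> carrier A \<Longrightarrow> scalar c \<in> functionals A (V 0)"
  using counit_functional by (intro functionalsI) (auto simp: scalar_def functionalsD r_distr m_lcomm)

lemma dual_over_field: "graded_ring_over_field A R scalar"
proof (intro graded_ring_over_field.intro graded_ring_over.intro graded_ring_over_field_axioms.intro)
  show "field A" by (rule field_axioms)
  show "graded_ring R" by (rule dual_graded_ring)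
  show "scalar c \<in> carrier (rgrp R 0)" if "c \<in> carrier A" for c using scalar_functional[OF that] by simp
  show "scalar (c \<oplus> d) = scalar c \<otimes>\<^bsub>rgrp R 0\<^esub> scalar d" if "c \<in> carrier A" "d \<in> carrier A" for c d
    unfolding dual_simps using that counit_functional
    by (auto simp: scalar_def functionalsD l_distr intro!: restrict_ext)
  show "scalar \<one> = rone R"
  proof -
    have "scalar \<one> = counit C"
      by (rule functionals_eqI[OF scalar_functional counit_functional])
        (use counit_functional in \<open>auto simp: scalar_def functionalsD\<close>)
    then show ?thesis by (simp add: dual_simps)
  qed
  fix c d assume c: "c \<in> carrier A" and d: "d \<in> carrier A"
  have c': "scalar c \<in> functionals A (V (- 0))" "scalar d \<in> functionals A (V (- 0))"
    using scalar_functional c d by simp_all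
  have "rmul R 0 0 (scalar c) (scalar d) = scalar (c \<otimes> d)"
  proof (rule functionals_eqI)
    show "rmul R 0 0 (scalar c) (scalar d) \<in> functionals A (V 0)" using rmul_functional[OF c'] by simp
    show "scalar (c \<otimes> d) \<in> functionals A (V 0)" using scalar_functional c d by simp
    fix x assume x: "x \<in> carrier (V 0)"
    have ax: "act (iota C) 0 0 (scalar d) x \<in> carrier (V 0)" using act_iota_closed[OF c'(2), of x 0] x by simp
    have "rmul R 0 0 (scalar c) (scalar d) x = c \<otimes> counit C (act (iota C) 0 0 (scalar d) x)"
      using rmul_apply[OF c', of x] x ax by (simp add: scalar_def)
    also have "\<dots> = c \<otimes> (d \<otimes> counit C x)"
      using counit_act[OF c'(2), of x] x by (simp add: scalar_def)
    finally show "rmul R 0 0 (scalar c) (scalar d) x = scalar (c \<otimes> d) x"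
      using x c d counit_functional by (simp add: scalar_def m_assoc functionalsD)
  qed
  then show "scalar (c \<otimes> d) = rmul R 0 0 (scalar c) (scalar d)" by simp
qed

text \<open>
  Extend the linear map \<open>c x \<mapsto> c\<close> from the line spanned by \<open>x\<close>.
\<close>

lemma functionals_separate:
  assumes x: "x \<in> carrier (V n)" "x \<noteq> \<zero>\<^bsub>V n\<^esub>"
  shows "\<exists>f\<in>functionals A (V n). f x \<noteq> \<zero>"
proof -
  have A: "scalar_action A (add_grp A) (\<otimes>)"
    by (intro scalar_action.intro scalar_action_axioms.intro field_axioms)
      (auto intro!: homI comm_groupI simp: r_distr l_distr m_assoc a_ac intro: bexI[of _ "\<ominus> _"] l_neg)
  have W: "scalar_action A (add_grp (V n)) (\<odot>\<^bsub>V n\<^esub>)"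
    by (intro scalar_action.intro scalar_action_axioms.intro field_axioms V.comm_group_add)
      (auto intro!: homI simp: V.smult_r_distr V.smult_l_distr V.smult_assoc1)
  have "\<exists>g. g \<in> hom (add_grp (V n)) (add_grp A) \<and>
      (\<forall>k\<in>carrier A. \<forall>y\<in>carrier (add_grp (V n)). g (k \<odot>\<^bsub>V n\<^esub> y) = k \<otimes> g y) \<and>
      (\<forall>c\<in>carrier (add_grp A). g (c \<odot>\<^bsub>V n\<^esub> x) = c)"
  proof (rule extend_linear_map[OF A W A, where u = "\<lambda>c. c \<odot>\<^bsub>V n\<^esub> x" and v = "\<lambda>c. c"])
    fix c assume c: "c \<in> carrier (add_grp A)" "c \<odot>\<^bsub>V n\<^esub> x = \<one>\<^bsub>add_grp (V n)\<^esub>"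
    show "c = \<one>\<^bsub>add_grp A\<^esub>"
    proof (rule ccontr)
      assume "c \<noteq> \<one>\<^bsub>add_grp A\<^esub>"
      then have u: "c \<in> Units A" using c field_Units by simp
      have "x = (inv c \<otimes> c) \<odot>\<^bsub>V n\<^esub> x" using u x by simp
      also have "\<dots> = inv c \<odot>\<^bsub>V n\<^esub> \<zero>\<^bsub>V n\<^esub>" using u x c by (subst V.smult_assoc1) auto
      also have "\<dots> = \<zero>\<^bsub>V n\<^esub>" using u by simp
      finally show False using x by simp
    qed
  qed (use x in \<open>auto intro!: homI simp: V.smult_l_distr V.smult_assoc1\<close>)
  then obtain g where g: "g \<in> hom (add_grp (V n)) (add_grp A)"
      "\<And>k y. k \<in> carrier A \<Longrightarrow> y \<in> carrier (V n) \<Longrightarrow> g (k \<odot>\<^bsub>V n\<^esub> y) = k \<otimes> g y"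
      "\<And>c. c \<in> carrier A \<Longrightarrow> g (c \<odot>\<^bsub>V n\<^esub> x) = c" by auto
  have "restrict g (carrier (V n)) \<in> functionals A (V n)"
    by (rule functionalsI) (use g in \<open>auto simp: hom_def\<close>)
  moreover have "g x = \<one>" using g(3)[of \<one>] x by simp
  ultimately show ?thesis using x by (intro bexI[of _ "restrict g (carrier (V n))"]) auto
qed

end

section \<open>Torsion for the degree filtration\<close>

context graded_left_module
begin

lemma gspan_submodule:
  assumes "gsubmodule R M N" shows "gspan R M N = N"
proof
  fix n show "gspan R M N n = N n" using assms by (auto simp: gspan_def)
qed

lemma gsubmodule_annihilator:
  assumes x: "x \<in> carrier (mgrp M d)" shows "gsubmodule R (reg R) (annihilator R M d x)"
  unfolding gsubmodule_def
proof (intro conjI allI ballI)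
  fix n show "subgroup (annihilator R M d x n) (mgrp (reg R) n)"
    unfolding reg_def gmod.simps
  proof (rule rg.subgroupI)
    show "annihilator R M d x n \<subseteq> carrier (rgrp R n)" by (auto simp: annihilator_def)
    show "annihilator R M d x n \<noteq> {}" using act_zero[OF x] by (auto simp: annihilator_def)
    fix r assume r: "r \<in> annihilator R M d x n"
    then have rc: "r \<in> carrier (rgrp R n)" and r1: "act M n d r x = \<one>\<^bsub>mgrp M (n + d)\<^esub>" by (auto simp: annihilator_def)
    have "act M n d (inv\<^bsub>rgrp R n\<^esub> r) x \<otimes>\<^bsub>mgrp M (n + d)\<^esub> act M n d r x = \<one>\<^bsub>mgrp M (n + d)\<^esub>"
      using act_add[of "inv\<^bsub>rgrp R n\<^esub> r" n r x d] rc x act_zero[OF x, of n] by simp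
    then show "inv\<^bsub>rgrp R n\<^esub> r \<in> annihilator R M d x n" using rc x r1 by (simp add: annihilator_def)
    show "r \<otimes>\<^bsub>rgrp R n\<^esub> s \<in> annihilator R M d x n" if "s \<in> annihilator R M d x n" for s
      using r that x by (simp add: annihilator_def act_add)
  qed
next
  fix p q r s assume "r \<in> carrier (rgrp R p)" "s \<in> annihilator R M d x q"
  then show "act (reg R) p q r s \<in> annihilator R M d x (p + q)"
    using x by (simp add: annihilator_def reg_def act_assoc add.assoc)
qed

end

lemma gsubmodule_Inter:
  assumes "graded_ring R" "gmodule R M" "F \<noteq> {}" "\<And>I. I \<in> F \<Longrightarrow> gsubmodule R M I"
  shows "gsubmodule R M (\<lambda>n. \<Inter>I\<in>F. I n)"
proof -
  interpret graded_left_module R M using assms by unfold_locales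
  have "subgroup (\<Inter>I\<in>F. I n) (mgrp M n)" for n
    by (rule mg.subgroups_Inter) (use assms(3) gsubmoduleD(1)[OF assms(4)] in auto)
  then show ?thesis
    unfolding gsubmodule_def using gsubmoduleD(6)[OF assms(4)] by auto
qed

locale nonnegative_graded_ring = graded_ring_over R for R :: "'r gring" +
  assumes negative: "n < 0 \<Longrightarrow> carrier (rgrp R n) = {\<one>\<^bsub>rgrp R n\<^esub>}"
    and nontrivial: "rone R \<noteq> \<one>\<^bsub>rgrp R 0\<^esub>"
begin

lemma deg_ideal_eq: "deg_ideal R j n = (if int j \<le> n then carrier (rgrp R n) else {\<one>\<^bsub>rgrp R n\<^esub>})"
  and deg_ideal_submodule: "gsubmodule R (reg R) (deg_ideal R j)"
proof -
  interpret reg: graded_left_module R "reg R" using regular_module by unfold_locales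
  define J where "J n = (if int j \<le> n then carrier (rgrp R n) else {\<one>\<^bsub>rgrp R n\<^esub>})" for n
  have J: "gsubmodule R (reg R) J"
    unfolding gsubmodule_def
  proof (intro conjI allI ballI)
    show "subgroup (J n) (mgrp (reg R) n)" for n
      using rg.subgroup_self rg.triv_subgroup by (auto simp: J_def reg_def)
    fix p q r s assume r: "r \<in> carrier (rgrp R p)" and s: "s \<in> J q"
    have sc: "s \<in> carrier (rgrp R q)" using s by (auto simp: J_def split: if_splits)
    show "act (reg R) p q r s \<in> J (p + q)"
    proof (cases "int j \<le> p + q \<or> s = \<one>\<^bsub>rgrp R q\<^esub>")
      case True
      then show ?thesis using r sc reg.act_one[OF r, of q] by (auto simp: J_def reg_def)
    next
      case False
      then have "p < 0" using s by (auto simp: J_def split: if_splits)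
      then show ?thesis using r negative reg.act_zero[of s q p] sc by (auto simp: J_def reg_def)
    qed
  qed
  have eq: "deg_ideal R j n = J n" for n
  proof
    show "deg_ideal R j n \<subseteq> J n" unfolding deg_ideal_def gspan_def
    proof (rule INF_lower)
      show "J \<in> {N. gsubmodule R (reg R) N \<and> (\<forall>k. (if int j \<le> k then carrier (rgrp R k) else {}) \<subseteq> N k)}"
        using J by (simp add: J_def)
    qed
    show "J n \<subseteq> deg_ideal R j n"
      unfolding deg_ideal_def gspan_def
    proof (rule INF_greatest)
      fix N assume "N \<in> {N. gsubmodule R (reg R) N \<and> (\<forall>k. (if int j \<le> k then carrier (rgrp R k) else {}) \<subseteq> N k)}"
      then have N: "gsubmodule R (reg R) N" "(if int j \<le> n then carrier (rgrp R n) else {}) \<subseteq> N n" by blast+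
      show "J n \<subseteq> N n"
        using N(2) gsubmoduleD(3)[OF N(1), of n] by (simp add: J_def reg_def split: if_splits)
    qed
  qed
  show "deg_ideal R j n = (if int j \<le> n then carrier (rgrp R n) else {\<one>\<^bsub>rgrp R n\<^esub>})"
    by (simp add: eq J_def)
  have "deg_ideal R j = J" by (rule ext) (rule eq)
  then show "gsubmodule R (reg R) (deg_ideal R j)" using J by simp
qed

lemma deg_ideal_antimono: "j \<le> k \<Longrightarrow> deg_ideal R k \<le> deg_ideal R j"
  by (auto simp: le_fun_def deg_ideal_eq)

lemma filtered_grad: "filtered_ideal_set R (grad R)"
  unfolding filtered_ideal_set_def ideal_set_def
proof (intro conjI ballI)
  fix I assume "I \<in> grad R"
  then obtain j where j: "j \<ge> 1" "I = deg_ideal R j" by (auto simp: grad_def)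
  show "homog_left_ideal R I" using j deg_ideal_submodule by (simp add: homog_left_ideal_def)
  have "I 0 = {\<one>\<^bsub>rgrp R 0\<^esub>}" using j by (simp add: deg_ideal_eq)
  then have "I 0 \<noteq> carrier (rgrp R 0)" using nontrivial rone_closed by fastforce
  then show "\<exists>n. I n \<noteq> carrier (rgrp R n)" by blast
  fix J assume "J \<in> grad R"
  then obtain k where k: "k \<ge> 1" "J = deg_ideal R k" by (auto simp: grad_def)
  have "deg_ideal R (max j k) \<in> grad R" using j by (auto simp: grad_def)
  then show "\<exists>K\<in>grad R. K \<le> I \<and> K \<le> J"
    using j k deg_ideal_antimono[of j "max j k"] deg_ideal_antimono[of k "max j k"] by auto
qed

text \<open>
  If \<open>I\<^sub>j\<close> kills \<open>x\<close>, it also kills \<open>r x\<close>: for \<open>s\<close> of degree at least \<open>j\<close> the product \<open>s r\<close> has degree at least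
  \<open>j\<close> too, as \<open>r\<close> has nonnegative degree.
\<close>

lemma grad_torsion_submodule:
  assumes M: "gmodule R M"
  shows "gsubmodule R M (\<lambda>n. \<Union>j\<in>{1 :: nat..}. killed M (deg_ideal R j) n)"
  unfolding gsubmodule_def
proof (intro conjI allI ballI)
  interpret M: graded_left_module R M using M by unfold_locales
  show "subgroup (\<Union>j\<in>{1 :: nat..}. killed M (deg_ideal R j) n) (mgrp M n)" for n
  proof (rule M.mg.subgroup_directed_Union)
    fix i j :: nat assume "i \<in> {1..}" "j \<in> {1..}"
    then show "\<exists>k\<in>{1..}. killed M (deg_ideal R i) n \<subseteq> killed M (deg_ideal R k) n \<and>
        killed M (deg_ideal R j) n \<subseteq> killed M (deg_ideal R k) n"
      by (intro bexI[of _ "max i j"] conjI killed_antimono deg_ideal_antimono) auto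
  qed (auto intro: M.killed_subgroup deg_ideal_submodule)
  fix p q r x assume r: "r \<in> carrier (rgrp R p)" and "x \<in> (\<Union>j\<in>{1 :: nat..}. killed M (deg_ideal R j) q)"
  then obtain j :: nat where j: "j \<ge> 1" and xk: "x \<in> killed M (deg_ideal R j) q" by auto
  then have x: "x \<in> carrier (mgrp M q)" by (simp add: killed_def)
  have "act M p q r x \<in> killed M (deg_ideal R j) (p + q)"
  proof (cases "p < 0")
    case True
    then have "act M p q r x = \<one>\<^bsub>mgrp M (p + q)\<^esub>" using r negative M.act_zero[OF x, of p] by auto
    then show ?thesis using subgroup.one_closed[OF M.killed_subgroup[OF deg_ideal_submodule]] by simp
  next
    case False
    have "act M n (p + q) s (act M p q r x) = \<one>\<^bsub>mgrp M (n + (p + q))\<^esub>" if s: "s \<in> deg_ideal R j n" for n s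
    proof (cases "int j \<le> n")
      case True
      then have sc: "s \<in> carrier (rgrp R n)" using s by (simp add: deg_ideal_eq)
      have "rmul R n p s r \<in> deg_ideal R j (n + p)"
        using rmul_closed[OF sc r] True False by (simp add: deg_ideal_eq)
      then have "act M (n + p) q (rmul R n p s r) x = \<one>\<^bsub>mgrp M (n + p + q)\<^esub>" using xk by (simp add: killed_def)
      then show ?thesis using M.act_assoc[OF sc r x] by (simp add: add.assoc)
    next
      case False
      then have "s = \<one>\<^bsub>rgrp R n\<^esub>" using s by (simp add: deg_ideal_eq)
      then show ?thesis using M.act_zero[of "act M p q r x" "p + q" n] r x by simp
    qed
    then show ?thesis using r x by (simp add: killed_def)
  qed
  then show "act M p q r x \<in> (\<Union>j\<in>{1 :: nat..}. killed M (deg_ideal R j) (p + q))" using j by auto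
qed

text \<open>
  Equivalent ideal sets kill the same elements. By the preceding lemma these form a submodule already,
  so that passing to the generated subgroup or submodule changes nothing.
\<close>

lemma torsion_of_equivalent:
  assumes M: "gmodule R M" and eq: "ideal_sets_equivalent S (grad R)"
  shows "(\<Union>I\<in>S. killed M I n) = (\<Union>j\<in>{1 :: nat..}. killed M (deg_ideal R j) n)"
    and "h0 M S n = (\<Union>I\<in>S. killed M I n)"
    and "H0 R M S n = (\<Union>I\<in>S. killed M I n)"
proof -
  interpret M: graded_left_module R M using M by unfold_locales
  let ?N = "\<lambda>n. \<Union>j\<in>{1 :: nat..}. killed M (deg_ideal R j) n"
  have N: "(\<Union>I\<in>S. killed M I n) = ?N n" for n
  proof
    show "(\<Union>I\<in>S. killed M I n) \<subseteq> ?N n"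
    proof (rule UN_least)
      fix I assume "I \<in> S"
      then obtain j where "j \<ge> 1" "deg_ideal R j \<le> I"
        using eq by (fastforce simp: ideal_sets_equivalent_def ideal_set_le_def grad_def)
      then show "killed M I n \<subseteq> ?N n" using killed_antimono[of "deg_ideal R j" I M n] by auto
    qed
    show "?N n \<subseteq> (\<Union>I\<in>S. killed M I n)"
    proof (rule UN_least)
      fix j :: nat assume "j \<in> {1..}"
      then have "deg_ideal R j \<in> grad R" by (auto simp: grad_def)
      then obtain I where "I \<in> S" "I \<le> deg_ideal R j"
        using eq unfolding ideal_sets_equivalent_def ideal_set_le_def by blast
      then show "killed M (deg_ideal R j) n \<subseteq> (\<Union>I\<in>S. killed M I n)" using killed_antimono[of I "deg_ideal R j" M n] by auto
    qed
  qed
  show "(\<Union>I\<in>S. killed M I n) = ?N n" by (rule N)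
  note sub = grad_torsion_submodule[OF M]
  have h0: "h0 M S n = ?N n" for n
  proof -
    have "{x \<in> carrier (mgrp M n). \<exists>I\<in>S. \<forall>p. \<forall>r\<in>I p. act M p n r x = \<one>\<^bsub>mgrp M (p + n)\<^esub>} = (\<Union>I\<in>S. killed M I n)"
      by (auto simp: killed_def)
    then have "h0 M S n = generate (mgrp M n) (?N n)" unfolding h0_def N by simp
    also have "\<dots> = ?N n"
      using M.mg.generate_subgroup_incl[OF order_refl gsubmoduleD(1)[OF sub, of n]] generate.incl[of _ "?N n" "mgrp M n"] by blast
    finally show ?thesis .
  qed
  then show "h0 M S n = (\<Union>I\<in>S. killed M I n)" by (simp add: N)
  have "h0 M S = ?N" by (rule ext) (rule h0)
  then show "H0 R M S n = (\<Union>I\<in>S. killed M I n)"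
    unfolding H0_def N using M.gspan_submodule[OF sub] by simp
qed

end

section \<open>Distinguished ideals and the degree filtration\<close>

context coalgebra_over_field
begin

lemma iota_module: "graded_left_module R (iota C)"
  using dual_graded_ring iota_gmodule by unfold_locales

lemma dual_zero_iff:
  "f \<in> functionals A (V (- n)) \<Longrightarrow> f = \<one>\<^bsub>rgrp R n\<^esub> \<longleftrightarrow> (\<forall>x\<in>carrier (V (- n)). f x = \<zero>)"
  unfolding dual_simps by (auto intro!: extensionalityI[of f "carrier (V (- n))"] dest: functionalsD(2))

text \<open>
  A functional is determined by its values on a finite spanning set. Zero is removed from this set
  since only annihilators of nonzero elements are strongly distinguished.
\<close>

lemma finite_separating_set:
  assumes fin: "fin_dim A (V (- n))"
  shows "\<exists>X. finite X \<and> X \<subseteq> carrier (V (- n)) - {\<zero>\<^bsub>V (- n)\<^esub>} \<and>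
    (\<forall>f\<in>functionals A (V (- n)). (\<forall>x\<in>X. f x = \<zero>) \<longrightarrow> f = \<one>\<^bsub>rgrp R n\<^esub>)"
proof -
  obtain X where X: "finite X" "X \<subseteq> carrier (V (- n))"
    and gen: "carrier (V (- n)) = generate (add_grp (V (- n))) {c \<odot>\<^bsub>V (- n)\<^esub> x |c x. c \<in> carrier A \<and> x \<in> X}"
    using fin unfolding fin_dim_def by blast
  interpret G: comm_group "add_grp (V (- n))" by (rule V.comm_group_add)
  have "f = \<one>\<^bsub>rgrp R n\<^esub>" if f: "f \<in> functionals A (V (- n))" and 0: "\<forall>x\<in>X - {\<zero>\<^bsub>V (- n)\<^esub>}. f x = \<zero>" for f
  proof -
    have fX: "f x = \<zero>" if "x \<in> X" for x
      using 0 that functional_zero[OF f] by (cases "x = \<zero>\<^bsub>V (- n)\<^esub>") auto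
    have "f y = \<zero>" if "y \<in> generate (add_grp (V (- n))) {c \<odot>\<^bsub>V (- n)\<^esub> x |c x. c \<in> carrier A \<and> x \<in> X}" for y
      using that
    proof (induction rule: generate.induct)
      case one
      then show ?case using functional_zero[OF f] by simp
    next
      case (incl h)
      then show ?case using functionalsD(4)[OF f] X fX by auto
    next
      case (inv h)
      then obtain c x where h: "h = c \<odot>\<^bsub>V (- n)\<^esub> x" "c \<in> carrier A" "x \<in> X" by blast
      then have hc: "h \<in> carrier (V (- n))" and fh: "f h = \<zero>" using functionalsD(4)[OF f] X fX by auto
      have ic: "inv\<^bsub>add_grp (V (- n))\<^esub> h \<in> carrier (V (- n))" using G.inv_closed[of h] hc by simp
      have "inv\<^bsub>add_grp (V (- n))\<^esub> h \<oplus>\<^bsub>V (- n)\<^esub> h = \<zero>\<^bsub>V (- n)\<^esub>" using G.l_inv[of h] hc by simp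
      then have "f (inv\<^bsub>add_grp (V (- n))\<^esub> h) \<oplus> f h = \<zero>"
        using functionalsD(3)[OF f ic hc] functional_zero[OF f] by simp
      then show ?case using fh functionalsD(1)[OF f ic] by simp
    next
      case (eng h k)
      then have "h \<in> carrier (V (- n))" "k \<in> carrier (V (- n))" using gen by blast+
      then show ?case using functionalsD(3)[OF f] eng by simp
    qed
    then show ?thesis using dual_zero_iff[OF f] gen by blast
  qed
  then show ?thesis using X by (intro exI[of _ "X - {\<zero>\<^bsub>V (- n)\<^esub>}"]) auto
qed

text \<open>
  This is \<open>f x = \<epsilon> (f \<cdot> x) = 0\<close>.
\<close>

lemma annihilator_functional_zero:
  assumes f: "f \<in> annihilator R (iota C) (- n) x n" and x: "x \<in> carrier (V (- n))"
  shows "f x = \<zero>"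
proof -
  have "f \<in> functionals A (V (- n))" "act (iota C) n (- n) f x = \<zero>\<^bsub>V 0\<^esub>"
    using f by (simp_all add: annihilator_def iota_simps)
  then show ?thesis using counit_act[of f n x] x functional_zero[OF counit_functional] by simp
qed

end

locale nonpositive_coalgebra = coalgebra_over_field A C for A :: "'a ring" (structure) and C :: "('a, 'v) gcoalg" +
  assumes positive: "n > 0 \<Longrightarrow> carrier (V n) = {\<zero>\<^bsub>V n\<^esub>}"
    and degree_0: "carrier (V 0) \<noteq> {\<zero>\<^bsub>V 0\<^esub>}"
    and finite_type: "\<And>n. fin_dim A (V n)"
begin

lemma nonzero_degree_0: "\<exists>x\<in>carrier (V 0). x \<noteq> \<zero>\<^bsub>V 0\<^esub>"
  using degree_0 V.M.zero_closed[of 0] by blast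

sublocale dual: nonnegative_graded_ring R
proof (intro nonnegative_graded_ring.intro nonnegative_graded_ring_axioms.intro graded_ring_over.intro)
  show "graded_ring R" by (rule dual_graded_ring)
  interpret iota: graded_left_module R "iota C" by (rule iota_module)
  show "carrier (rgrp R n) = {\<one>\<^bsub>rgrp R n\<^esub>}" if "n < 0" for n
  proof -
    have "f = \<one>\<^bsub>rgrp R n\<^esub>" if f: "f \<in> functionals A (V (- n))" for f
      using dual_zero_iff[OF f] positive[of "- n"] \<open>n < 0\<close> functional_zero[OF f] by simp
    then show ?thesis using iota.rg.one_closed[of n] unfolding dual_carrier by blast
  qed
  show "rone R \<noteq> \<one>\<^bsub>rgrp R 0\<^esub>"
  proof
    assume e: "rone R = \<one>\<^bsub>rgrp R 0\<^esub>"
    obtain x where x: "x \<in> carrier (V 0)" "x \<noteq> \<zero>\<^bsub>V 0\<^esub>" using nonzero_degree_0 by blast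
    then have "x = \<zero>\<^bsub>V 0\<^esub>" using iota.act_unit[of x 0] iota.act_zero[of x 0 0] e by (simp add: iota_simps)
    then show False using x by simp
  qed
qed

text \<open>
  For the last claim, a functional of degree \<open>n > - d\<close> moves an element of degree \<open>d\<close> into the positive
  degree \<open>n + d\<close>, where the coalgebra vanishes.
\<close>

lemma strongly_distinguished_ideal:
  assumes "strongly_distinguished A C I"
  shows "gsubmodule R (reg R) I" and "rone R \<notin> I 0" and "\<exists>j\<ge>1. deg_ideal R j \<le> I"
proof -
  interpret iota: graded_left_module R "iota C" by (rule iota_module)
  obtain d x where x: "x \<in> carrier (V d)" "x \<noteq> \<zero>\<^bsub>V d\<^esub>" and I: "I = annihilator R (iota C) d x"
    using assms by (auto simp: strongly_distinguished_def iota_simps)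
  have xc: "x \<in> carrier (mgrp (iota C) d)" using x by (simp add: iota_simps)
  show "gsubmodule R (reg R) I" unfolding I by (rule iota.gsubmodule_annihilator[OF xc])
  show "rone R \<notin> I 0" using iota.act_unit[OF xc] x by (simp add: I annihilator_def iota_simps)
  \<comment> \<open>Degrees from \<open>1 - d\<close> on move \<open>x\<close> into positive degrees; the degree filtration starts with \<open>j = 1\<close>.\<close>
  have "deg_ideal R (max 1 (nat (1 - d))) \<le> I"
    unfolding le_fun_def
  proof (intro allI subsetI)
    fix n f assume f: "f \<in> deg_ideal R (max 1 (nat (1 - d))) n"
    then have fc: "f \<in> carrier (rgrp R n)"
      using dual.rg.one_closed[of n] by (simp add: dual.deg_ideal_eq del: dual_carrier split: if_splits)
    show "f \<in> I n"
    proof (cases "int (max 1 (nat (1 - d))) \<le> n")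
      case True
      then have "carrier (mgrp (iota C) (n + d)) = {\<zero>\<^bsub>V (n + d)\<^esub>}" using positive[of "n + d"] by (simp add: iota_simps)
      then show ?thesis using iota.act_closed[OF fc xc] fc by (simp add: I annihilator_def iota_simps)
    next
      case False
      then have "f = \<one>\<^bsub>rgrp R n\<^esub>" using f by (simp add: dual.deg_ideal_eq)
      then show ?thesis using iota.act_zero[OF xc] fc by (simp add: I annihilator_def)
    qed
  qed
  then show "\<exists>j\<ge>1. deg_ideal R j \<le> I" by (intro exI[of _ "max 1 (nat (1 - d))"]) auto
qed

lemma filtered_dist: "filtered_ideal_set R (dist A C)"
  unfolding filtered_ideal_set_def ideal_set_def
proof (intro conjI ballI)
  fix I assume "I \<in> dist A C"
  then obtain F where F: "finite F" "F \<noteq> {}" "\<And>I. I \<in> F \<Longrightarrow> strongly_distinguished A C I" "I = (\<lambda>n. \<Inter>I\<in>F. I n)"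
    by (auto simp: dist_def)
  show "homog_left_ideal R I" unfolding homog_left_ideal_def F(4)
    by (rule gsubmodule_Inter[OF dual_graded_ring dual.regular_module F(2)]) (rule strongly_distinguished_ideal(1)[OF F(3)])
  have "rone R \<notin> I 0" using F strongly_distinguished_ideal(2) by blast
  then show "\<exists>n. I n \<noteq> carrier (rgrp R n)" using dual.rone_closed by metis
  fix J assume "J \<in> dist A C"
  then obtain G where G: "finite G" "G \<noteq> {}" "\<And>I. I \<in> G \<Longrightarrow> strongly_distinguished A C I" "J = (\<lambda>n. \<Inter>I\<in>G. I n)"
    by (auto simp: dist_def)
  have "(\<lambda>n. \<Inter>I\<in>F \<union> G. I n) \<in> dist A C" unfolding dist_def using F(1-3) G(1-3) by blast
  moreover have "(\<lambda>n. \<Inter>I\<in>F \<union> G. I n) \<le> I" "(\<lambda>n. \<Inter>I\<in>F \<union> G. I n) \<le> J" by (auto simp: le_fun_def F(4) G(4))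
  ultimately show "\<exists>K\<in>dist A C. K \<le> I \<and> K \<le> J" by blast
qed

text \<open>
  Each strongly distinguished ideal contains some \<open>I\<^sub>j\<close>, hence so does a finite intersection. In the other
  direction, intersect the annihilators of finite spanning sets in the degrees \<open>- n\<close> for \<open>0 \<le> n < j\<close>: what
  remains vanishes in degrees below \<open>j\<close>.
\<close>

lemma dist_equivalent_grad: "ideal_sets_equivalent (dist A C) (grad R)"
  unfolding ideal_sets_equivalent_def ideal_set_le_def
proof (intro conjI ballI)
  fix I assume "I \<in> dist A C"
  then obtain F where F: "finite F" "F \<noteq> {}" "\<And>I. I \<in> F \<Longrightarrow> strongly_distinguished A C I" "I = (\<lambda>n. \<Inter>I\<in>F. I n)"
    by (auto simp: dist_def)
  have "\<exists>j\<ge>1. \<forall>I\<in>F. deg_ideal R j \<le> I" using F(1,3)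
  proof (induction F)
    case (insert I F)
    then obtain j where j: "j \<ge> 1" "\<forall>I\<in>F. deg_ideal R j \<le> I" by blast
    obtain k where k: "k \<ge> 1" "deg_ideal R k \<le> I" using strongly_distinguished_ideal(3) insert.prems by blast
    show ?case
      using j k dual.deg_ideal_antimono[of j "max j k"] dual.deg_ideal_antimono[of k "max j k"]
      by (intro exI[of _ "max j k"]) (auto intro: order_trans)
  qed auto
  then obtain j where j: "j \<ge> 1" "\<And>I. I \<in> F \<Longrightarrow> deg_ideal R j \<le> I" by blast
  have "deg_ideal R j \<le> I" using j(2) by (auto simp: F(4) le_fun_def)
  then show "\<exists>J\<in>grad R. J \<le> I" using j(1) by (auto simp: grad_def)
next
  fix I assume "I \<in> grad R"
  then obtain j where j: "j \<ge> 1" "I = deg_ideal R j" by (auto simp: grad_def)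
  obtain X where X: "\<And>n. finite (X n) \<and> X n \<subseteq> carrier (V (- n)) - {\<zero>\<^bsub>V (- n)\<^esub>} \<and>
    (\<forall>f\<in>functionals A (V (- n)). (\<forall>x\<in>X n. f x = \<zero>) \<longrightarrow> f = \<one>\<^bsub>rgrp R n\<^esub>)"
    using finite_separating_set[OF finite_type] by metis
  define F where "F = (\<Union>n\<in>{0..<int j}. annihilator R (iota C) (- n) ` X n)"
  have "finite F" using X by (simp add: F_def)
  moreover have "strongly_distinguished A C I" if "I \<in> F" for I
    using that X by (fastforce simp: F_def strongly_distinguished_def iota_simps)
  moreover have "F \<noteq> {}"
  proof -
    \<comment> \<open>The intersection has to be nonempty; the counit is a nonzero functional of degree \<open>0\<close>, which is below \<open>j\<close>.\<close>
    have "X 0 \<noteq> {}"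
    proof
      assume "X 0 = {}"
      then have "counit C = \<one>\<^bsub>rgrp R 0\<^esub>" using X[of 0] counit_functional by simp
      then show False using dual.nontrivial by (simp add: dual_simps(3))
    qed
    then show ?thesis using j by (auto simp: F_def)
  qed
  ultimately have "(\<lambda>n. \<Inter>I\<in>F. I n) \<in> dist A C" by (auto simp: dist_def)
  moreover have "(\<lambda>n. \<Inter>I\<in>F. I n) \<le> I"
    unfolding le_fun_def
  proof (intro allI subsetI)
    fix n f assume f: "f \<in> (\<Inter>I\<in>F. I n)"
    have fc: "f \<in> carrier (rgrp R n)" using f \<open>F \<noteq> {}\<close> by (auto simp: F_def annihilator_def)
    show "f \<in> I n"
    proof (cases "int j \<le> n \<or> n < 0")
      case True
      then show ?thesis using fc dual.negative by (auto simp: j(2) dual.deg_ideal_eq simp del: dual_carrier)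
    next
      case False
      then have "f x = \<zero>" if "x \<in> X n" for x
        using f that X[of n] annihilator_functional_zero[of f n x] by (fastforce simp: F_def)
      then have "f = \<one>\<^bsub>rgrp R n\<^esub>" using X[of n] fc by simp
      then show ?thesis using False by (simp add: j(2) dual.deg_ideal_eq)
    qed
  qed
  ultimately show "\<exists>J\<in>dist A C. J \<le> I" by blast
qed

end

text \<open>
  In negative degrees each \<open>\<Gamma>\<^sup>*(n)\<close> vanishes, hence so does \<open>\<Gamma>\<^sup>*\<close>, as the maps \<open>\<sigma>\<^sub>n\<close> are jointly injective. In degree
  zero, \<open>\<Gamma>\<close> surjects onto \<open>\<Gamma>(0)\<close>, whose dual is one-dimensional there.
\<close>

lemma mitchell_nonpositive:
  assumes A: "field A" and \<Gamma>: "gcoalgebra A \<Gamma>" and fin: "finite_type A \<Gamma>"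
    and D: "mitchell_decomposition U A \<Gamma> D"
  shows "nonpositive_coalgebra A \<Gamma>"
proof -
  interpret coalgebra_over_field A \<Gamma> using A \<Gamma> by (simp add: coalgebra_over_field_def coalgebra_over_field_axioms_def)
  have iso: "(\<lambda>k f n. sigma D n k f) \<in> miso R (reg R) (seq_limit (ext_mod A D) (sigma_trn D))"
    using D unfolding mitchell_decomposition_def by blast
  have PA: "poincare_algebra A (dual_alg A (quo D n))" and Q: "gcoalgebra A (quo D n)"
    and pr: "proj D n \<in> coalg_epis A \<Gamma> (quo D n)" for n
    using D unfolding mitchell_decomposition_def by blast+
  have neg: "carrier (rgrp R k) = {\<one>\<^bsub>rgrp R k\<^esub>}" if k: "k < 0" for k
  proof -
    have inj: "inj_on (\<lambda>f n. sigma D n k f) (carrier (rgrp R k))"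
      and cl: "\<And>f. f \<in> carrier (rgrp R k) \<Longrightarrow>
        (\<lambda>n. sigma D n k f) \<in> carrier (mgrp (seq_limit (ext_mod A D) (sigma_trn D)) k)"
      using iso by (auto simp: miso_def giso_def iso_def bij_betw_def reg_def)
    have zero: "sigma D n k f = \<zero>\<^bsub>avec (dual_alg A (quo D n)) k\<^esub>" if "f \<in> carrier (rgrp R k)" for f n
    proof -
      have "sigma D n k f \<in> carrier (avec (dual_alg A (quo D n)) k)"
        using cl[OF that] by (simp add: seq_limit_def ext_mod_def gring_of_def)
      then show ?thesis using PA[of n] k by (simp add: poincare_algebra_def)
    qed
    interpret G: comm_group "rgrp R k" by (rule comm_group_dual)
    have "f = \<one>\<^bsub>rgrp R k\<^esub>" if "f \<in> carrier (rgrp R k)" for f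
      by (rule inj_onD[OF inj _ that G.one_closed]) (rule ext, simp only: zero[OF that] zero[OF G.one_closed])
    then show ?thesis using G.one_closed by blast
  qed
  show ?thesis
  proof (intro nonpositive_coalgebra.intro nonpositive_coalgebra_axioms.intro)
    show "coalgebra_over_field A \<Gamma>" by (rule coalgebra_over_field_axioms)
    show "fin_dim A (cvec \<Gamma> n)" for n using fin by (simp add: finite_type_def)
    show "carrier (cvec \<Gamma> n) = {\<zero>\<^bsub>cvec \<Gamma> n\<^esub>}" if n: "n > 0" for n
    proof -
      have "x = \<zero>\<^bsub>V n\<^esub>" if x: "x \<in> carrier (V n)" for x
      proof (rule ccontr)
        assume "x \<noteq> \<zero>\<^bsub>V n\<^esub>"
        then obtain f where f: "f \<in> functionals A (V n)" "f x \<noteq> \<zero>\<^bsub>A\<^esub>" using functionals_separate[OF x] by blast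
        then have "f = \<one>\<^bsub>rgrp R (- n)\<^esub>" using neg[of "- n"] n by auto
        then show False using f x dual_zero_iff[of f "- n"] by simp
      qed
      then show ?thesis using V.M.zero_closed by auto
    qed
    show "carrier (cvec \<Gamma> 0) \<noteq> {\<zero>\<^bsub>cvec \<Gamma> 0\<^esub>}"
    proof
      assume z: "carrier (cvec \<Gamma> 0) = {\<zero>\<^bsub>cvec \<Gamma> 0\<^esub>}"
      interpret Q: coalgebra_over_field A "quo D 0"
        using A Q by (simp add: coalgebra_over_field_def coalgebra_over_field_axioms_def)
      have "one_dim A (avec (dual_alg A (quo D 0)) 0)" using PA[of 0] by (simp add: poincare_algebra_def)
      then obtain f where f: "f \<in> functionals A (cvec (quo D 0) 0)" "f \<noteq> (\<lambda>x\<in>carrier (cvec (quo D 0) 0). \<zero>\<^bsub>A\<^esub>)"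
        by (auto simp: one_dim_def dual_alg_def gdual_def)
      have "proj D 0 0 ` carrier (V 0) = carrier (cvec (quo D 0) 0)" using pr[of 0] by (simp add: coalg_epis_def)
      then have "carrier (cvec (quo D 0) 0) = {\<zero>\<^bsub>cvec (quo D 0) 0\<^esub>}"
        using z Q.V.M.zero_closed[of 0] by (metis image_empty image_insert singletonD)
      then show False using f Q.functional_zero[OF f(1)] Q.dual_zero_iff[of f 0] by (simp add: Q.dual_simps)
    qed
  qed
qed

section \<open>Local cohomology of a Mitchell coalgebra\<close>

theorem theorem5p9:
  fixes A :: "'a ring"
    and \<Gamma> :: "('a, 'g) gcoalg"
    and D :: "('a, 'g, 'q) mitchell_data"
    and R :: "('g \<Rightarrow> 'a) gring"
  assumes "field A"
    and "gcoalgebra A \<Gamma>"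
    and "finite_type A \<Gamma>"
    and "mitchell_decomposition TYPE('u) A \<Gamma> D"
    and R_def: "R = dual_ring A \<Gamma>"
    and size: "large_type TYPE('g \<Rightarrow> 'a) TYPE('u)"
  shows "(filtered_ideal_set R (dist A \<Gamma>) \<and> filtered_ideal_set R (grad R) \<and>
          ideal_sets_equivalent (dist A \<Gamma>) (grad R) \<and>
          closed_ideal_set TYPE('u) R (dist A \<Gamma>))
       \<and> nat_isomorphic R
           (h0_fun (dist A \<Gamma>) :: ('g \<Rightarrow> 'a, 'u, 'u) gfun)
           (forget (H0_fun R (dist A \<Gamma>)))
       \<and> (\<forall>n :: int. nat_isomorphic R
           (forget (local_cohomology R (dist A \<Gamma>) n) :: ('g \<Rightarrow> 'a, 'u, 'u set) gfun)
           (colim_Ext R n (dist A \<Gamma>) (\<lambda>I J. J \<le> I) (\<lambda>I. I)))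
       \<and> (\<forall>n :: int. nat_isomorphic R
           (forget (local_cohomology R (dist A \<Gamma>) n) :: ('g \<Rightarrow> 'a, 'u, 'u set) gfun)
           (colim_Ext R n {1 :: nat..} (\<le>) (deg_ideal R)))"
proof -
  interpret nonpositive_coalgebra A \<Gamma> by (rule mitchell_nonpositive) fact+
  interpret F: graded_ring_over_field A R scalar unfolding R_def by (rule dual_over_field)
  note filt = filtered_dist[folded R_def] and eqv = dist_equivalent_grad[folded R_def]
  have h0_H0: "h0 M (dist A \<Gamma>) = H0 R M (dist A \<Gamma>)" if "gmodule R M" for M :: "('g \<Rightarrow> 'a, 'u) gmod"
    using dual.torsion_of_equivalent(2,3)[folded R_def, OF that eqv] by (intro ext) simp
  have iso: "(\<lambda>n x. x) \<in> giso (mgrp (submod M (h0 M (dist A \<Gamma>)))) (mgrp (submod M (H0 R M (dist A \<Gamma>))))"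
    if "gmodule R M" for M :: "('g \<Rightarrow> 'a, 'u) gmod"
    unfolding h0_H0[OF that] by (auto simp: giso_def iso_def hom_def bij_betw_def)
  have res: "injective_resolution R M (inj_res R M)" if "gmodule R M" for M :: "('g \<Rightarrow> 'a, 'u) gmod"
    by (rule inj_res[OF F.graded_ring that F.enough_injectives[OF size]])
  have lc: "forget (local_cohomology R (dist A \<Gamma>) n) = rderived R n (forget (H0_fun R (dist A \<Gamma>)))" for n
    by (simp add: local_cohomology_def mrderived_def forget_def[of "\<lparr>mobj = _, mmor = _\<rparr>"])
  have "torsion_system TYPE('u) R (dist A \<Gamma>) (dist A \<Gamma>) (\<lambda>I J. J \<le> I) (\<lambda>I. I)"
  proof (intro torsion_system.intro torsion_system_axioms.intro F.graded_ring_over_axioms res)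
    show "dist A \<Gamma> \<noteq> {}" using eqv dual.filtered_grad[folded R_def]
      by (fastforce simp: ideal_sets_equivalent_def ideal_set_le_def grad_def)
    show "\<exists>K\<in>dist A \<Gamma>. K \<le> I \<and> K \<le> J" if "I \<in> dist A \<Gamma>" "J \<in> dist A \<Gamma>" for I J
      using filt that by (simp add: filtered_ideal_set_def)
    show "gsubmodule R (reg R) I" if "I \<in> dist A \<Gamma>" for I
      using filt that by (simp add: filtered_ideal_set_def ideal_set_def homog_left_ideal_def)
    show "H0 R M (dist A \<Gamma>) d = (\<Union>I\<in>dist A \<Gamma>. killed M I d)" if "gmodule R M" for M :: "('g \<Rightarrow> 'a, 'u) gmod" and d
      by (rule dual.torsion_of_equivalent(3)[folded R_def, OF that eqv])
  qed auto
  note part3 = torsion_system.derived_torsion_colim_Ext[OF this]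
  have "torsion_system TYPE('u) R (dist A \<Gamma>) {1 :: nat..} (\<le>) (deg_ideal R)"
  proof (intro torsion_system.intro torsion_system_axioms.intro F.graded_ring_over_axioms res)
    show "\<exists>k\<in>{1 :: nat..}. i \<le> k \<and> j \<le> k" if "i \<in> {1..}" "j \<in> {1..}" for i j
      using that by (intro bexI[of _ "max i j"]) auto
    show "gsubmodule R (reg R) (deg_ideal R i)" for i by (rule dual.deg_ideal_submodule[folded R_def])
    show "deg_ideal R j \<le> deg_ideal R i" if "i \<le> j" for i j by (rule dual.deg_ideal_antimono[folded R_def, OF that])
    show "H0 R M (dist A \<Gamma>) d = (\<Union>i\<in>{1 :: nat..}. killed M (deg_ideal R i) d)" if "gmodule R M" for M :: "('g \<Rightarrow> 'a, 'u) gmod" and d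
      using dual.torsion_of_equivalent(1,3)[folded R_def, OF that eqv] by simp
  qed auto
  note part4 = torsion_system.derived_torsion_colim_Ext[OF this]
  have "nat_isomorphic R (h0_fun (dist A \<Gamma>) :: ('g \<Rightarrow> 'a, 'u, 'u) gfun) (forget (H0_fun R (dist A \<Gamma>)))"
    unfolding nat_isomorphic_def
    by (intro exI[of _ "\<lambda>M n x. x"]) (simp add: h0_fun_def H0_fun_def forget_def iso)
  then show ?thesis
    using filt eqv dual.filtered_grad[folded R_def] iso part3 part4 by (simp add: closed_ideal_set_def lc)
qed

end
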